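(* For any family of rational functions $\mathcal F\subset\mathbb R(x,y)$, its graphoid $\bar\Gamma(\mathcal F)\subset\bar{\mathbb R}^2\times\bar{\mathbb R}^{\mathcal F}$ has covering topological dimension $\dim(\bar\Gamma(\mathcal F))=2$.
   Context: $\bar{\mathbb R}=\mathbb R\cup\{\infty\}$ is the projective real line with the topology of the one-point compactification of $\mathbb R$ (a circle); $\bar{\mathbb R}^2$ is the torus. $\mathbb R(x,y)$ is the field of rational functions in two variables with real coefficients. Each $f\in\mathbb R(x,y)$, written $f=\frac pq$ with $p,q$ relatively prime polynomials, is regarded as a partial function on $\bar{\mathbb R}^2$: it is the continuous function $f:\mathrm{dom}(f)\to\bar{\mathbb R}$, $f(x,y)=p(x,y)/q(x,y)$ (with value $\infty$ where $q=0$), defined on the open dense subset $\mathrm{dom}(f)=\mathbb R^2\setminus(p^{-1}(0)\cap q^{-1}(0))$ of $\bar{\mathbb R}^2$. Graphoid of a (possibly uncountable) family $\mathcal F\subset\mathbb R(x,y)$: the graphoid extension of $\mathcal F$ is the multi-valued function $\bar{\mathcal F}$ assigning to each $z\in\bar{\mathbb R}^2$ the set $\bar{\mathcal F}(z)$ of all points $w=(w_f)_{f\in\mathcal F}\in\bar{\mathbb R}^{\mathcal F}$ such that for any neighborhood $O(z)\subset\bar{\mathbb R}^2$ of $z$, any finite subfamily $\mathcal E\subset\mathcal F$, and any neighborhoods $O(w_f)\subset\bar{\mathbb R}$ of the points $w_f$, $f\in\mathcal E$, there is a point $z'\in O(z)\cap\bigcap_{f\in\mathcal E}\mathrm{dom}(f)$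 with $f(z')\in O(w_f)$ for all $f\in\mathcal E$. The graphoid of $\mathcal F$ is $\bar\Gamma(\mathcal F)=\Gamma(\bar{\mathcal F})=\{(z,w)\in\bar{\mathbb R}^2\times\bar{\mathbb R}^{\mathcal F}:w\in\bar{\mathcal F}(z)\}$, with the subspace topology from the Tychonoff product. If $\mathcal F=\emptyset$, then $\bar{\mathbb R}^{\mathcal F}$ is a singleton and $\bar\Gamma(\mathcal F)=\bar{\mathbb R}^2\times\bar{\mathbb R}^{\emptyset}$. *)

theory Defs
  imports
    "HOL-Analysis.Analysis"
    "HOL-Computational_Algebra.Normalized_Fraction"
    "HOL-Computational_Algebra.Field_as_Ring"
    "HOL-Computational_Algebra.Polynomial_Factorial"
begin

section \<open>The projective real line and the torus\<close>

text \<open>The point at infinity is \<^term>\<open>None\<close>.\<close>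

type_synonym proj_real = "real option"

definition proj_line :: "proj_real topology" where
  "proj_line = Alexandroff_compactification euclideanreal"

definition torus :: "(proj_real \<times> proj_real) topology" where
  "torus = prod_topology proj_line proj_line"

lemma topspace_proj_line [simp]: "topspace proj_line = UNIV"
  by (simp add: proj_line_def UNIV_option_conv)

lemma topspace_torus [simp]: "topspace torus = UNIV"
  by (simp add: torus_def)

section \<open>Rational functions in two variables as partial functions on the torus\<close>

text \<open>
  Bivariate polynomials are represented as polynomials in \<open>y\<close> whose coefficients are
  polynomials in \<open>x\<close>.
\<close>

type_synonym ratfun2 = "real poly poly fract"

definition eval2 :: "real poly poly \<Rightarrow> real \<Rightarrow> real \<Rightarrow> real" where
  "eval2 p x y = poly (poly p [:y:]) x"

text \<open>
  The library function \<^const>\<open>quot_of_fract\<close> chooses a representation \<open>f = p / q\<close> with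
  \<open>p\<close>, \<open>q\<close> coprime. Such a representation is unique up to a common unit factor, that is, up to
  a nonzero real constant, so neither the domain nor the values depend on the choice; see the
  lemmas \<open>rf_dom_Fract\<close> and \<open>rf_val_Fract\<close> below.
\<close>

definition rf_num :: "ratfun2 \<Rightarrow> real poly poly" where
  "rf_num f = fst (quot_of_fract f)"

definition rf_denom :: "ratfun2 \<Rightarrow> real poly poly" where
  "rf_denom f = snd (quot_of_fract f)"

definition rf_dom :: "ratfun2 \<Rightarrow> (proj_real \<times> proj_real) set" where
  "rf_dom f = {(Some x, Some y) |x y. \<not> (eval2 (rf_num f) x y = 0 \<and> eval2 (rf_denom f) x y = 0)}"

text \<open>Only the values at points of \<^term>\<open>rf_dom f\<close> are meaningful.\<close>

fun rf_val :: "ratfun2 \<Rightarrow> proj_real \<times> proj_real \<Rightarrow> proj_real" where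
  "rf_val f (Some x, Some y) =
     (if eval2 (rf_denom f) x y = 0 then None
      else Some (eval2 (rf_num f) x y / eval2 (rf_denom f) x y))"
| "rf_val f _ = undefined"

lemma rf_num_denom_unique:
  assumes "coprime p q" "q \<noteq> 0"
  obtains c where "c \<noteq> 0"
    "\<And>x y. eval2 p x y = c * eval2 (rf_num (Fract p q)) x y"
    "\<And>x y. eval2 q x y = c * eval2 (rf_denom (Fract p q)) x y"
proof -
  have quot: "quot_of_fract (Fract p q) = normalize_quot (p, q)"
    using quot_of_fract_quot_to_fract[of "(p, q)"] by (simp add: quot_to_fract_def)
  from normalize_quotE[OF assms(2), of p] obtain d where
    d: "p = fst (normalize_quot (p, q)) * d" "q = snd (normalize_quot (p, q)) * d"
       "d dvd p" "d dvd q" "d \<noteq> 0" by metis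
  have "is_unit d" using assms(1) d(3,4) by (rule coprime_common_divisor)
  then obtain c where c: "c \<noteq> 0" "d = [:[:c:]:]"
    by (metis is_unit_polyE not_is_unit_0)
  show thesis
  proof
    show "c \<noteq> 0" by fact
    show "eval2 p x y = c * eval2 (rf_num (Fract p q)) x y" for x y
      by (subst d(1)) (simp add: eval2_def rf_num_def quot c(2))
    show "eval2 q x y = c * eval2 (rf_denom (Fract p q)) x y" for x y
      by (subst d(2)) (simp add: eval2_def rf_denom_def quot c(2))
  qed
qed

lemma rf_dom_Fract:
  assumes "coprime p q" "q \<noteq> 0"
  shows "rf_dom (Fract p q) = {(Some x, Some y) |x y. \<not> (eval2 p x y = 0 \<and> eval2 q x y = 0)}"
proof -
  from rf_num_denom_unique[OF assms] obtain c where "c \<noteq> 0"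
    "\<And>x y. eval2 p x y = c * eval2 (rf_num (Fract p q)) x y"
    "\<And>x y. eval2 q x y = c * eval2 (rf_denom (Fract p q)) x y" by blast
  then show ?thesis by (simp add: rf_dom_def)
qed

lemma rf_val_Fract:
  assumes "coprime p q" "q \<noteq> 0"
  shows "rf_val (Fract p q) (Some x, Some y) =
    (if eval2 q x y = 0 then None else Some (eval2 p x y / eval2 q x y))"
proof -
  from rf_num_denom_unique[OF assms] obtain c where "c \<noteq> 0"
    "\<And>x y. eval2 p x y = c * eval2 (rf_num (Fract p q)) x y"
    "\<And>x y. eval2 q x y = c * eval2 (rf_denom (Fract p q)) x y" by blast
  then show ?thesis by simp
qed

section \<open>Graphoids\<close>

definition graphoid_ext ::
    "ratfun2 set \<Rightarrow> proj_real \<times> proj_real \<Rightarrow> (ratfun2 \<Rightarrow> proj_real) set" where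
  "graphoid_ext \<F> z =
     {w \<in> topspace (product_topology (\<lambda>_. proj_line) \<F>).
        \<forall>O\<^sub>z \<E> W. openin torus O\<^sub>z \<and> z \<in> O\<^sub>z \<and> finite \<E> \<and> \<E> \<subseteq> \<F> \<and>
          (\<forall>f\<in>\<E>. openin proj_line (W f) \<and> w f \<in> W f) \<longrightarrow>
          (\<exists>z'\<in>O\<^sub>z \<inter> (\<Inter>f\<in>\<E>. rf_dom f). \<forall>f\<in>\<E>. rf_val f z' \<in> W f)}"

definition graphoid ::
    "ratfun2 set \<Rightarrow> ((proj_real \<times> proj_real) \<times> (ratfun2 \<Rightarrow> proj_real)) set" where
  "graphoid \<F> = {(z, w). z \<in> topspace torus \<and> w \<in> graphoid_ext \<F> z}"

definition graphoid_space ::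
    "ratfun2 set \<Rightarrow> ((proj_real \<times> proj_real) \<times> (ratfun2 \<Rightarrow> proj_real)) topology" where
  "graphoid_space \<F> =
     subtopology (prod_topology torus (product_topology (\<lambda>_. proj_line) \<F>)) (graphoid \<F>)"

section \<open>Covering dimension\<close>

text \<open>
  This is the Lebesgue covering dimension, in terms of finite open covers and the
  order of their finite open refinements. The predicate \<^const>\<open>dimension_le\<close> of the library
  is the small inductive dimension.
\<close>

definition open_cover :: "'a topology \<Rightarrow> 'a set set \<Rightarrow> bool" where
  "open_cover X \<U> \<longleftrightarrow> (\<forall>U\<in>\<U>. openin X U) \<and> \<Union>\<U> = topspace X"

definition covering_dim_le :: "'a topology \<Rightarrow> int \<Rightarrow> bool" where
  "covering_dim_le X n \<longleftrightarrow> -1 \<le> n \<and>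
     (\<forall>\<U>. finite \<U> \<and> open_cover X \<U> \<longrightarrow>
       (\<exists>\<V>. finite \<V> \<and> open_cover X \<V> \<and> (\<forall>V\<in>\<V>. \<exists>U\<in>\<U>. V \<subseteq> U) \<and>
            (\<forall>x\<in>topspace X. int (card {V\<in>\<V>. x \<in> V}) \<le> n + 1)))"

text \<open>
  The value is \<open>-1\<close> exactly for the empty space, and \<open>\<infinity>\<close> (the infimum of the empty set) if no
  integer bounds the dimension.
\<close>

definition covering_dim :: "'a topology \<Rightarrow> ereal" where
  "covering_dim X = Inf {ereal (of_int n) |n. covering_dim_le X n}"

end

theory Submission
  imports Defs
begin

text \<open>
  The graphoid \<open>X\<close> of \<open>\<F>\<close> is a compact Hausdorff space whose points are determined by their
  coordinates: the abscissa, the ordinate, and one coordinate for each member of \<open>\<F>\<close>. Both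
  bounds on its dimension are reduced to polynomial algebra in two variables, with finitely many
  coordinates at a time.

  Upper bound. The field of rational functions in two variables has transcendence degree two, so
  any three coordinates satisfy a polynomial equation (\<open>three_ratios_dependent\<close>). By continuity
  the equation holds at all points of \<open>X\<close> where the three values are finite, and for generic real
  \<open>a\<close>, \<open>b\<close>, \<open>c\<close> no point of \<open>X\<close> has the values \<open>a\<close>, \<open>b\<close>, \<open>c\<close> at these coordinates. By compactness a
  point of \<open>X\<close> and the points whose coordinates from a suitable finite set are close to its own lie
  in one member of a given cover. Cut the circles of these finitely many coordinates into small
  arcs, in three different ways, all cut points being generic. Each way splits the points with no
  coordinate at a cut point into disjoint open boxes. A point lost by all three ways would have
  three different coordinates at cut points, so the boxes of the three ways cover \<open>X\<close>, and every
  point lies in at most three of them.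

  Lower bound. The graphoid may contain blow-ups of infinitely many points. These are not
  orientable, so the argument has to count modulo two. On a compact Hausdorff space of dimension
  at most one, every map to the plane can be perturbed to avoid the origin
  (\<open>covering_dim_le_1_perturb_off_origin\<close>). Take a map that sends \<open>X\<close> to the plane through the
  first two coordinates and crosses the origin an odd number of times over the strip
  \<open>-1 \<le> x \<le> 1\<close>. By the Stone-Weierstrass theorem the components of its perturbation may be taken
  to be rational functions \<open>g = G / D\<close> and \<open>h = H / D\<close> of two real variables, where \<open>D\<close> is positive
  off finitely many vertical lines. They are bounded, and \<open>\<bar>g\<bar> + \<bar>h\<bar>\<close> is bounded away from zero,
  even near the indeterminacy points. This contradicts \<open>bounded_rational_miranda\<close>, which rests on
  the following count. For generic \<open>t\<close> consider the parity of the number of real zeros \<open>y\<close> of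
  \<open>H(t, y)\<close> with \<open>g(t, y) > 0\<close>. At all real zeros \<open>\<bar>g\<bar>\<close> lies between a small \<open>\<delta>\<close> and a large \<open>M\<close>, so
  the parity is given by the sign of the product of \<open>(a - g) (b - g)\<close> over all real zeros, for any
  \<open>0 < a < \<delta>\<close> and \<open>b > M\<close>. The product of the signs of \<open>s D - G\<close> over the real zeros of \<open>H(t, _)\<close>
  is the sign of a nonzero polynomial \<open>\<rho>(t, s)\<close>, much as for a resultant
  (\<open>root_sign_generic\<close>). At a given \<open>t\<^sub>0\<close>, the order of vanishing of \<open>\<rho>(_, s)\<close> is the same for
  all but finitely many \<open>s\<close>. Hence \<open>\<rho>(_, a) \<rho>(_, b)\<close> vanishes to even order for suitable \<open>a\<close> and
  \<open>b\<close>, and the parity is the same on both sides of \<open>t\<^sub>0\<close>, whether or not \<open>t\<^sub>0\<close> is the abscissa of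
  an indeterminacy point. But the parity is even near the left side of the strip and odd near the
  right side.
\<close>

section \<open>Signs of a polynomial at the real roots of another polynomial\<close>

text \<open>
  Roots count with multiplicity. Up to signs of powers of leading coefficients this is the sign of
  the resultant, because a pair of conjugate complex roots of \<open>H\<close> contributes \<open>\<bar>Q \<alpha>\<bar>\<^sup>2\<close>.
\<close>

definition root_sign :: "real poly \<Rightarrow> real poly \<Rightarrow> real" where
  "root_sign H Q = (\<Prod>\<alpha>\<in>#proots H. sgn (poly Q \<alpha>))"

lemma sgn_poly_rootless:
  fixes Q :: "real poly"
  assumes "\<And>x. poly Q x \<noteq> 0"
  shows "sgn (poly Q x) = sgn (lead_coeff Q)"
proof -
  have pos: "poly P x > 0" if P: "\<And>x. poly P x \<noteq> 0" "lead_coeff P > 0" for P :: "real poly" and x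
  proof (rule ccontr)
    assume "\<not> poly P x > 0"
    then have neg: "poly P x < 0" using P(1)[of x] by linarith
    obtain n where n: "\<And>y. y \<ge> n \<Longrightarrow> poly P y \<ge> lead_coeff P"
      using poly_pinfty_gt_lc[OF P(2)] by blast
    have "poly P (max n (x+1)) > 0" using n[of "max n (x+1)"] P(2) by linarith
    then obtain z where "poly P z = 0" using poly_IVT_pos[of x "max n (x+1)" P] neg by force
    then show False using P(1) by blast
  qed
  have "lead_coeff Q \<noteq> 0" using assms[of 0] by auto
  then consider "lead_coeff Q > 0" | "lead_coeff (- Q) > 0" by (metis lead_coeff_minus neg_0_less_iff_less linorder_neqE_linordered_idom)
  then show ?thesis
  proof cases
    case 1 then show ?thesis using pos[of Q x] assms by simp
  next
    case 2 then show ?thesis using pos[of "- Q" x] assms by simp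
  qed
qed

text \<open>
  The leading coefficient has the sign of the value at \<open>0\<close>. Reflecting the variable keeps this value and
  multiplies the leading coefficient by \<open>(-1) ^ degree Q\<close>.
\<close>

lemma even_degree_rootless:
  fixes Q :: "real poly"
  assumes "\<And>x. poly Q x \<noteq> 0"
  shows "even (degree Q)"
proof -
  let ?R = "pcompose Q [:0, -1:]"
  have nz: "poly ?R x \<noteq> 0" for x using assms by (simp add: poly_pcompose)
  have "sgn (lead_coeff ?R) = sgn (poly ?R 0)" using sgn_poly_rootless[OF nz] by metis
  also have "\<dots> = sgn (poly Q 0)" by (simp add: poly_pcompose)
  also have "\<dots> = sgn (lead_coeff Q)" using sgn_poly_rootless[OF assms] by metis
  finally have eq: "sgn (lead_coeff ?R) = sgn (lead_coeff Q)" .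
  have "lead_coeff ?R = lead_coeff Q * (-1) ^ degree Q"
    by (subst lead_coeff_comp) auto
  moreover have "lead_coeff Q \<noteq> 0" using assms[of 0] by auto
  ultimately have "(-1::real) ^ degree Q > 0" using eq
    by (cases "even (degree Q)") (auto simp: sgn_if split: if_splits)
  then show ?thesis by (metis neg_one_odd_power not_one_less_zero order_less_asym zero_less_one neg_less_0_iff_less)
qed

text \<open>
  Splitting off one real root at a time reduces both claims to polynomials without real roots.
\<close>

lemma sgn_poly_and_parity:
  fixes Q :: "real poly"
  assumes "Q \<noteq> 0"
  shows "(\<forall>x. sgn (poly Q x) = sgn (lead_coeff Q) * (\<Prod>\<beta>\<in>#proots Q. sgn (x - \<beta>)))
         \<and> (even (size (proots Q)) \<longleftrightarrow> even (degree Q))"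
  using assms
proof (induction "degree Q" arbitrary: Q rule: less_induct)
  case less
  show ?case
  proof (cases "\<exists>b. poly Q b = 0")
    case True
    then obtain b R where QR: "Q = [:-b, 1:] * R" by (metis poly_eq_0_iff_dvd dvdE)
    with less.prems have R0: "R \<noteq> 0" by auto
    have deg: "degree Q = Suc (degree R)" unfolding QR by (subst degree_mult_eq) (use R0 in auto)
    have pr: "proots Q = add_mset b (proots R)"
      unfolding QR by (subst proots_mult) (use R0 in auto)
    have lc: "lead_coeff Q = lead_coeff R" unfolding QR by (simp add: lead_coeff_mult del: mult_pCons_left)
    have IH: "sgn (poly R x) = sgn (lead_coeff R) * (\<Prod>\<beta>\<in>#proots R. sgn (x - \<beta>))"
             "even (size (proots R)) \<longleftrightarrow> even (degree R)" for x
      using less.hyps[of R] deg R0 by auto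
    have "sgn (poly Q x) = sgn (lead_coeff Q) * (\<Prod>\<beta>\<in>#proots Q. sgn (x - \<beta>))" for x
    proof -
      have "poly Q x = (x - b) * poly R x" by (simp add: QR algebra_simps)
      then show ?thesis using IH(1)[of x] unfolding pr lc by (simp add: sgn_mult)
    qed
    then show ?thesis using IH(2) pr deg by auto
  next
    case False
    then have "set_mset (proots Q) = {}" using set_count_proots[OF less.prems] by auto
    then have "proots Q = {#}" by simp
    then show ?thesis using False sgn_poly_rootless[of Q] even_degree_rootless[of Q] by auto
  qed
qed

lemma sgn_poly_eq_prod_proots:
  fixes Q :: "real poly"
  shows "Q \<noteq> 0 \<Longrightarrow> sgn (poly Q x) = sgn (lead_coeff Q) * (\<Prod>\<beta>\<in>#proots Q. sgn (x - \<beta>))"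
  using sgn_poly_and_parity by blast

lemma sgn_power_size_proots:
  fixes Q :: "real poly" and c :: real
  assumes "Q \<noteq> 0" "c \<noteq> 0"
  shows "sgn c ^ size (proots Q) = sgn c ^ degree Q"
  using sgn_poly_and_parity[OF assms(1)] assms(2) by (cases "c > 0") (auto simp: sgn_if uminus_power_if)

text \<open>
  Both sides are, up to the leading coefficients, the product of the signs of \<open>\<alpha> - \<beta>\<close> over all pairs
  of real roots \<open>\<alpha>\<close> of \<open>H\<close> and \<open>\<beta>\<close> of \<open>Q\<close>, read in the two possible orders. The numbers of real roots
  enter only through their parities, which are those of the degrees.
\<close>

lemma root_sign_reciprocity:
  assumes "H \<noteq> 0" "Q \<noteq> 0"
  shows "root_sign H Q = (-1) ^ (degree H * degree Q) * sgn (lead_coeff Q) ^ degree H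
           * sgn (lead_coeff H) ^ degree Q * root_sign Q H"
proof -
  let ?h = "proots H" and ?q = "proots Q"
  define P where "P = (\<Prod>\<alpha>\<in>#?h. \<Prod>\<beta>\<in>#?q. sgn (\<alpha> - \<beta>))"
  have 1: "root_sign H Q = sgn (lead_coeff Q) ^ degree H * P"
    unfolding root_sign_def sgn_poly_eq_prod_proots[OF assms(2)] P_def
    by (simp add: prod_mset.distrib sgn_power_size_proots assms)
  have "root_sign Q H = sgn (lead_coeff H) ^ degree Q * (\<Prod>\<beta>\<in>#?q. \<Prod>\<alpha>\<in>#?h. sgn (\<beta> - \<alpha>))"
    unfolding root_sign_def sgn_poly_eq_prod_proots[OF assms(1)]
    by (simp add: prod_mset.distrib sgn_power_size_proots assms)
  also have "(\<Prod>\<beta>\<in>#?q. \<Prod>\<alpha>\<in>#?h. sgn (\<beta> - \<alpha>)) = (\<Prod>\<beta>\<in>#?q. \<Prod>\<alpha>\<in>#?h. -1 * sgn (\<alpha> - \<beta>))"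
    by (intro arg_cong[where f = prod_mset] image_mset_cong) (simp add: sgn_minus[symmetric])
  also have "\<dots> = (-1) ^ (size ?h * size ?q) * (\<Prod>\<beta>\<in>#?q. \<Prod>\<alpha>\<in>#?h. sgn (\<alpha> - \<beta>))"
    by (simp only: prod_mset.distrib prod_mset_constant power_mult)
  also have "(\<Prod>\<beta>\<in>#?q. \<Prod>\<alpha>\<in>#?h. sgn (\<alpha> - \<beta>)) = P"
    unfolding P_def by (rule prod_mset.swap)
  also have "(-1) ^ (size ?h * size ?q) = ((-1) ^ (degree H * degree Q) :: real)"
    using sgn_poly_and_parity[OF assms(1)] sgn_poly_and_parity[OF assms(2)]
    by (simp add: uminus_power_if)
  finally have 2: "root_sign Q H = sgn (lead_coeff H) ^ degree Q * ((-1) ^ (degree H * degree Q) * P)" .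
  have sq: "sgn (lead_coeff H) ^ degree Q * sgn (lead_coeff H) ^ degree Q = 1"
    using assms(1) by (simp add: power_mult_distrib[symmetric] sgn_if)
  have sq': "(-1) ^ (degree H * degree Q) * (-1) ^ (degree H * degree Q) = (1::real)"
    by (simp add: power_mult_distrib[symmetric])
  show ?thesis unfolding 1 2 using sq sq' by (simp add: algebra_simps)
qed

lemma root_sign_mult: "root_sign H (P * Q) = root_sign H P * root_sign H Q"
  by (simp add: root_sign_def sgn_mult prod_mset.distrib)

lemma sgn_power_real: "sgn ((c::real) ^ n) = sgn c ^ n"
  by (induction n) (auto simp: sgn_mult)

lemma root_sign_smult: "root_sign H (smult c Q) = sgn c ^ size (proots H) * root_sign H Q"
  by (simp add: root_sign_def sgn_mult prod_mset.distrib)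

lemma root_sign_cong:
  assumes "H \<noteq> 0" "\<And>\<alpha>. poly H \<alpha> = 0 \<Longrightarrow> sgn (poly P \<alpha>) = sgn (poly Q \<alpha>)"
  shows "root_sign H P = root_sign H Q"
  unfolding root_sign_def
  by (intro arg_cong[where f = prod_mset] image_mset_cong)
     (use assms set_count_proots[OF assms(1)] in auto)

text \<open>
  The coefficients of the polynomials below are themselves polynomials in parameters; such a
  homomorphism substitutes real values for the parameters.
\<close>

definition eval_hom :: "('a::comm_ring_1 \<Rightarrow> real) \<Rightarrow> bool" where
  "eval_hom \<phi> \<longleftrightarrow> \<phi> 0 = 0 \<and> \<phi> 1 = 1 \<and> (\<forall>a b. \<phi> (a + b) = \<phi> a + \<phi> b) \<and> (\<forall>a b. \<phi> (a * b) = \<phi> a * \<phi> b)"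

context
  fixes \<phi> :: "'a::comm_ring_1 \<Rightarrow> real"
  assumes hom: "eval_hom \<phi>"
begin

lemma eval_hom_simps: "\<phi> 0 = 0" "\<phi> 1 = 1" "\<phi> (a + b) = \<phi> a + \<phi> b" "\<phi> (a * b) = \<phi> a * \<phi> b"
  "\<phi> (- a) = - \<phi> a" "\<phi> (a ^ n) = \<phi> a ^ n"
proof -
  show *: "\<phi> 0 = 0" "\<phi> 1 = 1" "\<phi> (a + b) = \<phi> a + \<phi> b" "\<phi> (a * b) = \<phi> a * \<phi> b" for a b
    using hom by (auto simp: eval_hom_def)
  show "\<phi> (- a) = - \<phi> a" using *(3)[of a "- a"] *(1) by simp
  show "\<phi> (a ^ n) = \<phi> a ^ n" by (induction n) (auto simp: *)
qed

lemma coeff_map_eval: "coeff (map_poly \<phi> p) n = \<phi> (coeff p n)"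
  by (simp add: coeff_map_poly eval_hom_simps)

lemma map_eval_add: "map_poly \<phi> (p + q) = map_poly \<phi> p + map_poly \<phi> q"
  by (rule poly_eqI) (simp add: coeff_map_eval eval_hom_simps)

lemma map_eval_smult: "map_poly \<phi> (smult c p) = smult (\<phi> c) (map_poly \<phi> p)"
  by (rule poly_eqI) (simp add: coeff_map_eval eval_hom_simps)

lemma map_eval_mult: "map_poly \<phi> (p * q) = map_poly \<phi> p * map_poly \<phi> q"
proof (induction p)
  case 0 then show ?case by simp
next
  case (pCons a p)
  have *: "map_poly \<phi> (pCons b r) = pCons (\<phi> b) (map_poly \<phi> r)" for b r
    by (simp add: map_poly_pCons eval_hom_simps)
  show ?case
    by (simp add: map_eval_add map_eval_smult * pCons.IH eval_hom_simps)
qed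

lemma degree_map_eval: "\<phi> (lead_coeff p) \<noteq> 0 \<Longrightarrow> degree (map_poly \<phi> p) = degree p"
  by (simp add: map_poly_degree_eq)

lemma lead_coeff_map_eval: "\<phi> (lead_coeff p) \<noteq> 0 \<Longrightarrow> lead_coeff (map_poly \<phi> p) = \<phi> (lead_coeff p)"
  by (simp add: degree_map_eval coeff_map_eval)

end

text \<open>
  The Euclidean algorithm computes \<open>root_sign\<close>: a division with remainder replaces \<open>Q\<close> by a
  polynomial \<open>G\<close> of smaller degree than \<open>H\<close>, up to a power of the leading coefficient of \<open>H\<close>, and
  reciprocity exchanges \<open>G\<close> and \<open>H\<close>. Every step multiplies the sign by signs of leading coefficients, so
  the steps can be done before the parameters are specialised; \<open>\<rho>\<close> collects these coefficients. If the
  remainder vanishes early, the common factor of \<open>H\<close> and \<open>Q\<close> has no real root at the parameters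
  considered, and there is nothing to count.
\<close>

lemma root_sign_generic:
  fixes H Q :: "'a::idom poly"
  assumes "H \<noteq> 0"
  shows "\<exists>\<rho>. \<rho> \<noteq> 0 \<and> (\<forall>\<phi>. eval_hom \<phi> \<longrightarrow> \<phi> \<rho> \<noteq> 0 \<longrightarrow>
            (\<forall>y. poly (map_poly \<phi> H) y = 0 \<longrightarrow> poly (map_poly \<phi> Q) y \<noteq> 0) \<longrightarrow>
            map_poly \<phi> H \<noteq> 0 \<and> root_sign (map_poly \<phi> H) (map_poly \<phi> Q) = sgn (\<phi> \<rho>))"
  using assms
proof (induction "degree H" arbitrary: H Q rule: less_induct)
  case less
  let ?c = "lead_coeff H"
  have c0: "?c \<noteq> 0" using less.prems by simp
  have nz: "map_poly \<phi> H \<noteq> 0" if "eval_hom \<phi>" "\<phi> ?c \<noteq> 0" for \<phi>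
    using lead_coeff_map_eval[OF that] that by auto
  have trivial: "root_sign (map_poly \<phi> H) P = sgn (\<phi> (?c * ?c))"
    if "eval_hom \<phi>" "\<phi> ?c \<noteq> 0" "\<And>y. poly (map_poly \<phi> H) y \<noteq> 0" for \<phi> P
  proof -
    have "set_mset (proots (map_poly \<phi> H)) = {}"
      using set_count_proots[OF nz[OF that(1,2)]] that(3) by simp
    then show ?thesis using that by (simp add: root_sign_def eval_hom_simps sgn_mult)
  qed
  show ?case
  proof (cases "degree H = 0")
    case True
    then obtain h where H: "H = [:h:]" by (metis degree_eq_zeroE)
    show ?thesis
    proof (intro exI[of _ "?c * ?c"] conjI allI impI)
      fix \<phi> :: "'a \<Rightarrow> real" assume *: "eval_hom \<phi>" "\<phi> (?c * ?c) \<noteq> 0"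
      then have **: "\<phi> ?c \<noteq> 0" by (auto simp: eval_hom_simps)
      show "map_poly \<phi> H \<noteq> 0" by (rule nz) fact+
      have "poly (map_poly \<phi> H) y \<noteq> 0" for y
        using ** by (simp add: H map_poly_pCons eval_hom_simps[OF *(1)])
      then show "root_sign (map_poly \<phi> H) (map_poly \<phi> Q) = sgn (\<phi> (?c * ?c))"
        using trivial * ** by blast
    qed (use c0 in auto)
  next
    case False
    obtain B G where BG: "pseudo_divmod Q H = (B, G)" by fastforce
    define k where "k = Suc (degree Q) - degree H"
    have div: "smult (?c ^ k) Q = H * B + G" and deg: "G = 0 \<or> degree G < degree H"
      using pseudo_divmod[OF less.prems BG] by (auto simp: k_def)
    have at_root: "\<phi> ?c ^ k * poly (map_poly \<phi> Q) y = poly (map_poly \<phi> G) y"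
      if "eval_hom \<phi>" "poly (map_poly \<phi> H) y = 0" for \<phi> y
    proof -
      have "smult (\<phi> ?c ^ k) (map_poly \<phi> Q) = map_poly \<phi> H * map_poly \<phi> B + map_poly \<phi> G"
        using arg_cong[OF div, of "map_poly \<phi>"] that(1)
        by (simp add: map_eval_smult map_eval_add map_eval_mult eval_hom_simps)
      from arg_cong[OF this, of "\<lambda>p. poly p y"] show ?thesis using that(2) by simp
    qed
    show ?thesis
    proof (cases "G = 0")
      case True
      show ?thesis
      proof (intro exI[of _ "?c * ?c"] conjI allI impI)
        fix \<phi> :: "'a \<Rightarrow> real"
        assume *: "eval_hom \<phi>" "\<phi> (?c * ?c) \<noteq> 0"
          and no_root: "\<forall>y. poly (map_poly \<phi> H) y = 0 \<longrightarrow> poly (map_poly \<phi> Q) y \<noteq> 0"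
        then have **: "\<phi> ?c \<noteq> 0" by (auto simp: eval_hom_simps)
        show "map_poly \<phi> H \<noteq> 0" by (rule nz) fact+
        have "poly (map_poly \<phi> H) y \<noteq> 0" for y
          using at_root[OF *(1), of y] ** no_root True by auto
        then show "root_sign (map_poly \<phi> H) (map_poly \<phi> Q) = sgn (\<phi> (?c * ?c))"
          using trivial * ** by blast
      qed (use c0 in auto)
    next
      case G0: False
      let ?g = "lead_coeff G"
      from deg G0 less.hyps[of G H] obtain \<rho>' where \<rho>': "\<rho>' \<noteq> 0"
        "\<And>\<phi>. eval_hom \<phi> \<Longrightarrow> \<phi> \<rho>' \<noteq> 0 \<Longrightarrow>
           (\<And>y. poly (map_poly \<phi> G) y = 0 \<Longrightarrow> poly (map_poly \<phi> H) y \<noteq> 0) \<Longrightarrow>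
           root_sign (map_poly \<phi> G) (map_poly \<phi> H) = sgn (\<phi> \<rho>')" by metis
      \<comment> \<open>The square does not affect signs; it makes both leading coefficients nonzero wherever \<open>\<rho>\<close> is.\<close>
      define \<rho> where "\<rho> = (?c * ?g) ^ 2 * (?c ^ (k * degree H) * ((-1) ^ (degree H * degree G)
                          * ?g ^ degree H * ?c ^ degree G * \<rho>'))"
      have g0: "?g \<noteq> 0" using G0 by simp
      show ?thesis
      proof (intro exI[of _ \<rho>] conjI allI impI)
        show "\<rho> \<noteq> 0" using c0 g0 \<rho>'(1) by (simp add: \<rho>_def)
        fix \<phi> :: "'a \<Rightarrow> real"
        assume h: "eval_hom \<phi>" and nz\<rho>: "\<phi> \<rho> \<noteq> 0"
          and no_root: "\<forall>y. poly (map_poly \<phi> H) y = 0 \<longrightarrow> poly (map_poly \<phi> Q) y \<noteq> 0"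
        note hs = eval_hom_simps[OF h]
        have cg: "\<phi> ?c \<noteq> 0" "\<phi> ?g \<noteq> 0" "\<phi> \<rho>' \<noteq> 0"
          using nz\<rho> by (auto simp: \<rho>_def hs)
        have sq2: "(sgn (\<phi> ?c) * sgn (\<phi> ?g))\<^sup>2 = 1"
          using cg by (simp add: power_mult_distrib sgn_if)
        let ?H = "map_poly \<phi> H" and ?G = "map_poly \<phi> G" and ?Q = "map_poly \<phi> Q"
        show H0: "?H \<noteq> 0" by (rule nz) fact+
        have G0': "?G \<noteq> 0" using lead_coeff_map_eval[OF h cg(2)] cg(2) by auto
        have "root_sign ?H ?G = root_sign ?H (smult (\<phi> ?c ^ k) ?Q)"
          by (rule root_sign_cong[OF H0]) (simp add: at_root[OF h])
        also have "\<dots> = sgn (\<phi> ?c) ^ (k * degree H) * root_sign ?H ?Q"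
          using sgn_power_size_proots[OF H0, of "\<phi> ?c ^ k"] degree_map_eval[OF h cg(1)] cg(1)
          by (simp add: root_sign_smult sgn_power_real power_mult)
        finally have 1: "root_sign ?H ?G = sgn (\<phi> ?c) ^ (k * degree H) * root_sign ?H ?Q" .
        have sq: "sgn (\<phi> ?c) ^ (k * degree H) * sgn (\<phi> ?c) ^ (k * degree H) = 1"
          using cg(1) by (simp add: power_mult_distrib[symmetric] sgn_if)
        have "root_sign ?H ?Q = sgn (\<phi> ?c) ^ (k * degree H) * root_sign ?H ?G"
          unfolding 1 using sq by (simp add: mult.assoc[symmetric])
        also have "root_sign ?H ?G = (-1) ^ (degree H * degree G) * sgn (\<phi> ?g) ^ degree H
           * sgn (\<phi> ?c) ^ degree G * root_sign ?G ?H"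
          using root_sign_reciprocity[OF H0 G0'] degree_map_eval[OF h cg(1)] degree_map_eval[OF h cg(2)]
          by (simp add: coeff_map_eval[OF h])
        also have "root_sign ?G ?H = sgn (\<phi> \<rho>')"
        proof (rule \<rho>'(2)[OF h cg(3)])
          fix y assume "poly ?G y = 0"
          then show "poly ?H y \<noteq> 0" using at_root[OF h, of y] cg(1) no_root by auto
        qed
        finally show "root_sign ?H ?Q = sgn (\<phi> \<rho>)"
          using cg sq2 by (simp add: \<rho>_def hs sgn_mult sgn_power_real)
      qed
    qed
  qed
qed

section \<open>A Poincare-Miranda theorem for bounded rational functions of the plane\<close>

abbreviation slice :: "real poly poly \<Rightarrow> real \<Rightarrow> real poly" where
  "slice p x \<equiv> map_poly (\<lambda>c. poly c x) p"

lemma poly_slice: "poly (slice p x) y = eval2 p x y"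
  unfolding eval2_def
  by (induction p) (auto simp: map_poly_pCons)

lemma eval2_arith [simp]:
  "eval2 0 x y = 0" "eval2 1 x y = 1" "eval2 (p + q) x y = eval2 p x y + eval2 q x y"
  "eval2 (p - q) x y = eval2 p x y - eval2 q x y" "eval2 (- p) x y = - eval2 p x y"
  "eval2 (p * q) x y = eval2 p x y * eval2 q x y" "eval2 (p ^ n) x y = eval2 p x y ^ n"
  "eval2 (smult c p) x y = poly c x * eval2 p x y" "eval2 [:c:] x y = poly c x"
  by (simp_all add: eval2_def)

lemma eval_hom_eval2: "eval_hom (\<lambda>r. eval2 r x y)"
  by (simp add: eval_hom_def)

text \<open>
  The number \<open>m\<close> is the order of vanishing at \<open>x = a\<close>, for generic values of the other variable.
\<close>

lemma extract_vertical_factor: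
  fixes \<rho> :: "real poly poly"
  assumes "\<rho> \<noteq> 0"
  shows "\<exists>m R. \<rho> = smult ([:-a, 1:] ^ m) R \<and> slice R a \<noteq> 0"
  using assms
proof (induction "degree (lead_coeff \<rho>)" arbitrary: \<rho> rule: less_induct)
  case less
  show ?case
  proof (cases "slice \<rho> a = 0")
    case False
    then show ?thesis by (intro exI[of _ 0] exI[of _ \<rho>]) auto
  next
    case True
    define \<rho>' where "\<rho>' = map_poly (\<lambda>c. c div [:-a, 1:]) \<rho>"
    have co: "coeff \<rho> n = [:-a, 1:] * coeff \<rho>' n" for n
    proof -
      have "poly (coeff \<rho> n) a = 0"
        using arg_cong[OF True, of "\<lambda>p. coeff p n"] by (simp add: coeff_map_poly)
      then have "[:-a, 1:] dvd coeff \<rho> n" by (simp add: poly_eq_0_iff_dvd)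
      moreover have "coeff \<rho>' n = coeff \<rho> n div [:-a, 1:]" by (simp add: \<rho>'_def coeff_map_poly)
      ultimately show ?thesis by (metis dvd_mult_div_cancel)
    qed
    have eq: "\<rho> = smult [:-a, 1:] \<rho>'" by (rule poly_eqI) (simp only: co coeff_smult)
    then have nz: "\<rho>' \<noteq> 0" using less.prems by auto
    have "degree \<rho> = degree \<rho>'" unfolding eq by simp
    then have "lead_coeff \<rho> = [:-a, 1:] * lead_coeff \<rho>'" using co by simp
    then have "degree (lead_coeff \<rho>) = Suc (degree (lead_coeff \<rho>'))"
      by (simp only:) (subst degree_mult_eq, use nz in auto)
    then obtain m R where "\<rho>' = smult ([:-a, 1:] ^ m) R" "slice R a \<noteq> 0"
      using less.hyps[OF _ nz] by auto
    then show ?thesis by (intro exI[of _ "Suc m"] exI[of _ R]) (simp add: eq)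
  qed
qed

text \<open>
  The parity of the number of points on the vertical line at \<open>t\<close> where \<open>H\<close> vanishes and \<open>G\<close> is
  positive, written as a sign.
\<close>

definition crossing_sign :: "real poly poly \<Rightarrow> real poly poly \<Rightarrow> real \<Rightarrow> real" where
  "crossing_sign G H t = (\<Prod>\<alpha>\<in>#proots (slice H t). if eval2 G t \<alpha> > 0 then -1 else 1)"

lemma eventually_at_notin_finite: "finite B \<Longrightarrow> eventually (\<lambda>t::real. t \<notin> B) (at t0)"
proof -
  assume "finite B"
  then have "open (- (B - {t0}))" by (intro open_Compl finite_imp_closed) auto
  then have "eventually (\<lambda>t. t \<in> - (B - {t0})) (at t0)"
    by (intro eventually_at_in_open') auto
  then show ?thesis by (auto simp: eventually_at_filter elim: eventually_mono)
qed

lemma eventually_sgn_eval2: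
  assumes "eval2 R t0 s \<noteq> 0"
  shows "eventually (\<lambda>t. sgn (eval2 R t s) = sgn (eval2 R t0 s)) (at t0)"
proof -
  have lim: "((\<lambda>t. eval2 R t s) \<longlongrightarrow> eval2 R t0 s) (at t0)"
    unfolding eval2_def by (intro tendsto_intros)
  show ?thesis
  proof (cases "eval2 R t0 s > 0")
    case True
    from order_tendstoD(1)[OF lim True] show ?thesis using True by (auto elim!: eventually_mono)
  next
    case False
    with assms have "eval2 R t0 s < 0" by simp
    from order_tendstoD(2)[OF lim this] show ?thesis using \<open>eval2 R t0 s < 0\<close> by (auto elim!: eventually_mono)
  qed
qed

text \<open>
  At a zero of \<open>H\<close> the quotient \<open>G / D\<close> lies in \<open>[-M, -\<delta>]\<close> or in \<open>[\<delta>, M]\<close>. So for \<open>0 < a < \<delta>\<close> and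
  \<open>b > M\<close> the product of \<open>a D - G\<close> and \<open>b D - G\<close> is negative exactly where \<open>G\<close> is positive, and the
  crossing sign is the product of the values of \<open>root_sign\<close> for these two polynomials. Both values
  come from one polynomial \<open>\<rho>(t, s)\<close>, taken at \<open>s = a\<close> and \<open>s = b\<close>. After \<open>(t - t\<^sub>0) ^ m\<close> is split
  off from \<open>\<rho>\<close>, the two powers cancel in the product of signs, whatever the parity of \<open>m\<close>.
\<close>

lemma crossing_sign_punctured_const:
  fixes G H D :: "real poly poly"
  assumes "H \<noteq> 0" "0 < \<delta>" "finite B"
    and dom: "\<And>x y. x \<notin> B \<Longrightarrow> eval2 D x y > 0"
    and bdd: "\<And>x y. x \<notin> B \<Longrightarrow> \<bar>eval2 G x y\<bar> \<le> M * eval2 D x y"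
    and away: "\<And>x y. x \<notin> B \<Longrightarrow> eval2 H x y = 0 \<Longrightarrow> \<bar>eval2 G x y\<bar> \<ge> \<delta> * eval2 D x y"
  shows "\<exists>e. eventually (\<lambda>t. slice H t \<noteq> 0 \<and> crossing_sign G H t = e) (at t0)"
proof -
  define H' :: "real poly poly poly" where "H' = map_poly (\<lambda>c. [:c:]) H"
  \<comment> \<open>\<open>Q'\<close> is \<open>s D - G\<close>; the coefficients are polynomials in \<open>s\<close> over the polynomials in \<open>t\<close>.\<close>
  define Q' :: "real poly poly poly" where "Q' = map_poly (\<lambda>c. [:0, c:]) D - map_poly (\<lambda>c. [:c:]) G"
  have H'0: "H' \<noteq> 0" using assms(1) by (auto simp: H'_def map_poly_eq_0_iff)
  have H': "map_poly (\<lambda>r. eval2 r t s) H' = slice H t" for t s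
    by (rule poly_eqI) (simp add: H'_def coeff_map_poly)
  have Q': "poly (map_poly (\<lambda>r. eval2 r t s) Q') y = s * eval2 D t y - eval2 G t y" for t s y
  proof -
    have "map_poly (\<lambda>r. eval2 r t s) Q' = smult s (slice D t) - slice G t"
      by (rule poly_eqI) (simp add: Q'_def coeff_map_poly eval2_def)
    then show ?thesis by (simp add: poly_slice)
  qed
  obtain \<rho> where \<rho>: "\<rho> \<noteq> 0" "\<And>\<phi>. eval_hom \<phi> \<Longrightarrow> \<phi> \<rho> \<noteq> 0 \<Longrightarrow>
            (\<And>y. poly (map_poly \<phi> H') y = 0 \<Longrightarrow> poly (map_poly \<phi> Q') y \<noteq> 0) \<Longrightarrow>
            map_poly \<phi> H' \<noteq> 0 \<and> root_sign (map_poly \<phi> H') (map_poly \<phi> Q') = sgn (\<phi> \<rho>)"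
    using root_sign_generic[OF H'0, of Q'] by blast
  obtain m R where R: "\<rho> = smult ([:-t0, 1:] ^ m) R" "slice R t0 \<noteq> 0"
    using extract_vertical_factor[OF \<rho>(1)] by blast
  have fin: "finite {s. eval2 R t0 s = 0}"
    using poly_roots_finite[OF R(2)] by (simp add: poly_slice)
  obtain a where a: "0 < a" "a < \<delta>" "eval2 R t0 a \<noteq> 0"
  proof -
    have "infinite ({0<..<\<delta>} - {s. eval2 R t0 s = 0})"
      using Diff_infinite_finite[OF fin] infinite_Ioo[OF \<open>0 < \<delta>\<close>] by blast
    then show ?thesis using that by (metis (mono_tags, lifting) DiffD1 DiffD2 finite.emptyI ex_in_conv greaterThanLessThan_iff mem_Collect_eq)
  qed
  obtain b where b: "M < b" "eval2 R t0 b \<noteq> 0"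
  proof -
    have "infinite ({M<..} - {s. eval2 R t0 s = 0})"
      using Diff_infinite_finite[OF fin] infinite_Ioi by blast
    then show ?thesis using that by (metis (mono_tags, lifting) DiffD1 DiffD2 finite.emptyI ex_in_conv greaterThan_iff mem_Collect_eq)
  qed
  define e where "e = sgn (eval2 R t0 a) * sgn (eval2 R t0 b)"
  have "eventually (\<lambda>t. t \<notin> B \<and> t \<noteq> t0 \<and> sgn (eval2 R t a) = sgn (eval2 R t0 a)
           \<and> sgn (eval2 R t b) = sgn (eval2 R t0 b)) (at t0)"
    using eventually_at_notin_finite[OF assms(3)] eventually_sgn_eval2[OF a(3)] eventually_sgn_eval2[OF b(2)]
    by (intro eventually_conj) (auto simp: eventually_at_filter)
  then have "eventually (\<lambda>t. slice H t \<noteq> 0 \<and> crossing_sign G H t = e) (at t0)"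
  proof (rule eventually_mono, elim conjE)
    fix t assume t: "t \<notin> B" "t \<noteq> t0"
      and sa: "sgn (eval2 R t a) = sgn (eval2 R t0 a)" and sb: "sgn (eval2 R t b) = sgn (eval2 R t0 b)"
    have \<rho>_eval: "eval2 \<rho> t s = (t - t0) ^ m * eval2 R t s" for s
      by (simp add: R(1) poly_power)
    define Qa where "Qa = map_poly (\<lambda>r. eval2 r t a) Q'"
    define Qb where "Qb = map_poly (\<lambda>r. eval2 r t b) Q'"
    have root: "sgn (poly Qa y * poly Qb y) = (if eval2 G t y > 0 then -1 else 1)"
      "poly Qa y \<noteq> 0" "poly Qb y \<noteq> 0"
      if "poly (slice H t) y = 0" for y
    proof -
      have D: "eval2 D t y > 0" and up: "\<bar>eval2 G t y\<bar> \<le> M * eval2 D t y"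
        and low: "\<bar>eval2 G t y\<bar> \<ge> \<delta> * eval2 D t y"
        using dom bdd away t(1) that by (auto simp: poly_slice)
      have "a * eval2 D t y < \<delta> * eval2 D t y" "M * eval2 D t y < b * eval2 D t y"
           "a * eval2 D t y > 0"
        using D a b by auto
      then have "eval2 G t y > 0 \<and> a * eval2 D t y - eval2 G t y < 0 \<and> b * eval2 D t y - eval2 G t y > 0
        \<or> eval2 G t y < 0 \<and> a * eval2 D t y - eval2 G t y > 0 \<and> b * eval2 D t y - eval2 G t y > 0"
        using up low by linarith
      then show "sgn (poly Qa y * poly Qb y) = (if eval2 G t y > 0 then -1 else 1)"
        "poly Qa y \<noteq> 0" "poly Qb y \<noteq> 0"
        unfolding Qa_def Qb_def Q' by (auto simp: sgn_mult)
    qed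
    have nz: "eval2 \<rho> t a \<noteq> 0" "eval2 \<rho> t b \<noteq> 0"
      using sa sb a(3) b(2) t(2) unfolding \<rho>_eval by (metis sgn_eq_0_iff mult_eq_0_iff power_not_zero right_minus_eq)+
    have A: "slice H t \<noteq> 0 \<and> root_sign (slice H t) Qa = sgn (eval2 \<rho> t a)"
      using \<rho>(2)[OF eval_hom_eval2 nz(1)] root(2) unfolding H' Qa_def[symmetric] by blast
    have "slice H t \<noteq> 0 \<and> root_sign (slice H t) Qb = sgn (eval2 \<rho> t b)"
      using \<rho>(2)[OF eval_hom_eval2 nz(2)] root(3) unfolding H' Qb_def[symmetric] by blast
    with A have "root_sign (slice H t) (Qa * Qb) = sgn (eval2 \<rho> t a) * sgn (eval2 \<rho> t b)"
      by (simp add: root_sign_mult)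
    also have "\<dots> = e"
      using t by (simp add: \<rho>_eval e_def sa sb sgn_mult sgn_power_real algebra_simps)
        (simp add: power_mult_distrib[symmetric] sgn_if)
    also have "root_sign (slice H t) (Qa * Qb) = crossing_sign G H t"
      unfolding root_sign_def crossing_sign_def
      by (intro arg_cong[where f = prod_mset] image_mset_cong)
         (use root(1) set_count_proots A in auto)
    finally show "slice H t \<noteq> 0 \<and> crossing_sign G H t = e" using A by simp
  qed
  then show ?thesis by blast
qed

text \<open>
  The function \<open>E\<close> itself is locally constant, because nearby punctured neighbourhoods overlap.
\<close>

lemma punctured_const_imp_const:
  fixes f :: "real \<Rightarrow> real"
  assumes E: "\<And>t0. eventually (\<lambda>t. f t = E t0) (at t0)"
  shows "E a = E b"
proof -
  have "eventually (\<lambda>t1. E t0 = E t1) (at t0)" for t0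
  proof -
    obtain d where d: "d > 0" "\<And>t. t \<noteq> t0 \<Longrightarrow> dist t t0 < d \<Longrightarrow> f t = E t0"
      using E[of t0] by (auto simp: eventually_at)
    have "E t0 = E t1" if t1: "t1 \<noteq> t0" "dist t1 t0 < d" for t1
    proof -
      have "open (ball t0 d - {t0})" by auto
      then have "eventually (\<lambda>t. t \<in> ball t0 d - {t0}) (at t1)"
        by (rule eventually_at_in_open') (use t1 in \<open>auto simp: dist_commute\<close>)
      then have "eventually (\<lambda>t. f t = E t0) (at t1)"
        by eventually_elim (use d in \<open>auto simp: dist_commute\<close>)
      with E[of t1] have "eventually (\<lambda>t. E t0 = E t1) (at t1)"
        by eventually_elim auto
      then show ?thesis by simp
    qed
    then show ?thesis using d(1) unfolding eventually_at by blast
  qed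
  then show ?thesis
    using connected_local_const[of UNIV a b E] by auto
qed

text \<open>
  On the lines near \<open>x = b\<close> the zeros of \<open>H\<close> with \<open>G > 0\<close> are those between \<open>-1\<close> and \<open>1\<close>; their number
  is odd, as \<open>H\<close> has opposite signs at \<open>-1\<close> and \<open>1\<close>. On the lines near \<open>x = a\<close> there are no such zeros.
  But the parity is the same for all lines: where \<open>H\<close> vanishes, \<open>G / D\<close> is bounded and bounded away
  from zero, and this controls the parity even across the lines where \<open>D\<close> vanishes.
\<close>

theorem bounded_rational_miranda:
  fixes G H D :: "real poly poly"
  assumes "0 < \<delta>" "finite B"
    and dom: "\<And>x y. x \<notin> B \<Longrightarrow> eval2 D x y > 0"
    and bdd: "\<And>x y. x \<notin> B \<Longrightarrow> \<bar>eval2 G x y\<bar> \<le> M * eval2 D x y"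
    and away: "\<And>x y. x \<notin> B \<Longrightarrow> eval2 H x y = 0 \<Longrightarrow> \<bar>eval2 G x y\<bar> \<ge> \<delta> * eval2 D x y"
    and left: "eventually (\<lambda>x. \<forall>y. eval2 G x y < 0) (at a)"
    and right: "eventually (\<lambda>x. \<forall>y. (\<bar>y\<bar> \<le> 1 \<longrightarrow> eval2 G x y > 0) \<and> (\<bar>y\<bar> \<ge> 2 \<longrightarrow> eval2 G x y < 0)
               \<and> (1 \<le> y \<and> y \<le> 2 \<longrightarrow> eval2 H x y > 0) \<and> (- 2 \<le> y \<and> y \<le> -1 \<longrightarrow> eval2 H x y < 0)) (at b)"
  shows False
proof -
  have "H \<noteq> 0"
  proof
    assume "H = 0"
    with right have "eventually (\<lambda>x. False) (at b)" by (elim eventually_mono) (auto dest: spec[of _ 1])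
    then show False by simp
  qed
  then have "\<forall>t0. \<exists>e. eventually (\<lambda>t. slice H t \<noteq> 0 \<and> crossing_sign G H t = e) (at t0)"
    by (intro allI crossing_sign_punctured_const[where \<delta> = \<delta> and B = B and D = D and M = M]) (use assms(1-5) in auto)
  from choice[OF this] obtain E where E: "\<And>t0. eventually (\<lambda>t. slice H t \<noteq> 0 \<and> crossing_sign G H t = E t0) (at t0)"
    by auto
  have "eventually (\<lambda>t. E a = 1) (at a)"
    using E[of a] left
  proof eventually_elim
    case (elim t)
    have "crossing_sign G H t = (\<Prod>\<alpha>\<in>#proots (slice H t). 1)"
      unfolding crossing_sign_def
      by (intro arg_cong[where f = prod_mset] image_mset_cong) (use elim in \<open>auto simp: not_less less_imp_le\<close>)
    then show ?case using elim by simp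
  qed
  moreover have "eventually (\<lambda>t. E b = -1) (at b)"
    using E[of b] right
  proof eventually_elim
    case (elim t)
    let ?h = "slice H t"
    have h0: "?h \<noteq> 0" using elim by simp
    \<comment> \<open>At every root the sign of \<open>G\<close> is opposite to that of \<open>y\<^sup>2 - 1\<close>, so the count of roots
      in \<open>(-1, 1)\<close> is read off from \<open>H\<close> at \<open>y = 1\<close> and \<open>y = -1\<close>.\<close>
    have "crossing_sign G H t = root_sign ?h ([:-1, 1:] * [:1, 1:])"
      unfolding crossing_sign_def root_sign_def
    proof (intro arg_cong[where f = prod_mset] image_mset_cong)
      fix y assume "y \<in># proots ?h"
      then have y: "eval2 H t y = 0" using set_count_proots[OF h0] by (auto simp: poly_slice)
      have el: "\<And>y. \<bar>y\<bar> \<le> 1 \<Longrightarrow> eval2 G t y > 0" "\<And>y. \<bar>y\<bar> \<ge> 2 \<Longrightarrow> eval2 G t y < 0"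
         "\<And>y. 1 \<le> y \<Longrightarrow> y \<le> 2 \<Longrightarrow> eval2 H t y > 0" "\<And>y. -2 \<le> y \<Longrightarrow> y \<le> -1 \<Longrightarrow> eval2 H t y < 0"
        using elim by auto
      have "\<bar>y\<bar> < 1 \<or> \<bar>y\<bar> \<ge> 2"
      proof (rule ccontr)
        assume "\<not> ?thesis"
        then have "1 \<le> y \<and> y \<le> 2 \<or> -2 \<le> y \<and> y \<le> -1" by (auto simp: abs_if split: if_splits)
        then show False using el(3,4)[of y] y by auto
      qed
      then show "(if 0 < eval2 G t y then - 1 else 1) = sgn (poly ([:- 1, 1:] * [:1, 1:]) y)"
      proof
        assume "\<bar>y\<bar> < 1"
        then have "y - 1 < 0" "y + 1 > 0" by auto
        then show ?thesis using el(1)[of y] \<open>\<bar>y\<bar> < 1\<close> by (simp add: sgn_mult del: mult_pCons_left mult_pCons_right)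
      next
        assume "\<bar>y\<bar> \<ge> 2"
        then have "y - 1 < 0 \<and> y + 1 < 0 \<or> y - 1 > 0 \<and> y + 1 > 0" by (auto simp: abs_if split: if_splits)
        then show ?thesis using el(2)[OF \<open>\<bar>y\<bar> \<ge> 2\<close>] by (auto simp: sgn_mult simp del: mult_pCons_left mult_pCons_right)
      qed
    qed
    also have "\<dots> = root_sign ?h [:-1, 1:] * root_sign ?h [:1, 1:]" by (rule root_sign_mult)
    also have "\<dots> = sgn (poly ?h 1) * sgn (poly ?h (- 1))"
    proof -
      have lin: "root_sign [:-c, 1:] ?h = sgn (poly ?h c)" for c
        by (simp add: root_sign_def)
      have "root_sign ?h [:-c, 1:] = (-1) ^ degree ?h * sgn (lead_coeff ?h) * sgn (poly ?h c)" for c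
        by (subst root_sign_reciprocity) (use h0 lin in auto)
      from this[of 1] this[of "-1"] show ?thesis
        using h0 by (simp add: sgn_if power_mult_distrib[symmetric])
    qed
    also have "\<dots> = -1"
      using elim by (simp add: poly_slice)
    finally show ?case using elim by simp
  qed
  ultimately have "E a = 1" "E b = -1" by simp_all
  moreover have "E a = E b"
    by (rule punctured_const_imp_const[of "crossing_sign G H" E]) (rule eventually_mono[OF E], simp)
  ultimately show False by simp
qed

section \<open>Dependence and common zeros of bivariate polynomials\<close>

text \<open>
  Gaussian elimination of one unknown for each equation.
\<close>

lemma homogeneous_system_nontrivial:
  fixes A :: "'i \<Rightarrow> 'j \<Rightarrow> real"
  assumes "finite I" "finite J" "card I < card J"
  shows "\<exists>L. (\<exists>j\<in>J. L j \<noteq> 0) \<and> (\<forall>i\<in>I. (\<Sum>j\<in>J. A i j * L j) = 0)"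
  using assms
proof (induction I arbitrary: J A rule: finite_induct)
  case empty
  then have "J \<noteq> {}" by auto
  then show ?case by (intro exI[of _ "\<lambda>_. 1"]) auto
next
  case (insert i0 I)
  have card: "card I < card J" using insert.prems insert.hyps by simp
  show ?case
  proof (cases "\<forall>j\<in>J. A i0 j = 0")
    case True
    obtain L where "\<exists>j\<in>J. L j \<noteq> 0" "\<forall>i\<in>I. (\<Sum>j\<in>J. A i j * L j) = 0"
      using insert.IH[OF insert.prems(1) card] by blast
    then show ?thesis using True by (intro exI[of _ L]) auto
  next
    case False
    then obtain j0 where j0: "j0 \<in> J" "A i0 j0 \<noteq> 0" by blast
    define J' where "J' = J - {j0}"
    have J: "J = insert j0 J'" "j0 \<notin> J'" "finite J'" using j0 insert.prems by (auto simp: J'_def)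
    then have "card I < card J'" using insert.prems insert.hyps by simp
    then obtain L where L: "\<exists>j\<in>J'. L j \<noteq> 0"
      "\<And>i. i \<in> I \<Longrightarrow> (\<Sum>j\<in>J'. (A i j - A i j0 * A i0 j / A i0 j0) * L j) = 0"
      using insert.IH[OF J(3), of "\<lambda>i j. A i j - A i j0 * A i0 j / A i0 j0"] by blast
    define K where "K = (\<Sum>j\<in>J'. A i0 j * L j) / A i0 j0"
    define L' where "L' = L(j0 := - K)"
    have sum: "(\<Sum>j\<in>J. A i j * L' j) = (\<Sum>j\<in>J'. A i j * L j) - A i j0 * K" for i
    proof -
      have "(\<Sum>j\<in>J'. A i j * L' j) = (\<Sum>j\<in>J'. A i j * L j)"
        using J(2) by (intro sum.cong) (auto simp: L'_def)
      then show ?thesis using J by (simp add: L'_def)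
    qed
    have "(\<Sum>j\<in>J. A i j * L' j) = 0" if "i \<in> I" for i
      using L(2)[OF that] unfolding sum
      by (simp add: left_diff_distrib sum_subtractf K_def sum_distrib_left mult.assoc sum_divide_distrib)
    moreover have "(\<Sum>j\<in>J. A i0 j * L' j) = 0"
      unfolding sum K_def using j0 by simp
    moreover have "\<exists>j\<in>J. L' j \<noteq> 0" using L(1) J by (auto simp: L'_def)
    ultimately show ?thesis by (intro exI[of _ L']) auto
  qed
qed

definition bidegree_le :: "real poly poly \<Rightarrow> nat \<Rightarrow> bool" where
  "bidegree_le p d \<longleftrightarrow> degree p \<le> d \<and> (\<forall>i. degree (coeff p i) \<le> d)"

lemma bidegree_le_mult:
  assumes "bidegree_le p d" "bidegree_le q e"
  shows "bidegree_le (p * q) (d + e)"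
proof -
  have "degree (p * q) \<le> d + e"
    using degree_mult_le[of p q] assms by (simp add: bidegree_le_def)
  moreover have "degree (coeff (p * q) i) \<le> d + e" for i
    unfolding coeff_mult
  proof (rule degree_sum_le)
    fix k
    show "degree (coeff p k * coeff q (i - k)) \<le> d + e"
      using degree_mult_le[of "coeff p k" "coeff q (i - k)"] assms
      by (meson add_mono bidegree_le_def order_trans)
  qed auto
  ultimately show ?thesis by (simp add: bidegree_le_def)
qed

lemma bidegree_le_power: "bidegree_le p d \<Longrightarrow> bidegree_le (p ^ n) (n * d)"
proof (induction n)
  case 0
  have "degree (coeff 1 i :: real poly) = 0" for i by (cases i) auto
  then show ?case by (simp add: bidegree_le_def)
next
  case (Suc n)
  then show ?case using bidegree_le_mult[of p d "p ^ n" "n * d"] by simp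
qed

lemma bidegree_le_mono: "bidegree_le p d \<Longrightarrow> d \<le> e \<Longrightarrow> bidegree_le p e"
  unfolding bidegree_le_def by (meson order_trans)

lemma ex_bidegree_le: "\<exists>d. bidegree_le p d"
proof -
  define d where "d = Max ((\<lambda>i. degree (coeff p i)) ` {..degree p})"
  have "degree (coeff p i) \<le> max (degree p) d" for i
  proof (cases "i \<le> degree p")
    case True
    then have "degree (coeff p i) \<le> d" unfolding d_def by (intro Max_ge) auto
    then show ?thesis by simp
  qed (auto simp: coeff_eq_0)
  then show ?thesis by (intro exI[of _ "max (degree p) d"]) (simp add: bidegree_le_def)
qed

lemma common_bidegree:
  assumes "finite S"
  shows "\<exists>d. \<forall>p\<in>S. bidegree_le p d"
  using assms
proof induction
  case (insert p S)
  then obtain d e where "\<forall>p\<in>S. bidegree_le p d" "bidegree_le p e" using ex_bidegree_le by metis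
  then show ?case by (intro exI[of _ "max d e"]) (auto intro: bidegree_le_mono)
qed auto

lemma eval2_sum: "eval2 (sum f A) x y = (\<Sum>a\<in>A. eval2 (f a) x y)"
  by (induction A rule: infinite_finite_induct) auto

text \<open>
  The monomials of degree at most \<open>n\<close> in each of three ratios, multiplied by the \<open>n\<close>-th powers of the
  denominators, are \<open>(n + 1)\<^sup>3\<close> polynomials of bidegree at most \<open>3 n d\<close>, that is, in a space of
  dimension \<open>(3 n d + 1)\<^sup>2\<close>. For large \<open>n\<close> there are more monomials than dimensions.
\<close>

theorem three_ratios_dependent:
  fixes num den :: "nat \<Rightarrow> real poly poly"
  shows "\<exists>n L. (\<exists>a\<le>n. \<exists>b\<le>n. \<exists>c\<le>n. L a b c \<noteq> 0) \<and>
     (\<forall>x y. (\<forall>i<3. eval2 (den i) x y \<noteq> 0) \<longrightarrow>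
        (\<Sum>c\<le>n. (\<Sum>b\<le>n. (\<Sum>a\<le>n. L a b c * (eval2 (num 0) x y / eval2 (den 0) x y) ^ a)
           * (eval2 (num 1) x y / eval2 (den 1) x y) ^ b)
           * (eval2 (num 2) x y / eval2 (den 2) x y) ^ c) = (0::real))"
proof -
  have "finite (num ` {..<3} \<union> den ` {..<3})" by simp
  from common_bidegree[OF this] obtain d where "\<forall>p\<in>num ` {..<3} \<union> den ` {..<3}. bidegree_le p d" by blast
  then have d: "bidegree_le (num i) d" "bidegree_le (den i) d" if "i < 3" for i using that by auto
  \<comment> \<open>Large enough for \<open>(3 n d + 1)\<^sup>2 < (n + 1)\<^sup>3\<close>.\<close>
  define n where "n = 9 * (d + 1) ^ 2"
  define hom where "hom i a = num i ^ a * den i ^ (n - a)" for i a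
  define mon where "mon = (\<lambda>(a, b, c). hom 0 a * hom 1 b * hom 2 c)"
  define N where "N = 3 * n * d"
  have hom: "bidegree_le (hom i a) (n * d)" if "i < 3" "a \<le> n" for i a
    using bidegree_le_mult[OF bidegree_le_power[OF d(1)] bidegree_le_power[OF d(2)], OF that(1) that(1), of a "n - a"] that
    by (simp add: hom_def flip: add_mult_distrib)
  have N: "n * d + n * d + n * d = N" by (simp add: N_def)
  have mon: "bidegree_le (mon (a, b, c)) N" if "a \<le> n" "b \<le> n" "c \<le> n" for a b c
    using bidegree_le_mult[OF bidegree_le_mult[OF hom[of 0 a] hom[of 1 b]] hom[of 2 c]] that
    by (simp add: mon_def N)
  let ?I = "{..N} \<times> {..N}" and ?J = "{..n} \<times> {..n} \<times> {..n}"
  have "N + 1 \<le> 3 * (d + 1) * (n + 1)" by (simp add: N_def algebra_simps)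
  then have "(N + 1) ^ 2 \<le> (3 * (d + 1) * (n + 1)) ^ 2" by (rule power_mono) simp
  also have "\<dots> = n * (n + 1) ^ 2"
  proof -
    have "3 ^ 2 * (d + 1) ^ 2 = n" by (simp add: n_def)
    then show ?thesis by (simp only: power_mult_distrib)
  qed
  also have "\<dots> < (n + 1) ^ 3" by (simp add: power3_eq_cube power2_eq_square)
  finally have card: "card ?I < card ?J" by (simp add: card_cartesian_product power3_eq_cube power2_eq_square algebra_simps)
  have "finite ?I" "finite ?J" by auto
  from homogeneous_system_nontrivial[OF this card, of "\<lambda>i j. coeff (coeff (mon j) (fst i)) (snd i)"]
  obtain L where L0: "\<exists>j\<in>?J. L j \<noteq> 0"
    and L: "\<And>i. i \<in> ?I \<Longrightarrow> (\<Sum>j\<in>?J. coeff (coeff (mon j) (fst i)) (snd i) * L j) = 0"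
    by blast
  define P where "P = (\<Sum>j\<in>?J. smult [:L j:] (mon j))"
  have "coeff (coeff P i) k = 0" for i k
  proof (cases "i \<le> N \<and> k \<le> N")
    case True
    have "coeff (coeff P i) k = (\<Sum>j\<in>?J. coeff (coeff (mon j) i) k * L j)"
      unfolding P_def coeff_sum by (intro sum.cong) auto
    then show ?thesis using L[of "(i, k)"] True by simp
  next
    case False
    have "coeff (coeff (mon j) i) k = 0" if "j \<in> ?J" for j
    proof -
      have "bidegree_le (mon j) N" using that mon by auto
      then have "degree (mon j) \<le> N" "degree (coeff (mon j) i) \<le> N" by (auto simp: bidegree_le_def)
      then show ?thesis using False by (metis coeff_0 coeff_eq_0 le_trans not_le)
    qed
    then show ?thesis unfolding P_def coeff_sum by (intro sum.neutral) auto
  qed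
  then have P0: "P = 0" by (auto intro!: poly_eqI)
  show ?thesis
  proof (rule exI[of _ n], rule exI[of _ "\<lambda>a b c. L (a, b, c)"], intro conjI allI impI)
    show "\<exists>a\<le>n. \<exists>b\<le>n. \<exists>c\<le>n. L (a, b, c) \<noteq> 0" using L0 by auto
  next
    fix x y assume den: "\<forall>i<3. eval2 (den i) x y \<noteq> 0"
    define u where "u i = eval2 (num i) x y / eval2 (den i) x y" for i
    define K where "K = eval2 (den 0) x y ^ n * eval2 (den 1) x y ^ n * eval2 (den 2) x y ^ n"
    have K0: "K \<noteq> 0" using den by (simp add: K_def)
    have h: "eval2 (hom i a) x y = eval2 (den i) x y ^ n * u i ^ a" if "i < 3" "a \<le> n" for i a
    proof -
      have "eval2 (den i) x y ^ n = eval2 (den i) x y ^ a * eval2 (den i) x y ^ (n - a)"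
        using that by (simp flip: power_add)
      then show ?thesis using den that by (simp add: hom_def u_def power_divide)
    qed
    have "0 = (\<Sum>j\<in>?J. L j * eval2 (mon j) x y)"
      using arg_cong[OF P0, of "\<lambda>p. eval2 p x y"] by (simp add: P_def eval2_sum)
    also have "\<dots> = (\<Sum>j\<in>?J. K * (case j of (a, b, c) \<Rightarrow> L (a, b, c) * u 0 ^ a * u 1 ^ b * u 2 ^ c))"
      by (intro sum.cong) (auto simp: mon_def h K_def)
    also have "\<dots> = K * (\<Sum>a\<le>n. \<Sum>b\<le>n. \<Sum>c\<le>n. L (a, b, c) * u 0 ^ a * u 1 ^ b * u 2 ^ c)"
      by (simp add: sum_distrib_left[symmetric] sum.cartesian_product[symmetric])
    finally have "(\<Sum>a\<le>n. \<Sum>b\<le>n. \<Sum>c\<le>n. L (a, b, c) * u 0 ^ a * u 1 ^ b * u 2 ^ c) = 0"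
      using K0 by simp
    also have "(\<Sum>a\<le>n. \<Sum>b\<le>n. \<Sum>c\<le>n. L (a, b, c) * u 0 ^ a * u 1 ^ b * u 2 ^ c)
       = (\<Sum>a\<le>n. \<Sum>c\<le>n. \<Sum>b\<le>n. L (a, b, c) * u 0 ^ a * u 1 ^ b * u 2 ^ c)"
      by (intro sum.cong refl sum.swap)
    also have "\<dots> = (\<Sum>c\<le>n. \<Sum>a\<le>n. \<Sum>b\<le>n. L (a, b, c) * u 0 ^ a * u 1 ^ b * u 2 ^ c)"
      by (rule sum.swap)
    also have "\<dots> = (\<Sum>c\<le>n. \<Sum>b\<le>n. \<Sum>a\<le>n. L (a, b, c) * u 0 ^ a * u 1 ^ b * u 2 ^ c)"
      by (intro sum.cong refl sum.swap)
    also have "\<dots> = (\<Sum>c\<le>n. (\<Sum>b\<le>n. (\<Sum>a\<le>n. L (a, b, c) * u 0 ^ a) * u 1 ^ b) * u 2 ^ c)"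
      by (simp add: sum_distrib_right)
    finally show "(\<Sum>c\<le>n. (\<Sum>b\<le>n. (\<Sum>a\<le>n. L (a, b, c) * (eval2 (num 0) x y / eval2 (den 0) x y) ^ a)
           * (eval2 (num 1) x y / eval2 (den 1) x y) ^ b)
           * (eval2 (num 2) x y / eval2 (den 2) x y) ^ c) = 0"
      by (simp add: u_def)
  qed
qed

text \<open>
  One nonzero coefficient makes the polynomials obtained by fixing the variables one after the other
  nonzero, and each of them has finitely many roots.
\<close>

lemma trivariate_generic_nonzero:
  fixes L :: "nat \<Rightarrow> nat \<Rightarrow> nat \<Rightarrow> real"
  assumes "\<exists>a\<le>n. \<exists>b\<le>n. \<exists>c\<le>n. L a b c \<noteq> 0"
  shows "\<forall>\<^sub>\<infinity>u. \<forall>\<^sub>\<infinity>v. \<forall>\<^sub>\<infinity>w. (\<Sum>c\<le>n. (\<Sum>b\<le>n. (\<Sum>a\<le>n. L a b c * u ^ a) * v ^ b) * w ^ c) \<noteq> 0"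
proof -
  have roots: "\<forall>\<^sub>\<infinity>u. (\<Sum>a\<le>n. f a * u ^ a) \<noteq> 0" if "\<exists>a\<le>n. f a \<noteq> 0" for f :: "nat \<Rightarrow> real"
    using that polyfun_finite_roots[of f n] by (auto simp: eventually_cofinite)
  from assms obtain a b c where abc: "a \<le> n" "b \<le> n" "c \<le> n" "L a b c \<noteq> 0" by blast
  have "\<forall>\<^sub>\<infinity>u. (\<Sum>a\<le>n. L a b c * u ^ a) \<noteq> 0" by (rule roots) (use abc in blast)
  then show ?thesis
  proof (rule eventually_mono)
    fix u assume u: "(\<Sum>a\<le>n. L a b c * u ^ a) \<noteq> 0"
    have "\<forall>\<^sub>\<infinity>v. (\<Sum>b\<le>n. (\<Sum>a\<le>n. L a b c * u ^ a) * v ^ b) \<noteq> 0"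
      by (rule roots) (use abc u in blast)
    then show "\<forall>\<^sub>\<infinity>v. \<forall>\<^sub>\<infinity>w. (\<Sum>c\<le>n. (\<Sum>b\<le>n. (\<Sum>a\<le>n. L a b c * u ^ a) * v ^ b) * w ^ c) \<noteq> 0"
    proof (rule eventually_mono)
      fix v assume v: "(\<Sum>b\<le>n. (\<Sum>a\<le>n. L a b c * u ^ a) * v ^ b) \<noteq> 0"
      show "\<forall>\<^sub>\<infinity>w. (\<Sum>c\<le>n. (\<Sum>b\<le>n. (\<Sum>a\<le>n. L a b c * u ^ a) * v ^ b) * w ^ c) \<noteq> 0"
        by (rule roots) (use abc v in blast)
    qed
  qed
qed

text \<open>
  Gauss's lemma: the scalar \<open>r\<close> divides the content of the cofactor of \<open>d\<close>.
\<close>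

lemma primitive_dvd_smult_cancel:
  fixes d p :: "real poly poly"
  assumes "content d = 1" "d dvd smult r p" "r \<noteq> 0"
  shows "d dvd p"
proof -
  from assms(2) obtain e where e: "smult r p = d * e" by (auto elim: dvdE)
  have "content (smult r p) = content e"
    unfolding e content_mult assms(1) by simp
  then have "normalize r * content p = content e" by simp
  then have "[:r:] dvd e" by (metis const_poly_dvd_iff_dvd_content dvd_triv_left normalize_dvd_iff)
  then obtain e' where "e = [:r:] * e'" by (auto elim: dvdE)
  then have "e = smult r e'" by simp
  with e have "smult r p = smult r (d * e')" by simp
  then have "p = d * e'" using assms(3) by (simp only: smult_cancel)
  then show ?thesis by simp
qed

text \<open>
  A nonzero combination \<open>d\<close> of \<open>p\<close> and \<open>q\<close> of smallest degree in \<open>y\<close> divides both of them up to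
  polynomials in \<open>x\<close>, by division with remainder. Hence its primitive part divides \<open>p\<close> and \<open>q\<close> and is
  a unit.
\<close>

lemma coprime_bezout_over_line:
  fixes p q :: "real poly poly"
  assumes "coprime p q" "q \<noteq> 0"
  shows "\<exists>u v r. r \<noteq> 0 \<and> u * p + v * q = [:r:]"
proof -
  define Id where "Id d \<longleftrightarrow> d \<noteq> 0 \<and> (\<exists>u v. d = u * p + v * q)" for d
  have "q = 0 * p + 1 * q" by simp
  then have "Id q" using assms(2) unfolding Id_def by blast
  define d where "d = arg_min degree Id"
  have d: "Id d" "\<And>e. Id e \<Longrightarrow> degree d \<le> degree e"
    using arg_min_nat_lemma[of Id q degree] \<open>Id q\<close> by (auto simp: d_def)
  have d0: "d \<noteq> 0" using d(1) by (simp add: Id_def)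
  have dvd: "\<exists>r. r \<noteq> 0 \<and> d dvd smult r s" if s: "\<exists>u v. s = u * p + v * q" for s
  proof -
    obtain B G where BG: "pseudo_divmod s d = (B, G)" by fastforce
    define r where "r = lead_coeff d ^ (Suc (degree s) - degree d)"
    have eq: "smult r s = d * B + G" and deg: "G = 0 \<or> degree G < degree d"
      using pseudo_divmod[OF d0 BG] by (auto simp: r_def)
    obtain u v u' v' where "s = u * p + v * q" "d = u' * p + v' * q" using s d(1) by (auto simp: Id_def)
    then have "G = (smult r u - u' * B) * p + (smult r v - v' * B) * q"
      using eq by (simp add: algebra_simps smult_add_right)
    then have "\<exists>u v. G = u * p + v * q" by blast
    then have "G \<noteq> 0 \<Longrightarrow> Id G" by (simp add: Id_def)
    then have "G = 0" using deg d(2)[of G] by fastforce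
    then show ?thesis using eq d0 by (intro exI[of _ r]) (auto simp: r_def)
  qed
  define d' where "d' = primitive_part d"
  have c: "content d' = 1" using d0 by (simp add: d'_def)
  have dd: "d = smult (content d) d'" by (simp add: d'_def)
  have "d' dvd d" by (subst dd) (rule dvd_smult, simp)
  have "\<exists>u v. p = u * p + v * q" "\<exists>u v. q = u * p + v * q"
    by (rule exI[of _ 1], rule exI[of _ 0], simp) (rule exI[of _ 0], rule exI[of _ 1], simp)
  then have "d' dvd p" "d' dvd q"
    using dvd \<open>d' dvd d\<close> primitive_dvd_smult_cancel[OF c] by (meson dvd_trans)+
  then have "is_unit d'" using assms(1) by (simp add: coprime_common_divisor)
  then obtain e where "d' = [:e:]" by (metis is_unit_polyE)
  with dd have "d = [:content d * e:]" by (metis smult_0_right smult_pCons)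
  then show ?thesis using d(1) unfolding Id_def by (metis pCons_eq_0_iff)
qed

lemma coprime_common_zeros_on_finitely_many_lines:
  assumes "coprime p q" "q \<noteq> 0"
  shows "finite {x. \<exists>y. eval2 p x y = 0 \<and> eval2 q x y = 0}"
proof -
  obtain u v r where r: "r \<noteq> 0" "u * p + v * q = [:r:]"
    using coprime_bezout_over_line[OF assms] by blast
  have "poly r x = 0" if "eval2 p x y = 0" "eval2 q x y = 0" for x y
    using arg_cong[OF r(2), of "\<lambda>s. eval2 s x y"] that by simp
  then have "{x. \<exists>y. eval2 p x y = 0 \<and> eval2 q x y = 0} \<subseteq> {x. poly r x = 0}" by auto
  then show ?thesis using poly_roots_finite[OF r(1)] by (rule finite_subset)
qed

section \<open>The projective line as a circle, and coordinates on the graphoid\<close>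

lemma compact_space_proj_line: "compact_space proj_line"
  by (simp add: proj_line_def compact_space_Alexandroff_compactification)

lemma Hausdorff_space_proj_line: "Hausdorff_space proj_line"
  unfolding proj_line_def Hausdorff_space_Alexandroff_compactification
  by (metis Hausdorff_space_euclidean locally_compact_space_euclidean)

lemma openin_proj_line:
  "openin proj_line V \<longleftrightarrow> (\<exists>U. open U \<and> V = Some ` U) \<or> (\<exists>C. compact C \<and> V = insert None (Some ` (- C)))"
  unfolding proj_line_def openin_Alexandroff_compactification
  by (auto simp: compactin_euclidean_iff Compl_eq_Diff_UNIV compact_imp_closed)

text \<open>
  The Cayley transform \<open>(1 + \<i> t) / (1 - \<i> t)\<close>, which identifies the projective line with the unit
  circle. It supplies the line with a metric and with the continuous rational functions
  \<open>Re (circ t) = (1 - t\<^sup>2) / (1 + t\<^sup>2)\<close> and \<open>Im (circ t) = 2 t / (1 + t\<^sup>2)\<close>.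
\<close>

fun circ :: "proj_real \<Rightarrow> complex" where
  "circ None = -1"
| "circ (Some t) = 2 / (1 - \<i> * of_real t) - 1"

declare circ.simps(2) [simp del]

lemma one_minus_i_nz: "1 - \<i> * of_real t \<noteq> 0"
  by (simp add: complex_eq_iff)

lemma norm_one_minus_i: "norm (1 - \<i> * of_real t) \<ge> 1" "norm (1 - \<i> * of_real t) \<ge> \<bar>t\<bar>"
  using abs_Re_le_cmod[of "1 - \<i> * of_real t"] abs_Im_le_cmod[of "1 - \<i> * of_real t"] by auto

lemma Re_circ: "Re (circ (Some t)) = (1 - t\<^sup>2) / (1 + t\<^sup>2)"
  and Im_circ: "Im (circ (Some t)) = 2 * t / (1 + t\<^sup>2)"
proof -
  have "1 + t\<^sup>2 \<noteq> 0" by (metis add_pos_nonneg less_irrefl zero_le_power2 zero_less_one)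
  then show "Re (circ (Some t)) = (1 - t\<^sup>2) / (1 + t\<^sup>2)" "Im (circ (Some t)) = 2 * t / (1 + t\<^sup>2)"
    by (simp_all add: circ.simps(2) Re_divide Im_divide field_simps power2_eq_square)
qed

lemma circ_lipschitz: "norm (circ (Some s) - circ (Some t)) \<le> 2 * \<bar>s - t\<bar>"
proof -
  let ?a = "1 - \<i> * complex_of_real s" and ?b = "1 - \<i> * complex_of_real t"
  have "circ (Some s) - circ (Some t) = 2 * \<i> * of_real (s - t) / (?a * ?b)"
    using one_minus_i_nz[of s] one_minus_i_nz[of t] by (simp add: circ.simps(2) field_simps)
  then have "norm (circ (Some s) - circ (Some t)) = 2 * \<bar>s - t\<bar> / (norm ?a * norm ?b)"
    by (simp add: norm_mult norm_divide del: of_real_diff)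
  also have "\<dots> \<le> 2 * \<bar>s - t\<bar> / 1"
    using mult_mono[OF norm_one_minus_i(1)[of s] norm_one_minus_i(1)[of t]]
    by (intro divide_left_mono) (auto intro: order.strict_trans2[of 0 1])
  finally show ?thesis by simp
qed

lemma circ_near_infinity: "t \<noteq> 0 \<Longrightarrow> norm (circ (Some t) - circ None) \<le> 2 / \<bar>t\<bar>"
  using norm_one_minus_i(2)[of t] by (simp add: circ.simps(2) norm_divide frac_le)

lemma inj_circ: "inj circ"
proof (rule injI)
  fix u v assume "circ u = circ v"
  then show "u = v"
    using one_minus_i_nz by (cases u; cases v) (auto simp: circ.simps(2) frac_eq_eq)
qed

lemma continuous_map_circ: "continuous_map proj_line euclidean circ"
proof -
  have cont: "continuous_on UNIV (\<lambda>t. circ (Some t))"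
    unfolding circ.simps by (intro continuous_intros ballI one_minus_i_nz)
  show ?thesis
  proof (rule continuous_map_alt[THEN iffD2], intro conjI allI impI)
    fix S :: "complex set" assume "openin euclidean S"
    then have S: "open S" by simp
    define U where "U = {t. circ (Some t) \<in> S}"
    have oU: "open U" using open_vimage[OF S cont] by (simp add: U_def vimage_def )
    show "openin proj_line (circ -` S \<inter> topspace proj_line)"
    proof (cases "-1 \<in> S")
      case False
      then have "v \<in> circ -` S \<longleftrightarrow> v \<in> Some ` U" for v
        by (cases v) (auto simp: U_def)
      then have "circ -` S \<inter> topspace proj_line = Some ` U" by auto
      then show ?thesis using oU openin_proj_line by blast
    next
      case True
      then obtain e where e: "e > 0" "ball (-1) e \<subseteq> S" using S open_contains_ball by blast
      have "bounded (- U)"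
        unfolding bounded_iff
      proof (intro exI ballI)
        fix t assume t: "t \<in> - U"
        show "norm t \<le> 2 / e"
        proof (rule ccontr)
          assume *: "\<not> norm t \<le> 2 / e"
          moreover have "2 / e > 0" using e by simp
          ultimately have "t \<noteq> 0" "\<bar>t\<bar> > 2 / e" by auto
          then have "2 / \<bar>t\<bar> < e" using e by (simp add: field_simps)
          moreover have "dist (- 1) (circ (Some t)) \<le> 2 / \<bar>t\<bar>"
            using circ_near_infinity[OF \<open>t \<noteq> 0\<close>] by (metis dist_commute dist_norm circ.simps(1))
          ultimately have "circ (Some t) \<in> ball (-1) e" by simp
          then show False using e(2) t by (auto simp: U_def)
        qed
      qed
      then have cU: "compact (- U)" using oU by (simp add: compact_eq_bounded_closed closed_Compl)
      have "v \<in> circ -` S \<longleftrightarrow> v \<in> insert None (Some ` (- (- U)))" for v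
        using True by (cases v) (auto simp: U_def)
      then have "circ -` S \<inter> topspace proj_line = insert None (Some ` (- (- U)))" by auto
      then show ?thesis using openin_proj_line cU by metis
    qed
  qed auto
qed

text \<open>
  \<open>circ\<close> is a closed map, being continuous and injective on a compact space.
\<close>

lemma circ_ball_inside_open:
  assumes "openin proj_line W" "v \<in> W"
  obtains r where "r > 0" "\<And>u. norm (circ u - circ v) < r \<Longrightarrow> u \<in> W"
proof -
  have "closed_map proj_line euclidean circ"
    by (rule continuous_imp_closed_map[OF continuous_map_circ compact_space_proj_line]) simp
  moreover have "closedin proj_line (- W)" using assms(1) by (simp add: closedin_def double_compl Compl_eq_Diff_UNIV Diff_Diff_Int)
  ultimately have "closed (circ ` (- W))" by (simp add: closed_map_def)
  then have "open (- (circ ` (- W)))" by (rule open_Compl)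
  moreover have "circ v \<in> - (circ ` (- W))" using assms(2) inj_circ by (auto dest: injD)
  ultimately obtain r where r: "r > 0" "ball (circ v) r \<subseteq> - (circ ` (- W))"
    using open_contains_ball by blast
  show thesis
  proof
    fix u assume "norm (circ u - circ v) < r"
    then have "circ u \<in> ball (circ v) r" by (simp add: dist_norm norm_minus_commute)
    then show "u \<in> W" using r(2) by blast
  qed fact
qed

lemma openin_circ_ball: "openin proj_line {u. norm (circ u - c) < r}"
proof -
  have "openin proj_line {u \<in> topspace proj_line. circ u \<in> ball c r}"
    by (rule openin_continuous_map_preimage[OF continuous_map_circ]) simp
  then show ?thesis by (simp add: dist_norm norm_minus_commute)
qed

text \<open>
  The abscissa and the ordinate are treated on the same footing as the members of \<open>\<F>\<close>; each coordinate
  is a quotient of two polynomials on the real plane.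
\<close>

datatype coord = Abscissa | Ordinate | Ratfun ratfun2

fun coord_of :: "coord \<Rightarrow> (proj_real \<times> proj_real) \<times> (ratfun2 \<Rightarrow> proj_real) \<Rightarrow> proj_real" where
  "coord_of Abscissa (z, w) = fst z"
| "coord_of Ordinate (z, w) = snd z"
| "coord_of (Ratfun f) (z, w) = w f"

fun coord_num :: "coord \<Rightarrow> real poly poly" where
  "coord_num Abscissa = [:[:0, 1:]:]"
| "coord_num Ordinate = [:0, 1:]"
| "coord_num (Ratfun f) = rf_num f"

fun coord_den :: "coord \<Rightarrow> real poly poly" where
  "coord_den (Ratfun f) = rf_denom f"
| "coord_den _ = 1"

definition coords :: "ratfun2 set \<Rightarrow> coord set" where
  "coords \<F> = {Abscissa, Ordinate} \<union> Ratfun ` \<F>"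

definition regular_at :: "coord \<Rightarrow> real \<Rightarrow> real \<Rightarrow> bool" where
  "regular_at i x y \<longleftrightarrow> \<not> (eval2 (coord_num i) x y = 0 \<and> eval2 (coord_den i) x y = 0)"

definition coord_val :: "coord \<Rightarrow> real \<Rightarrow> real \<Rightarrow> proj_real" where
  "coord_val i x y = (if eval2 (coord_den i) x y = 0 then None
     else Some (eval2 (coord_num i) x y / eval2 (coord_den i) x y))"

lemma coord_val_simps [simp]:
  "coord_val Abscissa x y = Some x" "coord_val Ordinate x y = Some y"
  "rf_val f (Some x, Some y) = coord_val (Ratfun f) x y"
  "regular_at Abscissa x y" "regular_at Ordinate x y"
  by (auto simp: coord_val_def regular_at_def) (auto simp: eval2_def)

lemma rf_dom_iff: "(z \<in> rf_dom f) \<longleftrightarrow> (\<exists>x y. z = (Some x, Some y) \<and> regular_at (Ratfun f) x y)"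
  by (auto simp: rf_dom_def regular_at_def)

lemma coord_norm_pos: "regular_at i x y \<Longrightarrow> eval2 (coord_den i) x y ^ 2 + eval2 (coord_num i) x y ^ 2 > 0"
  by (auto simp: regular_at_def sum_power2_gt_zero_iff)

text \<open>
  The formulas remain valid where the denominator of the coordinate vanishes and its value is infinite.
\<close>

lemma circ_coord_val_components:
  assumes "regular_at i x y"
  shows "Re (circ (coord_val i x y)) = (eval2 (coord_den i) x y ^ 2 - eval2 (coord_num i) x y ^ 2)
           / (eval2 (coord_den i) x y ^ 2 + eval2 (coord_num i) x y ^ 2)"
    and "Im (circ (coord_val i x y)) = 2 * eval2 (coord_den i) x y * eval2 (coord_num i) x y
           / (eval2 (coord_den i) x y ^ 2 + eval2 (coord_num i) x y ^ 2)"
proof -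
  let ?q = "eval2 (coord_den i) x y" and ?p = "eval2 (coord_num i) x y"
  have "Re (circ (coord_val i x y)) = (?q ^ 2 - ?p ^ 2) / (?q ^ 2 + ?p ^ 2) \<and>
        Im (circ (coord_val i x y)) = 2 * ?q * ?p / (?q ^ 2 + ?p ^ 2)"
  proof (cases "?q = 0")
    case True
    then show ?thesis using assms by (simp add: coord_val_def regular_at_def)
  next
    case False
    have pos: "?q ^ 2 + ?p ^ 2 \<noteq> 0" using coord_norm_pos[OF assms] by (rule less_imp_neq[symmetric])
    have *: "1 + (?p / ?q) ^ 2 = (?q ^ 2 + ?p ^ 2) / ?q ^ 2" "1 - (?p / ?q) ^ 2 = (?q ^ 2 - ?p ^ 2) / ?q ^ 2"
      "2 * (?p / ?q) = 2 * ?q * ?p / ?q ^ 2"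
      using False by (simp_all add: power_divide add_divide_distrib diff_divide_distrib power2_eq_square)
    have val: "coord_val i x y = Some (?p / ?q)" using False by (simp add: coord_val_def)
    show ?thesis unfolding val Re_circ Im_circ * using False by simp
  qed
  then show "Re (circ (coord_val i x y)) = (?q ^ 2 - ?p ^ 2) / (?q ^ 2 + ?p ^ 2)"
            "Im (circ (coord_val i x y)) = 2 * ?q * ?p / (?q ^ 2 + ?p ^ 2)" by auto
qed

lemma finite_irregular_lines: "finite {x. \<exists>y. \<not> regular_at i x y}"
proof (cases i)
  case (Ratfun f)
  have "coprime (rf_num f) (rf_denom f)" "rf_denom f \<noteq> 0"
    by (simp_all add: rf_num_def rf_denom_def coprime_quot_of_fract)
  then show ?thesis
    using coprime_common_zeros_on_finitely_many_lines Ratfun by (simp add: regular_at_def)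
qed auto

section \<open>Topology of the graphoid\<close>

abbreviation ambient :: "ratfun2 set \<Rightarrow> ((proj_real \<times> proj_real) \<times> (ratfun2 \<Rightarrow> proj_real)) topology" where
  "ambient \<F> \<equiv> prod_topology torus (product_topology (\<lambda>_. proj_line) \<F>)"

lemma compact_Hausdorff_ambient: "compact_space (ambient \<F>)" "Hausdorff_space (ambient \<F>)"
  by (simp_all add: torus_def compact_space_prod_topology Hausdorff_space_prod_topology
      compact_space_product_topology Hausdorff_space_product_topology
      compact_space_proj_line Hausdorff_space_proj_line)

lemma continuous_map_coord_ambient:
  assumes "i \<in> coords \<F>"
  shows "continuous_map (ambient \<F>) proj_line (coord_of i)"
proof -
  have z: "continuous_map (ambient \<F>) torus fst" by (rule continuous_map_fst)
  show ?thesis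
  proof (cases i)
    case Abscissa
    have "continuous_map (ambient \<F>) proj_line (fst \<circ> fst)"
      using continuous_map_compose[OF z] continuous_map_fst unfolding torus_def by blast
    then show ?thesis by (rule continuous_map_eq) (auto simp: Abscissa)
  next
    case Ordinate
    have "continuous_map (ambient \<F>) proj_line (snd \<circ> fst)"
      using continuous_map_compose[OF z] continuous_map_snd unfolding torus_def by blast
    then show ?thesis by (rule continuous_map_eq) (auto simp: Ordinate)
  next
    case (Ratfun f)
    then have "f \<in> \<F>" using assms by (auto simp: coords_def)
    then have "continuous_map (ambient \<F>) proj_line ((\<lambda>w. w f) \<circ> snd)"
      by (intro continuous_map_compose[OF continuous_map_snd] continuous_map_product_projection)
    then show ?thesis by (rule continuous_map_eq) (auto simp: Ratfun)
  qed
qed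

lemma graphoid_subset: "graphoid \<F> \<subseteq> topspace (ambient \<F>)"
  by (auto simp: graphoid_def graphoid_ext_def)

lemma topspace_graphoid_space [simp]: "topspace (graphoid_space \<F>) = graphoid \<F>"
  using graphoid_subset by (auto simp: graphoid_space_def)

lemma continuous_map_coord_of:
  "i \<in> coords \<F> \<Longrightarrow> continuous_map (graphoid_space \<F>) proj_line (coord_of i)"
  unfolding graphoid_space_def
  by (intro continuous_map_from_subtopology continuous_map_coord_ambient)

lemma openin_coord_box:
  assumes "\<And>i. i \<in> I \<Longrightarrow> continuous_map X proj_line (c i)" "finite I"
    "\<And>i. i \<in> I \<Longrightarrow> openin proj_line (W i)"
  shows "openin X {q \<in> topspace X. \<forall>i\<in>I. c i q \<in> W i}"
proof -
  have "openin X (topspace X \<inter> \<Inter> ((\<lambda>i. {q \<in> topspace X. c i q \<in> W i}) ` I))"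
    using assms by (intro openin_Int_Inter) (auto intro: openin_continuous_map_preimage)
  also have "topspace X \<inter> \<Inter> ((\<lambda>i. {q \<in> topspace X. c i q \<in> W i}) ` I)
      = {q \<in> topspace X. \<forall>i\<in>I. c i q \<in> W i}" by auto
  finally show ?thesis .
qed

text \<open>
  A failure of the approximation property is witnessed by finitely many open conditions, and these
  conditions witness the failure at all nearby points.
\<close>

lemma closedin_graphoid: "closedin (ambient \<F>) (graphoid \<F>)"
proof -
  have "openin (ambient \<F>) (topspace (ambient \<F>) - graphoid \<F>)"
  proof (subst openin_subopen, intro ballI)
    fix p assume p: "p \<in> topspace (ambient \<F>) - graphoid \<F>"
    obtain z w where zw: "p = (z, w)" by fastforce
    with p have "w \<in> topspace (product_topology (\<lambda>_. proj_line) \<F>)" "w \<notin> graphoid_ext \<F> z"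
      by (auto simp: graphoid_def)
    then obtain U \<E> W where UEW: "openin torus U" "z \<in> U" "finite \<E>" "\<E> \<subseteq> \<F>"
      "\<forall>f\<in>\<E>. openin proj_line (W f) \<and> w f \<in> W f"
      "\<not> (\<exists>z'\<in>U \<inter> (\<Inter>f\<in>\<E>. rf_dom f). \<forall>f\<in>\<E>. rf_val f z' \<in> W f)"
      unfolding graphoid_ext_def by blast
    define N where "N = {q \<in> topspace (ambient \<F>). fst q \<in> U} \<inter>
      {q \<in> topspace (ambient \<F>). \<forall>f\<in>\<E>. coord_of (Ratfun f) q \<in> W f}"
    have "openin (ambient \<F>) N"
      unfolding N_def using UEW
      by (intro openin_Int openin_continuous_map_preimage[OF continuous_map_fst] openin_coord_box
          continuous_map_coord_ambient) (auto simp: coords_def)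
    moreover have "p \<in> N" using p UEW by (auto simp: N_def zw)
    moreover have "N \<subseteq> topspace (ambient \<F>) - graphoid \<F>"
    proof
      fix q assume q: "q \<in> N"
      obtain z' w' where q_eq: "q = (z', w')" by fastforce
      have "w' \<notin> graphoid_ext \<F> z'"
      proof
        assume "w' \<in> graphoid_ext \<F> z'"
        moreover have "z' \<in> U" "\<forall>f\<in>\<E>. openin proj_line (W f) \<and> w' f \<in> W f"
          using q UEW by (auto simp: N_def q_eq)
        ultimately show False using UEW unfolding graphoid_ext_def by blast
      qed
      then show "q \<in> topspace (ambient \<F>) - graphoid \<F>"
        using q by (auto simp: N_def q_eq graphoid_def)
    qed
    ultimately show "\<exists>T. openin (ambient \<F>) T \<and> p \<in> T \<and> T \<subseteq> topspace (ambient \<F>) - graphoid \<F>"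
      by blast
  qed
  then show ?thesis using graphoid_subset by (simp add: closedin_def)
qed

lemma compact_graphoid_space: "compact_space (graphoid_space \<F>)"
  unfolding graphoid_space_def
  by (intro compact_space_subtopology closedin_compact_space compact_Hausdorff_ambient closedin_graphoid)

lemma Hausdorff_graphoid_space: "Hausdorff_space (graphoid_space \<F>)"
  unfolding graphoid_space_def by (intro Hausdorff_space_subtopology compact_Hausdorff_ambient)

lemma graphoid_extE:
  assumes "w \<in> graphoid_ext \<F> z" "openin torus U" "z \<in> U" "finite \<E>" "\<E> \<subseteq> \<F>"
    "\<And>f. f \<in> \<E> \<Longrightarrow> openin proj_line (W f) \<and> w f \<in> W f"
  obtains z' where "z' \<in> U" "\<And>f. f \<in> \<E> \<Longrightarrow> z' \<in> rf_dom f \<and> rf_val f z' \<in> W f"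
proof -
  have "\<exists>z'\<in>U \<inter> (\<Inter>f\<in>\<E>. rf_dom f). \<forall>f\<in>\<E>. rf_val f z' \<in> W f"
    using assms(1)[unfolded graphoid_ext_def, THEN CollectD, THEN conjunct2, rule_format, of U \<E> W] assms(2-)
    by simp
  then show thesis using that by auto
qed

text \<open>
  Open conditions on finitely many coordinates that hold at a point of the graphoid hold at a point
  of the graph. The coordinate \<open>f\<close> is there to force the approximating point into the real plane:
  without any rational function it could lie at infinity.
\<close>

lemma graphoid_approx:
  assumes p: "p \<in> graphoid \<F>" and I: "finite I" "I \<subseteq> coords \<F>" "Ratfun f \<in> I"
    and W: "\<And>i. i \<in> I \<Longrightarrow> openin proj_line (W i) \<and> coord_of i p \<in> W i"
  shows "\<exists>x y. \<forall>i\<in>I. regular_at i x y \<and> coord_val i x y \<in> W i"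
proof -
  obtain z w where zw: "p = (z, w)" by fastforce
  define A where "A i = (if i \<in> I then W i else UNIV)" for i
  have A: "openin proj_line (A i)" for i
    using W openin_topspace[of proj_line] by (simp add: A_def)
  have U: "openin torus (A Abscissa \<times> A Ordinate)" "z \<in> A Abscissa \<times> A Ordinate"
    using A W[of Abscissa] W[of Ordinate] unfolding torus_def openin_prod_Times_iff
    by (auto simp: A_def zw mem_Times_iff)
  have "finite (Ratfun -` I)" using I(1) by (intro finite_vimageI) (auto intro: injI)
  moreover have "Ratfun -` I \<subseteq> \<F>" using I(2) by (auto simp: coords_def)
  moreover have "openin proj_line (W (Ratfun f)) \<and> w f \<in> W (Ratfun f)" if "f \<in> Ratfun -` I" for f
    using W[of "Ratfun f"] that by (simp add: zw)
  moreover have "w \<in> graphoid_ext \<F> z" using p by (simp add: graphoid_def zw)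
  ultimately obtain z' where z': "z' \<in> A Abscissa \<times> A Ordinate"
    "\<And>f. f \<in> Ratfun -` I \<Longrightarrow> z' \<in> rf_dom f \<and> rf_val f z' \<in> W (Ratfun f)"
    using graphoid_extE[OF _ U, where W = "\<lambda>f. W (Ratfun f)"] by metis
  have "z' \<in> rf_dom f" using z'(2) I(3) by blast
  then obtain x y where xy: "z' = (Some x, Some y)" by (auto simp: rf_dom_iff)
  have "regular_at i x y \<and> coord_val i x y \<in> W i" if i: "i \<in> I" for i
  proof (cases i)
    case (Ratfun g)
    then have "z' \<in> rf_dom g \<and> rf_val g z' \<in> W i" using z'(2)[of g] i by simp
    then show ?thesis by (simp add: xy rf_dom_iff Ratfun del: rf_val.simps)
  qed (use z'(1) i in \<open>auto simp: xy A_def\<close>)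
  then show ?thesis by blast
qed

lemma compact_space_finite_subcover:
  assumes "compact_space X" "\<And>x. x \<in> topspace X \<Longrightarrow> openin X (N x) \<and> x \<in> N x"
  obtains P where "finite P" "P \<subseteq> topspace X" "topspace X \<subseteq> \<Union>(N ` P)"
proof -
  have "\<exists>\<G>. finite \<G> \<and> \<G> \<subseteq> N ` topspace X \<and> topspace X \<subseteq> \<Union>\<G>"
  proof (rule compactinD)
    show "compactin X (topspace X)" using assms(1) unfolding compact_space_def .
    show "openin X V" if "V \<in> N ` topspace X" for V using that assms(2) by blast
    show "topspace X \<subseteq> \<Union>(N ` topspace X)" using assms(2) by blast
  qed
  then obtain \<G> where \<G>: "finite \<G>" "\<G> \<subseteq> N ` topspace X" "topspace X \<subseteq> \<Union>\<G>" by blast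
  from finite_subset_image[OF \<G>(1,2)] obtain P where "P \<subseteq> topspace X" "finite P" "\<G> = N ` P" by blast
  then show thesis using that \<G>(3) by blast
qed

lemma graphoid_basic_neighbourhood:
  assumes "openin (graphoid_space \<F>) U" "p \<in> U"
  shows "\<exists>I r. finite I \<and> I \<subseteq> coords \<F> \<and> r > 0 \<and>
    (\<forall>q\<in>graphoid \<F>. (\<forall>i\<in>I. norm (circ (coord_of i q) - circ (coord_of i p)) < r) \<longrightarrow> q \<in> U)"
proof -
  obtain T where T: "openin (ambient \<F>) T" "U = T \<inter> graphoid \<F>"
    using assms(1) unfolding graphoid_space_def openin_subtopology by blast
  obtain z w where zw: "p = (z, w)" by fastforce
  have "(z, w) \<in> T" using assms(2) T zw by blast
  then obtain Z V where ZV: "openin torus Z" "openin (product_topology (\<lambda>_. proj_line) \<F>) V"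
    "z \<in> Z" "w \<in> V" "Z \<times> V \<subseteq> T"
    using T(1) unfolding openin_prod_topology_alt by meson
  obtain A B where AB: "openin proj_line A" "openin proj_line B" "fst z \<in> A" "snd z \<in> B" "A \<times> B \<subseteq> Z"
    using ZV(1,3) unfolding torus_def openin_prod_topology_alt by (metis prod.collapse)
  obtain C where C: "w \<in> Pi\<^sub>E \<F> C" "\<And>f. openin proj_line (C f)" "finite {f. C f \<noteq> topspace proj_line}"
    "Pi\<^sub>E \<F> C \<subseteq> V"
    using product_topology_open_contains_basis[OF ZV(2,4)] by blast
  define I where "I = {Abscissa, Ordinate} \<union> Ratfun ` ({f. C f \<noteq> UNIV} \<inter> \<F>)"
  define W where "W i = (case i of Abscissa \<Rightarrow> A | Ordinate \<Rightarrow> B | Ratfun f \<Rightarrow> C f)" for i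
  have I: "finite I" "I \<subseteq> coords \<F>" using C(3) by (auto simp: I_def coords_def)
  have "\<exists>r>0. \<forall>u. norm (circ u - circ (coord_of i p)) < r \<longrightarrow> u \<in> W i" if "i \<in> I" for i
  proof -
    have "openin proj_line (W i)" using AB C by (auto simp: W_def split: coord.split)
    moreover have "coord_of i p \<in> W i" using that AB C(1) by (auto simp: I_def W_def zw PiE_iff)
    ultimately show ?thesis using circ_ball_inside_open by metis
  qed
  then obtain r where r: "\<And>i. i \<in> I \<Longrightarrow> r i > 0"
    "\<And>i u. i \<in> I \<Longrightarrow> norm (circ u - circ (coord_of i p)) < r i \<Longrightarrow> u \<in> W i" by metis
  define R where "R = Min (r ` I)"
  have I0: "I \<noteq> {}" by (auto simp: I_def)
  have R: "R > 0" "\<And>i. i \<in> I \<Longrightarrow> R \<le> r i" using I(1) I0 r(1) by (auto simp: R_def)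
  have "q \<in> U" if q: "q \<in> graphoid \<F>" "\<forall>i\<in>I. norm (circ (coord_of i q) - circ (coord_of i p)) < R" for q
  proof -
    obtain z' w' where q_eq: "q = (z', w')" by fastforce
    have W: "coord_of i q \<in> W i" if "i \<in> I" for i
      using r(2)[OF that] q(2) R(2)[OF that] that by fastforce
    have "fst z' \<in> A" "snd z' \<in> B" using W[of Abscissa] W[of Ordinate] by (auto simp: I_def W_def q_eq)
    then have "z' \<in> Z" using AB(5) by (metis mem_Times_iff subsetD)
    moreover have "w' \<in> Pi\<^sub>E \<F> C"
    proof (rule PiE_I)
      fix f assume "f \<in> \<F>"
      then show "w' f \<in> C f" using W[of "Ratfun f"] by (auto simp: I_def W_def q_eq)
    next
      fix f assume "f \<notin> \<F>"
      then show "w' f = undefined" using q(1) by (auto simp: q_eq graphoid_def graphoid_ext_def PiE_iff extensional_def)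
    qed
    ultimately show ?thesis using ZV(5) C(4) T(2) q(1) by (auto simp: q_eq)
  qed
  then show ?thesis using I R(1) by blast
qed

text \<open>
  The metric analogue of Lebesgue's number lemma. The basic neighbourhoods of the product topology
  constrain finitely many coordinates, and compactness makes one finite set \<open>I\<close> suffice.
\<close>

lemma graphoid_Lebesgue_number:
  assumes "open_cover (graphoid_space \<F>) \<U>"
  shows "\<exists>I r. finite I \<and> I \<subseteq> coords \<F> \<and> r > 0 \<and> (\<forall>p\<in>graphoid \<F>. \<exists>U\<in>\<U>. \<forall>q\<in>graphoid \<F>.
    (\<forall>i\<in>I. norm (circ (coord_of i q) - circ (coord_of i p)) < r) \<longrightarrow> q \<in> U)"
proof -
  let ?close = "\<lambda>I r p q. \<forall>i\<in>I. norm (circ (coord_of i q) - circ (coord_of i p)) < r"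
  have "\<exists>U I r. U \<in> \<U> \<and> finite I \<and> I \<subseteq> coords \<F> \<and> r > 0 \<and> (\<forall>q\<in>graphoid \<F>. ?close I r p q \<longrightarrow> q \<in> U)"
    if p: "p \<in> graphoid \<F>" for p
  proof -
    have "\<Union>\<U> = graphoid \<F>" "\<forall>U\<in>\<U>. openin (graphoid_space \<F>) U"
      using assms by (simp_all add: open_cover_def)
    then obtain U where U: "U \<in> \<U>" "p \<in> U" "openin (graphoid_space \<F>) U"
      using p by blast
    from graphoid_basic_neighbourhood[OF U(3,2)] show ?thesis using U(1) by metis
  qed
  then obtain U I r where UIr: "\<And>p. p \<in> graphoid \<F> \<Longrightarrow> U p \<in> \<U> \<and> finite (I p) \<and> I p \<subseteq> coords \<F> \<and> r p > 0
    \<and> (\<forall>q\<in>graphoid \<F>. ?close (I p) (r p) p q \<longrightarrow> q \<in> U p)" by metis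
  define N where "N p = {q \<in> topspace (graphoid_space \<F>). \<forall>i\<in>I p. coord_of i q \<in> {u. norm (circ u - circ (coord_of i p)) < r p / 2}}" for p
  have N: "openin (graphoid_space \<F>) (N p)" if "p \<in> graphoid \<F>" for p
    unfolding N_def using UIr[OF that]
    by (intro openin_coord_box continuous_map_coord_of openin_circ_ball) auto
  have N': "p \<in> N p" if "p \<in> graphoid \<F>" for p
    unfolding N_def using UIr[OF that] that by simp
  obtain P where P: "finite P" "P \<subseteq> graphoid \<F>" "graphoid \<F> \<subseteq> \<Union>(N ` P)"
    using compact_space_finite_subcover[OF compact_graphoid_space, of \<F> N] N N' by auto
  define J where "J = \<Union>(I ` P)"
  define R where "R = Min (insert 1 ((\<lambda>p. r p / 2) ` P))"
  have fin: "finite (insert 1 ((\<lambda>p. r p / 2) ` P))" using P(1) by simp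
  have "r p / 2 > 0" if "p \<in> P" for p using UIr P(2) that half_gt_zero by blast
  then have R: "R > 0" unfolding R_def using Min_gr_iff[OF fin] by auto
  have R': "R \<le> r p / 2" if "p \<in> P" for p unfolding R_def by (rule Min_le[OF fin]) (use that in auto)
  have "\<exists>V\<in>\<U>. \<forall>q\<in>graphoid \<F>. ?close J R p q \<longrightarrow> q \<in> V" if p: "p \<in> graphoid \<F>" for p
  proof -
    obtain p0 where p0: "p0 \<in> P" "p \<in> N p0" using P(3) p by blast
    have p0': "p0 \<in> graphoid \<F>" using p0 P by blast
    have "q \<in> U p0" if q: "q \<in> graphoid \<F>" "?close J R p q" for q
    proof -
      have "norm (circ (coord_of i q) - circ (coord_of i p0)) < r p0" if "i \<in> I p0" for i
      proof -
        have "norm (circ (coord_of i q) - circ (coord_of i p)) < R" using q(2) that p0(1) by (auto simp: J_def)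
        moreover have "norm (circ (coord_of i p) - circ (coord_of i p0)) < r p0 / 2"
          using p0(2) that by (auto simp: N_def)
        ultimately show ?thesis using R'[OF p0(1)] norm_diff_triangle_less by fastforce
      qed
      then show ?thesis using UIr[OF p0'] q(1) by blast
    qed
    then show ?thesis using UIr[OF p0'] by blast
  qed
  moreover have "finite J" "J \<subseteq> coords \<F>" using P(1,2) UIr unfolding J_def by blast+
  ultimately show ?thesis using R by blast
qed

lemma continuous_on_eval2: "continuous_on UNIV (\<lambda>z. eval2 p (fst z) (snd z))"
proof (induction p)
  case (pCons a p)
  have "(\<lambda>z. eval2 (pCons a p) (fst z) (snd z)) = (\<lambda>z. poly a (fst z) + snd z * eval2 p (fst z) (snd z))"
    by (simp add: eval2_def)
  then show ?case using pCons.IH by (simp only:) (intro continuous_intros)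
qed simp

lemma circ_coord_val_continuous:
  assumes "regular_at i x y" "e > 0"
  shows "\<exists>r>0. \<forall>x' y'. dist (x', y') (x, y) < r \<longrightarrow> regular_at i x' y' \<longrightarrow>
           norm (circ (coord_val i x' y') - circ (coord_val i x y)) < e"
proof -
  let ?q = "\<lambda>z. eval2 (coord_den i) (fst z) (snd z)" and ?p = "\<lambda>z. eval2 (coord_num i) (fst z) (snd z)"
  define G where "G z = Complex ((?q z ^ 2 - ?p z ^ 2) / (?q z ^ 2 + ?p z ^ 2)) (2 * ?q z * ?p z / (?q z ^ 2 + ?p z ^ 2))" for z
  have eq: "circ (coord_val i a b) = G (a, b)" if "regular_at i a b" for a b
    unfolding complex_eq_iff using circ_coord_val_components[OF that] by (simp add: G_def)
  have c: "isCont ?q z" "isCont ?p z" for z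
    using continuous_on_eval2[of "coord_den i"] continuous_on_eval2[of "coord_num i"]
    by (auto simp only: continuous_on_eq_continuous_at[OF open_UNIV])
  have nz: "?q (x, y) ^ 2 + ?p (x, y) ^ 2 \<noteq> 0" using coord_norm_pos[OF assms(1)]
    unfolding fst_conv snd_conv by (rule less_imp_neq[symmetric])
  have "isCont G (x, y)"
    unfolding G_def complex_eq_iff Complex_eq
    by (intro continuous_intros c) (use nz in simp_all)
  then obtain r where "r > 0" "\<And>z. dist z (x, y) < r \<Longrightarrow> dist (G z) (G (x, y)) < e"
    using assms(2) unfolding continuous_at_eps_delta by blast
  then show ?thesis using eq assms(1) by (intro exI[of _ r]) (auto simp: dist_norm)
qed

text \<open>
  Over a real point outside the domain of some member of \<open>\<F>\<close> it is not obvious that the graphoid has any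
  points, as \<open>\<F>\<close> may be uncountable and the common domain empty. The sets of points that agree with the
  graph at a nearby real point, for finitely many coordinates, have the finite intersection property,
  and a point in the intersection of their closures is as required; the coordinates in \<open>\<E>\<close> are
  determined by continuity.
\<close>

lemma graphoid_point_over:
  assumes "finite \<E>" "\<E> \<subseteq> \<F>" "\<And>f. f \<in> \<E> \<Longrightarrow> regular_at (Ratfun f) x y"
  shows "\<exists>p\<in>graphoid \<F>. \<forall>i\<in>coords \<E>. coord_of i p = coord_val i x y"
proof -
  \<comment> \<open>Points of the ambient product that agree at the coordinates in \<open>I\<close> with the graph at some
    real point close to \<open>(x, y)\<close>.\<close>
  define S where "S r I = {q \<in> topspace (ambient \<F>). \<exists>x' y'. dist (x', y') (x, y) < r \<and>
     (\<forall>i\<in>I. regular_at i x' y' \<and> coord_of i q = coord_val i x' y')}" for r I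
  define K where "K = (\<lambda>(r, I). ambient \<F> closure_of (S r I))"
  define A where "A = {(r :: real, I). r > 0 \<and> finite I \<and> I \<subseteq> coords \<F>}"
  have S_mono: "S r I \<subseteq> S r' I'" if "r \<le> r'" "I' \<subseteq> I" for r r' I I'
  proof
    fix q assume "q \<in> S r I"
    then obtain x' y' where "q \<in> topspace (ambient \<F>)" "dist (x', y') (x, y) < r"
      "\<forall>i\<in>I. regular_at i x' y' \<and> coord_of i q = coord_val i x' y'" unfolding S_def by blast
    moreover from this that have "dist (x', y') (x, y) < r'" by linarith
    ultimately show "q \<in> S r' I'" using that(2) unfolding S_def by (intro CollectI conjI exI[of _ x'] exI[of _ y']) auto
  qed
  have S_nonempty: "S r I \<noteq> {}" if "r > 0" "finite I" "I \<subseteq> coords \<F>" for r I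
  proof -
    define B where "B = (\<Union>i\<in>I. {x. \<exists>y. \<not> regular_at i x y})"
    have "finite B" unfolding B_def using that(2) finite_irregular_lines by (intro finite_UN_I) auto
    then have "infinite ({x<..<x + r} - B)"
      using infinite_Ioo[of x "x + r"] that(1) by (simp add: Diff_infinite_finite)
    then have "{x<..<x + r} - B \<noteq> {}" by (metis finite.emptyI)
    then obtain x' where "x' \<in> {x<..<x + r} - B" by blast
    then have x': "x < x'" "x' < x + r" "\<And>i. i \<in> I \<Longrightarrow> regular_at i x' y" by (auto simp: B_def)
    let ?q = "((Some x', Some y), \<lambda>f\<in>\<F>. coord_val (Ratfun f) x' y)"
    have "coord_of i ?q = coord_val i x' y" if "i \<in> I" for i
      using that \<open>I \<subseteq> coords \<F>\<close> by (auto simp: coords_def)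
    moreover have "dist (x', y) (x, y) < r" using x' by (simp add: dist_Pair_Pair dist_real_def)
    ultimately have "?q \<in> S r I" using x'(3) by (auto simp: S_def)
    then show ?thesis by blast
  qed
  have "\<Inter>(K ` A) \<noteq> {}"
  proof -
    have closed: "\<forall>C\<in>K ` A. closedin (ambient \<F>) C" by (auto simp: K_def)
    have "\<Inter>\<G> \<noteq> {}" if \<G>: "finite \<G>" "\<G> \<subseteq> K ` A" for \<G>
    proof -
      obtain A' where A': "finite A'" "A' \<subseteq> A" "\<G> = K ` A'" using finite_subset_image[OF \<G>] by metis
      define r where "r = Min (insert 1 (fst ` A'))"
      define I where "I = \<Union>(snd ` A')"
      have fin: "finite (insert 1 (fst ` A'))" using A'(1) by simp
      have A'': "fst a > 0" "finite (snd a)" "snd a \<subseteq> coords \<F>" if "a \<in> A'" for a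
      proof -
        have "a \<in> A" using A'(2) that by blast
        then show "fst a > 0" "finite (snd a)" "snd a \<subseteq> coords \<F>" by (auto simp: A_def case_prod_beta)
      qed
      have r: "r > 0" unfolding r_def using Min_gr_iff[OF fin] A''(1) by auto
      have r': "r \<le> fst a" if "a \<in> A'" for a unfolding r_def by (rule Min_le[OF fin]) (use that in auto)
      have I: "finite I" "I \<subseteq> coords \<F>" using A'(1) A'' unfolding I_def by blast+
      have "S r I \<subseteq> K a" if "a \<in> A'" for a
      proof -
        have "S r I \<subseteq> S (fst a) (snd a)" using r'[OF that] that by (intro S_mono) (auto simp: I_def)
        also have "\<dots> \<subseteq> ambient \<F> closure_of S (fst a) (snd a)"
          by (rule closure_of_subset) (auto simp: S_def)
        finally show ?thesis by (simp add: K_def case_prod_beta)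
      qed
      then show ?thesis using S_nonempty[OF r I] A'(3) by blast
    qed
    then have fip: "\<forall>\<G>. finite \<G> \<and> \<G> \<subseteq> K ` A \<longrightarrow> \<Inter>\<G> \<noteq> {}" by blast
    show ?thesis
      by (rule compact_space_fip[THEN iffD1, OF compact_Hausdorff_ambient(1), THEN spec, THEN mp])
         (rule conjI[OF closed fip])
  qed
  then obtain p where pA: "p \<in> \<Inter>(K ` A)" by blast
  have p: "p \<in> ambient \<F> closure_of S r I" if "r > 0" "finite I" "I \<subseteq> coords \<F>" for r I
  proof -
    have "(r, I) \<in> A" using that by (simp add: A_def)
    then have "p \<in> K (r, I)" using pA by blast
    then show ?thesis by (simp add: K_def)
  qed
  have meet: "\<exists>q\<in>T. q \<in> S r I" if "r > 0" "finite I" "I \<subseteq> coords \<F>" "openin (ambient \<F>) T" "p \<in> T" for r I T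
    using p[OF that(1-3)] that(4,5) unfolding in_closure_of by metis
  have p_top: "p \<in> topspace (ambient \<F>)"
    using p[of 1 "{}"] unfolding in_closure_of by simp
  have "coord_of i p = coord_val i x y" if i: "i \<in> coords \<E>" for i
  proof (rule ccontr)
    assume "coord_of i p \<noteq> coord_val i x y"
    then have "circ (coord_of i p) \<noteq> circ (coord_val i x y)" using inj_circ by (auto dest: injD)
    then have e: "norm (circ (coord_of i p) - circ (coord_val i x y)) / 2 > 0" (is "?e > 0") by simp
    have iF: "i \<in> coords \<F>" using i assms(2) by (auto simp: coords_def)
    have "regular_at i x y" using i assms(3) by (auto simp: coords_def)
    from circ_coord_val_continuous[OF this e] obtain r where r: "r > 0"
      "\<And>x' y'. dist (x', y') (x, y) < r \<Longrightarrow> regular_at i x' y' \<Longrightarrow>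
         norm (circ (coord_val i x' y') - circ (coord_val i x y)) < ?e" by blast
    have "openin (ambient \<F>) {q \<in> topspace (ambient \<F>). coord_of i q \<in> {u. norm (circ u - circ (coord_of i p)) < ?e}}"
      by (rule openin_continuous_map_preimage[OF continuous_map_coord_ambient[OF iF] openin_circ_ball])
    from meet[OF r(1) _ _ this, of "{i}"] obtain q where q: "q \<in> S r {i}"
      "norm (circ (coord_of i q) - circ (coord_of i p)) < ?e" using iF p_top e by auto
    from q(1) obtain x' y' where "dist (x', y') (x, y) < r" "regular_at i x' y'" "coord_of i q = coord_val i x' y'"
      by (auto simp: S_def)
    then have "norm (circ (coord_of i q) - circ (coord_val i x y)) < ?e" using r(2) by simp
    with q(2) have "norm (circ (coord_of i p) - circ (coord_val i x y)) < ?e + ?e"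
      by (metis norm_diff_triangle_less norm_minus_commute)
    then show False by simp
  qed
  moreover have "p \<in> graphoid \<F>"
  proof -
    obtain z w where zw: "p = (z, w)" by fastforce
    have "\<exists>z'\<in>U \<inter> (\<Inter>f\<in>\<E>'. rf_dom f). \<forall>f\<in>\<E>'. rf_val f z' \<in> W f"
      if h: "openin torus U" "z \<in> U" "finite \<E>'" "\<E>' \<subseteq> \<F>" "\<forall>f\<in>\<E>'. openin proj_line (W f) \<and> w f \<in> W f"
      for U \<E>' W
    proof -
      define N where "N = {q \<in> topspace (ambient \<F>). fst q \<in> U} \<inter>
        {q \<in> topspace (ambient \<F>). \<forall>f\<in>\<E>'. coord_of (Ratfun f) q \<in> W f}"
      have "openin (ambient \<F>) N"
        unfolding N_def using h
        by (intro openin_Int openin_continuous_map_preimage[OF continuous_map_fst] openin_coord_box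
            continuous_map_coord_ambient) (auto simp: coords_def)
      moreover have "p \<in> N" using p_top h by (auto simp: N_def zw)
      moreover have "finite (coords \<E>')" "coords \<E>' \<subseteq> coords \<F>" using h by (auto simp: coords_def)
      ultimately obtain q where q: "q \<in> N" "q \<in> S 1 (coords \<E>')" using meet[of 1 "coords \<E>'" N] by auto
      from q(2) obtain x' y' where xy: "\<And>i. i \<in> coords \<E>' \<Longrightarrow> regular_at i x' y' \<and> coord_of i q = coord_val i x' y'"
        by (auto simp: S_def)
      have "fst q = (Some x', Some y')"
        using xy[of Abscissa] xy[of Ordinate] by (cases q) (auto simp: coords_def prod_eq_iff)
      moreover have "regular_at (Ratfun f) x' y' \<and> coord_val (Ratfun f) x' y' \<in> W f" if "f \<in> \<E>'" for f
        using xy[of "Ratfun f"] q(1) that by (force simp: coords_def N_def)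
      ultimately show ?thesis
        using q(1) by (intro bexI[of _ "(Some x', Some y')"]) (auto simp: rf_dom_iff N_def simp del: rf_val.simps)
    qed
    moreover have "w \<in> topspace (product_topology (\<lambda>_. proj_line) \<F>)" using p_top by (auto simp: zw)
    ultimately have "w \<in> graphoid_ext \<F> z" unfolding graphoid_ext_def by blast
    then show ?thesis by (simp add: graphoid_def zw)
  qed
  ultimately show ?thesis by blast
qed

section \<open>The upper bound\<close>

text \<open>
  Values are chosen one variable at a time. The induction carries along that the conditions on
  triples which are only partly chosen so far still hold for generic values of the remaining
  variables; then each new value has to avoid finitely many reals.
\<close>

lemma generic_choice:
  fixes Q :: "'v \<Rightarrow> 'v \<Rightarrow> 'v \<Rightarrow> real \<Rightarrow> real \<Rightarrow> real \<Rightarrow> bool"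
  assumes "finite T" and J: "\<And>v. v \<in> T \<Longrightarrow> infinite (J v)"
    and generic: "\<And>u v w. u \<in> T \<Longrightarrow> v \<in> T \<Longrightarrow> w \<in> T \<Longrightarrow> distinct [u, v, w] \<Longrightarrow>
           \<forall>\<^sub>\<infinity>a. \<forall>\<^sub>\<infinity>b. \<forall>\<^sub>\<infinity>c. Q u v w a b c"
    and swap1: "\<And>u v w a b c. Q u v w a b c \<Longrightarrow> Q v u w b a c"
    and swap2: "\<And>u v w a b c. Q u v w a b c \<Longrightarrow> Q u w v a c b"
  shows "\<exists>c. (\<forall>v\<in>T. c v \<in> J v) \<and>
    (\<forall>u\<in>T. \<forall>v\<in>T. \<forall>w\<in>T. distinct [u, v, w] \<longrightarrow> Q u v w (c u) (c v) (c w))"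
proof -
  define Inv where "Inv S c \<longleftrightarrow> (\<forall>v\<in>S. c v \<in> J v) \<and>
     (\<forall>u\<in>S. \<forall>v\<in>T. \<forall>w\<in>T. distinct [u, v, w] \<longrightarrow> (\<forall>\<^sub>\<infinity>y. \<forall>\<^sub>\<infinity>z. Q u v w (c u) y z)) \<and>
     (\<forall>u\<in>S. \<forall>v\<in>S. \<forall>w\<in>T. distinct [u, v, w] \<longrightarrow> (\<forall>\<^sub>\<infinity>z. Q u v w (c u) (c v) z)) \<and>
     (\<forall>u\<in>S. \<forall>v\<in>S. \<forall>w\<in>S. distinct [u, v, w] \<longrightarrow> Q u v w (c u) (c v) (c w))" for S c
  have "\<exists>c. Inv S c" if "S \<subseteq> T" for S
  proof -
    have "finite S" using that assms(1) by (rule finite_subset)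
    then show ?thesis using that
    proof (induction S rule: finite_induct)
      case empty then show ?case by (auto simp: Inv_def)
    next
      case (insert s S)
      have sT: "s \<in> T" and ST: "S \<subseteq> T" and finS: "finite S" using insert by auto
      obtain c where Inv: "Inv S c" using insert.IH[OF ST] by blast
      have c: "\<And>v. v \<in> S \<Longrightarrow> c v \<in> J v"
        "\<And>u v w. u \<in> S \<Longrightarrow> v \<in> T \<Longrightarrow> w \<in> T \<Longrightarrow> distinct [u, v, w] \<Longrightarrow> \<forall>\<^sub>\<infinity>y. \<forall>\<^sub>\<infinity>z. Q u v w (c u) y z"
        "\<And>u v w. u \<in> S \<Longrightarrow> v \<in> S \<Longrightarrow> w \<in> T \<Longrightarrow> distinct [u, v, w] \<Longrightarrow> \<forall>\<^sub>\<infinity>z. Q u v w (c u) (c v) z"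
        "\<And>u v w. u \<in> S \<Longrightarrow> v \<in> S \<Longrightarrow> w \<in> S \<Longrightarrow> distinct [u, v, w] \<Longrightarrow> Q u v w (c u) (c v) (c w)"
        using Inv unfolding Inv_def by blast+
      have "\<forall>\<^sub>\<infinity>x. (\<forall>v\<in>T. \<forall>w\<in>T. distinct [s, v, w] \<longrightarrow> (\<forall>\<^sub>\<infinity>y. \<forall>\<^sub>\<infinity>z. Q s v w x y z))"
        using generic[OF sT] by (intro eventually_ball_finite assms(1) ballI) (auto simp: eventually_conj_iff)
      moreover have "\<forall>\<^sub>\<infinity>x. (\<forall>u\<in>S. \<forall>w\<in>T. distinct [u, s, w] \<longrightarrow> (\<forall>\<^sub>\<infinity>z. Q u s w (c u) x z))"
        using c(2)[OF _ sT] by (intro eventually_ball_finite finS assms(1) ballI) auto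
      moreover have "\<forall>\<^sub>\<infinity>x. (\<forall>u\<in>S. \<forall>v\<in>S. distinct [u, v, s] \<longrightarrow> Q u v s (c u) (c v) x)"
        using c(3)[OF _ _ sT] by (intro eventually_ball_finite finS ballI) auto
      ultimately have ev: "\<forall>\<^sub>\<infinity>x. (\<forall>v\<in>T. \<forall>w\<in>T. distinct [s, v, w] \<longrightarrow> (\<forall>\<^sub>\<infinity>y. \<forall>\<^sub>\<infinity>z. Q s v w x y z)) \<and>
          (\<forall>u\<in>S. \<forall>w\<in>T. distinct [u, s, w] \<longrightarrow> (\<forall>\<^sub>\<infinity>z. Q u s w (c u) x z)) \<and>
          (\<forall>u\<in>S. \<forall>v\<in>S. distinct [u, v, s] \<longrightarrow> Q u v s (c u) (c v) x)" (is "\<forall>\<^sub>\<infinity>x. ?P x")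
        by (intro eventually_conj)
      then have "finite {x. \<not> ?P x}" by (simp only: eventually_cofinite)
      then have "infinite (J s - {x. \<not> ?P x})" using J[OF sT] by (simp add: Diff_infinite_finite)
      then have "J s - {x. \<not> ?P x} \<noteq> {}" by (metis finite.emptyI)
      then obtain x where x: "x \<in> J s" "?P x" by blast
      have x1: "\<forall>\<^sub>\<infinity>y. \<forall>\<^sub>\<infinity>z. Q s v w x y z" if "v \<in> T" "w \<in> T" "distinct [s, v, w]" for v w
        using x(2) that by blast
      have x2: "\<forall>\<^sub>\<infinity>z. Q u s w (c u) x z" if "u \<in> S" "w \<in> T" "distinct [u, s, w]" for u w
        using x(2) that by blast
      have x3: "Q u v s (c u) (c v) x" if "u \<in> S" "v \<in> S" "distinct [u, v, s]" for u v
        using x(2) that by blast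
      have x2': "\<forall>\<^sub>\<infinity>z. Q s u w x (c u) z" if "u \<in> S" "w \<in> T" "distinct [u, s, w]" for u w
        by (rule eventually_mono[OF x2[OF that]]) (rule swap1)
      have x3': "Q u s v (c u) x (c v)" "Q s u v x (c u) (c v)" if "u \<in> S" "v \<in> S" "distinct [u, v, s]" for u v
        using swap2[OF x3[OF that]] swap1 by auto
      define c' where "c' = c(s := x)"
      have c': "c' s = x" "\<And>v. v \<in> S \<Longrightarrow> c' v = c v" using insert.hyps(2) by (auto simp: c'_def)
      have "Inv (insert s S) c'"
        unfolding Inv_def
      proof (intro conjI ballI impI)
        fix v assume "v \<in> insert s S" then show "c' v \<in> J v" using c(1) x(1) c' by (cases "v = s") auto
      next
        fix u v w assume "u \<in> insert s S" "v \<in> T" "w \<in> T" "distinct [u, v, w]"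
        then show "\<forall>\<^sub>\<infinity>y. \<forall>\<^sub>\<infinity>z. Q u v w (c' u) y z"
          using x1[of v w] c(2)[of u v w] c' by (cases "u = s") auto
      next
        fix u v w assume uvw: "u \<in> insert s S" "v \<in> insert s S" "w \<in> T" and d: "distinct [u, v, w]"
        consider "u = s" "v \<in> S" | "v = s" "u \<in> S" | "u \<in> S" "v \<in> S" using uvw d by auto
        then show "\<forall>\<^sub>\<infinity>z. Q u v w (c' u) (c' v) z"
        proof cases
          case 1 then show ?thesis using x2'[of v w] uvw(3) d c' by auto
        next
          case 2 then show ?thesis using x2[of u w] uvw(3) d c' by auto
        next
          case 3 then show ?thesis using c(3)[of u v w] uvw(3) d c' by auto
        qed
      next
        fix u v w assume uvw: "u \<in> insert s S" "v \<in> insert s S" "w \<in> insert s S" and d: "distinct [u, v, w]"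
        consider "u = s" "v \<in> S" "w \<in> S" | "v = s" "u \<in> S" "w \<in> S" | "w = s" "u \<in> S" "v \<in> S" | "u \<in> S" "v \<in> S" "w \<in> S"
          using uvw d by auto
        then show "Q u v w (c' u) (c' v) (c' w)"
        proof cases
          case 1 then show ?thesis using x3'(2)[of v w] d c' by auto
        next
          case 2 then show ?thesis using x3'(1)[of u w] d c' by auto
        next
          case 3 then show ?thesis using x3[of u v] d c' by auto
        next
          case 4 then show ?thesis using c(4)[of u v w] d c' by auto
        qed
      qed
      then show ?case by blast
    qed
  qed
  from this[of T] show ?thesis unfolding Inv_def by blast
qed

definition avoids_triple :: "ratfun2 set \<Rightarrow> coord \<Rightarrow> coord \<Rightarrow> coord \<Rightarrow> real \<Rightarrow> real \<Rightarrow> real \<Rightarrow> bool" where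
  "avoids_triple \<F> i j k a b c \<longleftrightarrow>
     \<not> (\<exists>p\<in>graphoid \<F>. coord_of i p = Some a \<and> coord_of j p = Some b \<and> coord_of k p = Some c)"

text \<open>
  Let \<open>P\<close> be a polynomial relation between the three coordinates on the graph. If \<open>P\<close> does not vanish
  at \<open>(a, b, c)\<close>, then it does not vanish on a box around this triple, and a point of the graphoid
  with these coordinates could be approximated by a point of the graph with values in the box.
\<close>

lemma graphoid_avoids_generic_triple:
  assumes d: "distinct [i, j, k]" and ijk: "i \<in> coords \<F>" "j \<in> coords \<F>" "k \<in> coords \<F>"
  shows "\<forall>\<^sub>\<infinity>a. \<forall>\<^sub>\<infinity>b. \<forall>\<^sub>\<infinity>c. avoids_triple \<F> i j k a b c"
proof -
  define num where "num m = coord_num ([i, j, k] ! m)" for m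
  define den where "den m = coord_den ([i, j, k] ! m)" for m
  have lt3: "(\<forall>m<3. P m) \<longleftrightarrow> P 0 \<and> P (Suc 0) \<and> P (Suc (Suc 0))" for P :: "nat \<Rightarrow> bool"
    by (auto simp: numeral_3_eq_3 less_Suc_eq)
  obtain n L where L0: "\<exists>a\<le>n. \<exists>b\<le>n. \<exists>c\<le>n. L a b c \<noteq> 0" and
    L: "\<And>x y. (\<forall>m<3. eval2 (den m) x y \<noteq> 0) \<Longrightarrow>
        (\<Sum>c\<le>n. (\<Sum>b\<le>n. (\<Sum>a\<le>n. L a b c * (eval2 (num 0) x y / eval2 (den 0) x y) ^ a)
           * (eval2 (num 1) x y / eval2 (den 1) x y) ^ b)
           * (eval2 (num 2) x y / eval2 (den 2) x y) ^ c) = (0::real)"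
    using three_ratios_dependent[of den num] by blast
  define P where "P u v w = (\<Sum>c\<le>n. (\<Sum>b\<le>n. (\<Sum>a\<le>n. L a b c * u ^ a) * v ^ b) * w ^ c)" for u v w
  have nz: "\<forall>\<^sub>\<infinity>u. \<forall>\<^sub>\<infinity>v. \<forall>\<^sub>\<infinity>w. P u v w \<noteq> 0"
    unfolding P_def by (rule trivariate_generic_nonzero[OF L0])
  have avoid: "avoids_triple \<F> i j k a b c" if P0: "P a b c \<noteq> 0" for a b c
    unfolding avoids_triple_def
  proof
    assume "\<exists>p\<in>graphoid \<F>. coord_of i p = Some a \<and> coord_of j p = Some b \<and> coord_of k p = Some c"
    then obtain p where p: "p \<in> graphoid \<F>" "coord_of i p = Some a" "coord_of j p = Some b" "coord_of k p = Some c"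
      by blast
    have "continuous_on UNIV (\<lambda>t :: real \<times> real \<times> real. P (fst t) (fst (snd t)) (snd (snd t)))"
      unfolding P_def by (intro continuous_intros)
    then have "open ((\<lambda>t :: real \<times> real \<times> real. P (fst t) (fst (snd t)) (snd (snd t))) -` (- {0}))"
      by (intro open_vimage open_Compl closed_singleton)
    moreover have "(a, b, c) \<in> (\<lambda>t :: real \<times> real \<times> real. P (fst t) (fst (snd t)) (snd (snd t))) -` (- {0})"
      using P0 by simp
    ultimately obtain A BC where A: "open A" "open BC" "(a, b, c) \<in> A \<times> BC"
      "A \<times> BC \<subseteq> (\<lambda>t :: real \<times> real \<times> real. P (fst t) (fst (snd t)) (snd (snd t))) -` (- {0})"
      by (rule open_prod_elim)
    from A(2,3) obtain B C where BC: "open B" "open C" "(b, c) \<in> B \<times> C" "B \<times> C \<subseteq> BC"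
      by (metis mem_Sigma_iff open_prod_elim)
    have box: "P u v w \<noteq> 0" if "u \<in> A" "v \<in> B" "w \<in> C" for u v w
    proof -
      have "(u, v, w) \<in> A \<times> BC" using that BC(4) by auto
      then show ?thesis using A(4) by auto
    qed
    define W where "W m = (if m = i then Some ` A else if m = j then Some ` B else Some ` C)" for m
    have W: "W i = Some ` A" "W j = Some ` B" "W k = Some ` C" using d by (auto simp: W_def)
    have "\<exists>f. Ratfun f \<in> {i, j, k}"
      using d ijk by (cases i; cases j; cases k) (auto simp: coords_def)
    then obtain f where f: "Ratfun f \<in> {i, j, k}" by blast
    have op: "openin proj_line (Some ` A)" "openin proj_line (Some ` B)" "openin proj_line (Some ` C)"
      using A(1) BC(1,2) openin_proj_line by blast+
    have "\<exists>x y. \<forall>m\<in>{i, j, k}. regular_at m x y \<and> coord_val m x y \<in> W m"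
      by (rule graphoid_approx[OF p(1) _ _ f]) (use ijk op W p A(3) BC(3) in auto)
    then obtain x y where xy: "coord_val i x y \<in> Some ` A" "coord_val j x y \<in> Some ` B" "coord_val k x y \<in> Some ` C"
      using W by auto
    have val: "eval2 (coord_den m) x y \<noteq> 0 \<and> eval2 (coord_num m) x y / eval2 (coord_den m) x y \<in> D"
      if "coord_val m x y \<in> Some ` D" for m D
      using that by (auto simp: coord_val_def split: if_splits)
    have "P (eval2 (num 0) x y / eval2 (den 0) x y) (eval2 (num 1) x y / eval2 (den 1) x y)
       (eval2 (num 2) x y / eval2 (den 2) x y) = 0"
      unfolding P_def by (rule L) (use xy val in \<open>auto simp: lt3 den_def\<close>)
    moreover have "P (eval2 (num 0) x y / eval2 (den 0) x y) (eval2 (num 1) x y / eval2 (den 1) x y)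
       (eval2 (num 2) x y / eval2 (den 2) x y) \<noteq> 0"
      by (rule box) (use xy val in \<open>auto simp: num_def den_def numeral_2_eq_2\<close>)
    ultimately show False by simp
  qed
  show ?thesis
    by (rule eventually_mono[OF nz], rule eventually_mono, assumption, rule eventually_mono, assumption, rule avoid)
qed

definition small_open_partition :: "real \<Rightarrow> proj_real set set \<Rightarrow> bool" where
  "small_open_partition r \<P> \<longleftrightarrow> finite \<P> \<and> (\<forall>S\<in>\<P>. openin proj_line S) \<and> disjoint \<P> \<and>
     (\<forall>S\<in>\<P>. \<forall>u\<in>S. \<forall>v\<in>S. norm (circ u - circ v) < r)"

text \<open>
  The windows serve three levels \<open>l < 3\<close> of cutting. The cut point number \<open>m < K\<close> of level \<open>l\<close> may be
  placed anywhere in \<open>J l m\<close>, so that generic positions are available; the windows of different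
  levels are disjoint to keep cut points of different levels apart.
\<close>

definition cut_windows :: "real \<Rightarrow> nat \<Rightarrow> (nat \<Rightarrow> nat \<Rightarrow> real set) \<Rightarrow> bool" where
  "cut_windows r K J \<longleftrightarrow> (\<forall>l m. infinite (J l m)) \<and>
    (\<forall>l l' m m'. l < 3 \<longrightarrow> l' < 3 \<longrightarrow> (l, m) \<noteq> (l', m') \<longrightarrow> J l m \<inter> J l' m' = {}) \<and>
    (\<forall>l<3. \<forall>c. (\<forall>m<K. c m \<in> J l m) \<longrightarrow>
      (\<exists>\<P>. small_open_partition r \<P> \<and> \<Union>\<P> = - (Some ` c ` {..<K})))"

text \<open>
  The windows are consecutive intervals of length \<open>h\<close>, dealt out cyclically to the three levels. The
  arcs between neighbouring cut points are short, and the arc through infinity is short because the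
  windows cover a large part of the real line.
\<close>

lemma ex_cut_windows:
  fixes r :: real
  assumes "r > 0"
  shows "\<exists>K J. cut_windows r K J"
proof -
  define h where "h = r / 16"
  have h: "h > 0" using assms by (simp add: h_def)
  obtain K0 :: nat where K0: "(8 / r + 3 * h) / (3 * h / 2) < real K0" using reals_Archimedean2 by blast
  define K where "K = Suc K0"
  \<comment> \<open>The \<open>3 K\<close> windows of length \<open>h\<close> fill the interval from \<open>-L\<close> to \<open>L\<close>.\<close>
  define L where "L = 3 * h * K / 2"
  have L: "L - 3 * h \<ge> 8 / r"
  proof -
    have "8 / r + 3 * h < real K0 * (3 * h / 2)" using K0 h by (simp add: pos_divide_less_eq)
    also have "\<dots> \<le> L" using h by (simp add: L_def K_def algebra_simps)
    finally show ?thesis by simp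
  qed
  define w where "w n = h * real n - L" for n :: nat
  define J where "J l m = {w (3 * m + l) <..< w (3 * m + l + 1)}" for l m
  have w_mono: "w a \<le> w b" if "a \<le> b" for a b using that h by (simp add: w_def)
  have "infinite (J l m)" for l m
    unfolding J_def using h by (intro infinite_Ioo) (simp add: w_def)
  moreover have "J l m \<inter> J l' m' = {}" if "l < 3" "l' < 3" "(l, m) \<noteq> (l', m')" for l l' m m'
  proof -
    have "l = l' \<Longrightarrow> m \<noteq> m'" using that(3) by auto
    then have "3 * m + l + 1 \<le> 3 * m' + l' \<or> 3 * m' + l' + 1 \<le> 3 * m + l"
      using that(1,2) by presburger
    then show ?thesis using w_mono[of "3 * m + l + 1" "3 * m' + l'"] w_mono[of "3 * m' + l' + 1" "3 * m + l"]
      by (auto simp: J_def)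
  qed
  moreover have "\<exists>\<P>. small_open_partition r \<P> \<and> \<Union>\<P> = - (Some ` c ` {..<K})"
    if l: "l < 3" and c: "\<forall>m<K. c m \<in> J l m" for l c
  proof -
    have c_mono: "c m < c m'" if "m < m'" "m' < K" for m m'
    proof -
      have "c m < w (3 * m + l + 1)" "w (3 * m' + l) < c m'" using c that by (auto simp: J_def)
      moreover have "w (3 * m + l + 1) \<le> w (3 * m' + l)" using that by (intro w_mono) auto
      ultimately show ?thesis by linarith
    qed
    have c_mono': "c m \<le> c m'" if "m \<le> m'" "m' < K" for m m'
      using c_mono[of m m'] that by (cases "m = m'") auto
    define tail where "tail = insert None (Some ` (- {c 0 .. c K0}))"
    define arc where "arc m = Some ` {c m <..< c (Suc m)}" for m
    define \<P> where "\<P> = insert tail (arc ` {..<K0})"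
    have "openin proj_line tail" unfolding tail_def openin_proj_line using compact_Icc by blast
    moreover have "openin proj_line (arc m)" for m
      unfolding arc_def openin_proj_line using open_greaterThanLessThan by blast
    ultimately have "openin proj_line S" if "S \<in> \<P>" for S
      using that by (auto simp: \<P>_def)
    moreover have "disjoint \<P>"
    proof -
      have at: "arc m \<inter> tail = {}" if "m < K0" for m
        using that c_mono'[of 0 m] c_mono'[of "Suc m" K0] by (auto simp: arc_def tail_def K_def)
      have aa: "arc m \<inter> arc m' = {}" if "m < m'" "m' < K0" for m m'
        using that c_mono'[of "Suc m" m'] by (auto simp: arc_def K_def)
      have aa': "arc m \<inter> arc m' = {}" if "m < K0" "m' < K0" "m \<noteq> m'" for m m'
        using aa[of m m'] aa[of m' m] that by (cases m m' rule: linorder_cases) auto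
      show ?thesis
      proof (rule disjointI)
        fix A B assume AB: "A \<in> \<P>" "B \<in> \<P>" "A \<noteq> B"
        then consider m where "A = tail" "B = arc m" "m < K0" | m where "A = arc m" "B = tail" "m < K0"
          | m m' where "A = arc m" "B = arc m'" "m < K0" "m' < K0" "m \<noteq> m'"
          unfolding \<P>_def by blast
        then show "A \<inter> B = {}" using at aa' by cases blast+
      qed
    qed
    moreover have "norm (circ u - circ v) < r" if S: "S \<in> \<P>" "u \<in> S" "v \<in> S" for S u v
    proof (cases "S = tail")
      case True
      have far: "norm (circ t - circ None) \<le> r / 4" if "t \<in> tail" for t
      proof (cases t)
        case None then show ?thesis using assms by simp
      next
        case (Some s)
        then have s: "s < c 0 \<or> s > c K0" using that by (auto simp: tail_def)
        have "c 0 < w (l + 1)" "w (3 * K0) < c K0"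
          using c[rule_format, of 0] c[rule_format, of K0] w_mono[of "3 * K0" "3 * K0 + l"] by (auto simp: J_def K_def)
        moreover have "w (l + 1) \<le> 3 * h - L" using l h by (simp add: w_def)
        moreover have "w (3 * K0) = L - 3 * h" by (simp add: w_def L_def K_def algebra_simps)
        ultimately have s8: "\<bar>s\<bar> \<ge> 8 / r" using s L by linarith
        then have s0: "\<bar>s\<bar> > 0" using assms by (smt (verit) divide_pos_pos)
        have "norm (circ t - circ None) \<le> 2 / \<bar>s\<bar>" using circ_near_infinity[of s] s0 Some by auto
        also have "\<dots> \<le> r / 4" using s8 s0 assms by (simp add: field_simps)
        finally show ?thesis .
      qed
      have "norm (circ u - circ v) \<le> norm (circ u - circ None) + norm (circ v - circ None)"
        by (metis norm_triangle_ineq4 diff_diff_eq2 add.commute add_diff_cancel diff_add_cancel)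
      moreover have "u \<in> tail" "v \<in> tail" using S True by auto
      ultimately show ?thesis using far[of u] far[of v] assms by linarith
    next
      case False
      then obtain m where m: "m < K0" "S = arc m" using S by (auto simp: \<P>_def)
      then obtain s t where st: "u = Some s" "v = Some t" "c m < s" "s < c (Suc m)" "c m < t" "t < c (Suc m)"
        using S by (auto simp: arc_def)
      have "c m > w (3 * m + l)" "c (Suc m) < w (3 * m + l + 4)"
        using c[rule_format, of m] c[rule_format, of "Suc m"] m by (auto simp: J_def K_def algebra_simps numeral_eq_Suc)
      moreover have "w (3 * m + l + 4) = w (3 * m + l) + 4 * h" by (simp add: w_def algebra_simps)
      ultimately have "\<bar>s - t\<bar> < 4 * h" using st by linarith
      then show ?thesis using circ_lipschitz[of s t] st assms by (simp add: h_def)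
    qed
    moreover have "\<Union>\<P> = - (Some ` c ` {..<K})"
    proof (intro equalityI subsetI)
      fix v assume "v \<in> \<Union>\<P>"
      then consider "v \<in> tail" | m where "m < K0" "v \<in> arc m" by (auto simp: \<P>_def)
      then show "v \<in> - (Some ` c ` {..<K})"
      proof cases
        case 1
        then show ?thesis using c_mono'[of 0] c_mono'[of _ K0] by (fastforce simp: tail_def K_def)
      next
        case 2
        have False if "v = Some (c n)" "n < K" for n
          using that 2 c_mono'[of n m] c_mono'[of "Suc m" n] by (cases "n \<le> m") (auto simp: arc_def K_def)
        then show ?thesis by auto
      qed
    next
      fix v assume v: "v \<in> - (Some ` c ` {..<K})"
      show "v \<in> \<Union>\<P>"
      proof (cases "v \<in> tail")
        case False
        then obtain t where t: "v = Some t" "c 0 \<le> t" "t \<le> c K0" by (cases v) (auto simp: tail_def)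
        have ne: "t \<noteq> c m" if "m < K" for m using v t(1) that by auto
        define n where "n = (LEAST n. t < c n)"
        have "t < c K0" using t(3) ne[of K0] by (auto simp: K_def)
        then have n: "t < c n" "n \<le> K0" unfolding n_def by (auto intro: LeastI Least_le)
        have "n \<noteq> 0" using n t(2) by (metis not_le)
        then obtain m where m: "n = Suc m" using not0_implies_Suc by blast
        have "\<not> t < c m" using not_less_Least[of m "\<lambda>n. t < c n"] m by (simp add: n_def)
        then have "c m < t" using ne[of m] n(2) m by (auto simp: K_def)
        then have "v \<in> arc m" "m < K0" using n m t(1) by (auto simp: arc_def)
        then show ?thesis unfolding \<P>_def by blast
      qed (auto simp: \<P>_def)
    qed
    moreover have "finite \<P>" by (simp add: \<P>_def)
    ultimately show ?thesis unfolding small_open_partition_def by blast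
  qed
  ultimately have "cut_windows r K J" unfolding cut_windows_def by (intro conjI allI impI)
  then show ?thesis by blast
qed

text \<open>
  Each level of cutting gives a disjoint family of boxes. Points lost at all three levels do not exist
  by genericity, so each point lies in at least one and at most three boxes.
\<close>

theorem covering_dim_graphoid_le_2: "covering_dim_le (graphoid_space \<F>) 2"
  unfolding covering_dim_le_def
proof (intro conjI allI impI)
  fix \<U> assume "finite \<U> \<and> open_cover (graphoid_space \<F>) \<U>"
  then have "open_cover (graphoid_space \<F>) \<U>" by blast
  from graphoid_Lebesgue_number[OF this] obtain I r where I: "finite I" "I \<subseteq> coords \<F>" and r: "r > 0"
    and leb: "\<And>p. p \<in> graphoid \<F> \<Longrightarrow> \<exists>U\<in>\<U>. \<forall>q\<in>graphoid \<F>.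
       (\<forall>i\<in>I. norm (circ (coord_of i q) - circ (coord_of i p)) < r) \<longrightarrow> q \<in> U" by blast
  obtain K J where KJ: "cut_windows r K J" using ex_cut_windows[OF r] by blast
  have J: "infinite (J l m)" for l m using KJ by (simp add: cut_windows_def)
  have J': "J l m \<inter> J l' m' = {}" if "l < 3" "l' < 3" "(l, m) \<noteq> (l', m')" for l m l' m'
    using KJ that unfolding cut_windows_def by metis
  have cut: "\<exists>\<P>. small_open_partition r \<P> \<and> \<Union>\<P> = - (Some ` c ` {..<K})"
    if "l < 3" "\<forall>m<K. c m \<in> J l m" for l c
    using KJ that unfolding cut_windows_def by metis
  define T where "T = I \<times> {..<3::nat} \<times> {..<K}"
  define Q where "Q u v w a b c \<longleftrightarrow> (distinct [fst u, fst v, fst w] \<longrightarrow> avoids_triple \<F> (fst u) (fst v) (fst w) a b c)"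
    for u v w :: "coord \<times> nat \<times> nat" and a b c
  have "\<exists>c. (\<forall>v\<in>T. c v \<in> (case v of (i, l, m) \<Rightarrow> J l m)) \<and>
    (\<forall>u\<in>T. \<forall>v\<in>T. \<forall>w\<in>T. distinct [u, v, w] \<longrightarrow> Q u v w (c u) (c v) (c w))"
  proof (rule generic_choice)
    show "finite T" using I(1) by (simp add: T_def)
    show "infinite (case v of (i, l, m) \<Rightarrow> J l m)" for v using J by (auto split: prod.split)
    show "\<forall>\<^sub>\<infinity>a. \<forall>\<^sub>\<infinity>b. \<forall>\<^sub>\<infinity>c. Q u v w a b c" if "u \<in> T" "v \<in> T" "w \<in> T" for u v w
    proof (cases "distinct [fst u, fst v, fst w]")
      case True
      then have "\<forall>\<^sub>\<infinity>a. \<forall>\<^sub>\<infinity>b. \<forall>\<^sub>\<infinity>c. avoids_triple \<F> (fst u) (fst v) (fst w) a b c"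
        by (rule graphoid_avoids_generic_triple) (use that I(2) in \<open>auto simp: T_def\<close>)
      then show ?thesis using True by (simp add: Q_def)
    qed (auto simp: Q_def)
    show "Q v u w b a c" if "Q u v w a b c" for u v w a b c
      using that unfolding Q_def avoids_triple_def by auto
    show "Q u w v a c b" if "Q u v w a b c" for u v w a b c
      using that unfolding Q_def avoids_triple_def by auto
  qed
  then obtain c where cuts: "(\<forall>v\<in>T. c v \<in> (case v of (i, l, m) \<Rightarrow> J l m)) \<and>
    (\<forall>u\<in>T. \<forall>v\<in>T. \<forall>w\<in>T. distinct [u, v, w] \<longrightarrow> Q u v w (c u) (c v) (c w))" by (rule exE)
  note cJ = cuts[THEN conjunct1] and generic = cuts[THEN conjunct2]
  have c: "c (i, l, m) \<in> J l m" if "i \<in> I" "l < 3" "m < K" for i l m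
    using bspec[OF cJ, of "(i, l, m)"] that by (simp add: T_def)
  have "\<exists>\<P>. small_open_partition r \<P> \<and> \<Union>\<P> = - (Some ` (\<lambda>m. c (i, l, m)) ` {..<K})"
    if "i \<in> I" "l < 3" for i l
    by (rule cut) (use c that in auto)
  then obtain \<P> where \<P>': "\<And>i l. i \<in> I \<Longrightarrow> l < 3 \<Longrightarrow> small_open_partition r (\<P> i l) \<and>
      \<Union>(\<P> i l) = - (Some ` (\<lambda>m. c (i, l, m)) ` {..<K})"
    by metis
  have \<P>_fin: "finite (\<P> i l)" and \<P>_open: "\<And>S. S \<in> \<P> i l \<Longrightarrow> openin proj_line S" and \<P>_disj: "disjoint (\<P> i l)"
    and \<P>_small: "\<And>S u v. S \<in> \<P> i l \<Longrightarrow> u \<in> S \<Longrightarrow> v \<in> S \<Longrightarrow> norm (circ u - circ v) < r"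
    and \<P>_un: "\<Union>(\<P> i l) = - (Some ` (\<lambda>m. c (i, l, m)) ` {..<K})" if "i \<in> I" "l < 3" for i l
    using \<P>'[OF that] by (simp_all add: small_open_partition_def)
  define B where "B S = {p \<in> topspace (graphoid_space \<F>). \<forall>i\<in>I. coord_of i p \<in> S i}" for S
  define \<V> where "\<V> l = {V \<in> B ` (\<Pi>\<^sub>E i\<in>I. \<P> i l). V \<noteq> {}}" for l
  have fin: "finite (\<V> l)" if "l < 3" for l
  proof -
    have "finite (\<Pi>\<^sub>E i\<in>I. \<P> i l)" using that by (intro finite_PiE I \<P>_fin)
    then show ?thesis by (simp add: \<V>_def)
  qed
  have cover: "\<exists>l<3. \<exists>V\<in>\<V> l. p \<in> V" if p: "p \<in> graphoid \<F>" for p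
  proof -
    have "\<exists>l<3. \<forall>i\<in>I. \<forall>m<K. coord_of i p \<noteq> Some (c (i, l, m))"
    proof (rule ccontr)
      assume "\<not> ?thesis"
      then have "\<forall>l<3. \<exists>i m. i \<in> I \<and> m < K \<and> coord_of i p = Some (c (i, l, m))" by blast
      then obtain i m where im: "\<And>l. l < 3 \<Longrightarrow> i l \<in> I \<and> m l < K \<and> coord_of (i l) p = Some (c (i l, l, m l))"
        by metis
      have ne: "i l \<noteq> i l'" if "l < 3" "l' < 3" "l \<noteq> l'" for l l'
      proof
        assume eq: "i l = i l'"
        then have "c (i l, l, m l) = c (i l', l', m l')" using im[OF that(1)] im[OF that(2)] by simp
        then have "c (i l, l, m l) \<in> J l (m l) \<inter> J l' (m l')" using c im that by (metis IntI)
        then show False using J'[OF that(1,2)] that(3) by blast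
      qed
      let ?v = "\<lambda>l. (i l, l, m l)"
      have "Q (?v 0) (?v 1) (?v 2) (c (?v 0)) (c (?v 1)) (c (?v 2))"
        by (rule generic[rule_format]) (use im ne in \<open>auto simp: T_def\<close>)
      moreover have "distinct [i 0, i 1, i 2]" using ne[of 0 1] ne[of 0 2] ne[of 1 2] by simp
      ultimately have "avoids_triple \<F> (i 0) (i 1) (i 2) (c (?v 0)) (c (?v 1)) (c (?v 2))"
        by (simp add: Q_def)
      then show False using im[of 0] im[of 1] im[of 2] p by (auto simp: avoids_triple_def)
    qed
    then obtain l where l: "l < 3" "\<And>i m. i \<in> I \<Longrightarrow> m < K \<Longrightarrow> coord_of i p \<noteq> Some (c (i, l, m))" by blast
    have "\<exists>S\<in>\<P> i l. coord_of i p \<in> S" if "i \<in> I" for i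
    proof -
      have "coord_of i p \<in> \<Union>(\<P> i l)" unfolding \<P>_un[OF that l(1)] using l(2)[OF that] by blast
      then show ?thesis by blast
    qed
    then obtain S where S: "\<And>i. i \<in> I \<Longrightarrow> S i \<in> \<P> i l \<and> coord_of i p \<in> S i" by metis
    have "p \<in> B (restrict S I)" using S p by (simp add: B_def)
    moreover have "restrict S I \<in> (\<Pi>\<^sub>E i\<in>I. \<P> i l)" using S by auto
    ultimately have "B (restrict S I) \<in> \<V> l" "p \<in> B (restrict S I)" unfolding \<V>_def by blast+
    then show ?thesis using l(1) by blast
  qed
  have single: "card {V \<in> \<V> l. p \<in> V} \<le> 1" if l: "l < 3" for l p
  proof -
    have "V = V'" if V: "V \<in> \<V> l" "p \<in> V" "V' \<in> \<V> l" "p \<in> V'" for V V'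
    proof -
      obtain S S' where S: "S \<in> (\<Pi>\<^sub>E i\<in>I. \<P> i l)" "V = B S" "S' \<in> (\<Pi>\<^sub>E i\<in>I. \<P> i l)" "V' = B S'"
        using V by (auto simp: \<V>_def)
      have "S i = S' i" if i: "i \<in> I" for i
      proof -
        have "coord_of i p \<in> S i \<inter> S' i" using V S i by (auto simp: B_def)
        moreover have "S i \<in> \<P> i l" "S' i \<in> \<P> i l" using S i by auto
        ultimately show ?thesis using \<P>_disj[OF i l] by (metis disjointD emptyE)
      qed
      then have "S = S'" using S PiE_ext by blast
      then show ?thesis using S by simp
    qed
    then show ?thesis using fin[OF l] by (auto intro!: card_le_Suc0_iff_eq[THEN iffD2])
  qed
  show "\<exists>\<V>. finite \<V> \<and> open_cover (graphoid_space \<F>) \<V> \<and> (\<forall>V\<in>\<V>. \<exists>U\<in>\<U>. V \<subseteq> U) \<and>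
            (\<forall>x\<in>topspace (graphoid_space \<F>). int (card {V\<in>\<V>. x \<in> V}) \<le> 2 + 1)"
  proof (intro exI[of _ "\<Union>l<3. \<V> l"] conjI ballI)
    show "finite (\<Union>l<3. \<V> l)" using fin by auto
    have op: "openin (graphoid_space \<F>) V" if VV: "V \<in> \<V> l" and "l < 3" for V l
    proof -
      obtain S where S: "S \<in> (\<Pi>\<^sub>E i\<in>I. \<P> i l)" "V = B S" using VV by (auto simp: \<V>_def)
      show ?thesis unfolding S(2) B_def
      proof (rule openin_coord_box)
        show "continuous_map (graphoid_space \<F>) proj_line (coord_of i)" if "i \<in> I" for i
          using that I(2) by (intro continuous_map_coord_of) blast
        show "openin proj_line (S i)" if "i \<in> I" for i
          using PiE_mem[OF S(1) that] \<P>_open that \<open>l < 3\<close> by blast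
      qed (rule I(1))
    qed
    have sub: "V \<subseteq> graphoid \<F>" if "V \<in> \<V> l" for V l using that by (auto simp: \<V>_def B_def)
    have "\<Union> (\<Union>l<3. \<V> l) = graphoid \<F>"
    proof (rule subset_antisym)
      show "\<Union> (\<Union>l<3. \<V> l) \<subseteq> graphoid \<F>" using sub by blast
      show "graphoid \<F> \<subseteq> \<Union> (\<Union>l<3. \<V> l)" using cover by (simp add: subset_iff Bex_def) blast
    qed
    then show "open_cover (graphoid_space \<F>) (\<Union>l<3. \<V> l)"
      using op unfolding open_cover_def by auto
    fix V assume "V \<in> (\<Union>l<3. \<V> l)"
    then obtain l where l: "l < 3" "V \<in> \<V> l" by blast
    then obtain S where S: "S \<in> (\<Pi>\<^sub>E i\<in>I. \<P> i l)" "V = B S" by (auto simp: \<V>_def)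
    from l(2) obtain p where p: "p \<in> V" unfolding \<V>_def by blast
    then have pg: "p \<in> graphoid \<F>" using S(2) by (simp add: B_def)
    from leb[OF this] obtain U where U: "U \<in> \<U>" "\<And>q. q \<in> graphoid \<F> \<Longrightarrow>
       (\<forall>i\<in>I. norm (circ (coord_of i q) - circ (coord_of i p)) < r) \<Longrightarrow> q \<in> U" by blast
    have "q \<in> U" if q: "q \<in> V" for q
    proof (rule U(2))
      show "q \<in> graphoid \<F>" using q S(2) by (simp add: B_def)
      show "\<forall>i\<in>I. norm (circ (coord_of i q) - circ (coord_of i p)) < r"
      proof
        fix i assume i: "i \<in> I"
        then have "S i \<in> \<P> i l" "coord_of i q \<in> S i" "coord_of i p \<in> S i" using S p q by (auto simp: B_def)
        then show "norm (circ (coord_of i q) - circ (coord_of i p)) < r" using \<P>_small[OF i l(1)] by blast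
      qed
    qed
    then show "\<exists>U\<in>\<U>. V \<subseteq> U" using U(1) by blast
  next
    fix p
    have "{V \<in> \<Union>l<3. \<V> l. p \<in> V} = (\<Union>l<3. {V \<in> \<V> l. p \<in> V})" by auto
    then have "card {V \<in> \<Union>l<3. \<V> l. p \<in> V} \<le> (\<Sum>l<3. card {V \<in> \<V> l. p \<in> V})"
      using card_UN_le[of "{..<3::nat}" "\<lambda>l. {V \<in> \<V> l. p \<in> V}"] by simp
    also have "\<dots> \<le> (\<Sum>l<3::nat. 1)" using single by (intro sum_mono) auto
    finally show "int (card {V \<in> \<Union>l<3. \<V> l. p \<in> V}) \<le> 2 + 1" by simp
  qed
qed simp

section \<open>Perturbation off the origin over spaces of dimension at most one\<close>

definition partition_of_unity :: "'a topology \<Rightarrow> 'a set set \<Rightarrow> ('a set \<Rightarrow> 'a \<Rightarrow> real) \<Rightarrow> bool" where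
  "partition_of_unity X \<V> \<phi> \<longleftrightarrow>
     (\<forall>V\<in>\<V>. continuous_map X euclideanreal (\<phi> V)) \<and>
     (\<forall>V\<in>\<V>. \<forall>x\<in>topspace X. \<phi> V x \<ge> 0) \<and>
     (\<forall>V\<in>\<V>. \<forall>x\<in>topspace X. x \<notin> V \<longrightarrow> \<phi> V x = 0) \<and>
     (\<forall>x\<in>topspace X. (\<Sum>V\<in>\<V>. \<phi> V x) = 1)"

text \<open>
  Urysohn functions at the points of \<open>X\<close>, finitely many of which are needed, are grouped according
  to the member of the cover that supports them and divided by their sum.
\<close>

lemma ex_partition_of_unity:
  assumes "compact_space X" "Hausdorff_space X" "finite \<V>" "open_cover X \<V>"
  shows "\<exists>\<phi>. partition_of_unity X \<V> \<phi>"
proof -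
  have normal: "normal_space X"
    using compact_Hausdorff_or_regular_imp_normal_space assms(1,2) by blast
  have "\<exists>V f. V \<in> \<V> \<and> continuous_map X euclideanreal f \<and> (\<forall>y\<in>topspace X. 0 \<le> f y) \<and> f x = 1 \<and>
          (\<forall>y\<in>topspace X. y \<notin> V \<longrightarrow> f y = 0)" if x: "x \<in> topspace X" for x
  proof -
    have un: "\<Union>\<V> = topspace X" and op: "\<And>V. V \<in> \<V> \<Longrightarrow> openin X V" using assms(4) by (auto simp: open_cover_def)
    obtain V where V: "V \<in> \<V>" "x \<in> V" using un x by blast
    have c: "closedin X (topspace X - V)" "closedin X {x}"
      using op[OF V(1)] x assms(2) by (auto intro: closedin_diff closedin_Hausdorff_singleton)
    have dis: "disjnt (topspace X - V) {x}" using V by simp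
    obtain f where f: "continuous_map X (top_of_set {0..1::real}) f" "f ` (topspace X - V) \<subseteq> {0}" "f ` {x} \<subseteq> {1}"
      by (rule Urysohn_lemma[OF normal c dis, of 0 1]) auto
    from f(1) have "continuous_map X euclideanreal f" "\<And>y. y \<in> topspace X \<Longrightarrow> f y \<in> {0..1}"
      unfolding continuous_map_in_subtopology by auto
    then show ?thesis using V(1) f(2,3) by (intro exI[of _ V] exI[of _ f]) auto
  qed
  then obtain V f where Vf: "\<And>x. x \<in> topspace X \<Longrightarrow> V x \<in> \<V> \<and> continuous_map X euclideanreal (f x) \<and>
      (\<forall>y\<in>topspace X. 0 \<le> f x y) \<and> f x x = 1 \<and> (\<forall>y\<in>topspace X. y \<notin> V x \<longrightarrow> f x y = 0)"
    by metis
  define N where "N x = {y \<in> topspace X. f x y \<in> {0<..}}" for x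
  have N: "openin X (N x) \<and> x \<in> N x" if "x \<in> topspace X" for x
  proof
    show "openin X (N x)"
      unfolding N_def by (rule openin_continuous_map_preimage) (use Vf[OF that] in auto)
    show "x \<in> N x" using Vf[OF that] that by (simp add: N_def)
  qed
  obtain P where P: "finite P" "P \<subseteq> topspace X" "topspace X \<subseteq> \<Union>(N ` P)"
    using compact_space_finite_subcover[OF assms(1) N] by blast
  define \<psi> where "\<psi> W y = (\<Sum>x\<in>{x \<in> P. V x = W}. f x y)" for W y
  define \<Psi> where "\<Psi> y = (\<Sum>x\<in>P. f x y)" for y
  have fnn: "0 \<le> f x y" if "x \<in> P" "y \<in> topspace X" for x y using Vf P(2) that by blast
  have pos: "\<Psi> y > 0" if y: "y \<in> topspace X" for y
  proof -
    obtain x where x: "x \<in> P" "f x y > 0" using P(3) y by (auto simp: N_def)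
    then have "f x y \<le> \<Psi> y" unfolding \<Psi>_def using fnn y P(1) by (intro member_le_sum) auto
    then show ?thesis using x by linarith
  qed
  have cf: "continuous_map X euclideanreal (f x)" if "x \<in> P" for x using Vf P(2) that by blast
  have "(\<Sum>W\<in>\<V>. \<psi> W y) = \<Psi> y" for y
    unfolding \<psi>_def \<Psi>_def using P(1,2) Vf assms(3) by (intro sum.group) auto
  then have "(\<Sum>W\<in>\<V>. \<psi> W y / \<Psi> y) = 1" if "y \<in> topspace X" for y
    using pos[OF that] by (simp add: sum_divide_distrib[symmetric])
  moreover
  have \<Psi>0: "(\<Sum>x\<in>P. f x y) \<noteq> 0" if "y \<in> topspace X" for y
    using pos[OF that] unfolding \<Psi>_def by linarith
  have "continuous_map X euclideanreal (\<lambda>y. \<psi> W y / \<Psi> y)" for W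
    unfolding \<psi>_def \<Psi>_def
    by (intro continuous_map_real_divide continuous_map_sum) (use P(1) cf \<Psi>0 in auto)
  moreover have "\<psi> W y / \<Psi> y \<ge> 0" if "y \<in> topspace X" for W y
    using pos[OF that] fnn that unfolding \<psi>_def by (intro divide_nonneg_pos sum_nonneg) auto
  moreover have "\<psi> W y / \<Psi> y = 0" if y: "y \<in> topspace X" "y \<notin> W" for W y
  proof -
    have "f x y = 0" if "x \<in> P" "V x = W" for x using Vf[of x] P(2) that y by blast
    then show ?thesis by (simp add: \<psi>_def)
  qed
  ultimately have "partition_of_unity X \<V> (\<lambda>W y. \<psi> W y / \<Psi> y)"
    unfolding partition_of_unity_def by simp
  then show ?thesis by blast
qed

lemma finite_segments_miss_small_point:
  fixes \<S> :: "(complex \<times> complex) set"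
  assumes "finite \<S>" "\<epsilon> > 0"
  obtains c where "norm c < \<epsilon>" "\<And>a b. (a, b) \<in> \<S> \<Longrightarrow> c \<notin> closed_segment a b"
proof -
  have "negligible (\<Union>((\<lambda>(a, b). closed_segment a b) ` \<S>))"
    using assms(1)
    by (intro negligible_Union)
       (auto simp: negligible_convex_interior[OF convex_closed_segment] interior_closed_segment_ge2)
  moreover have "\<not> negligible (ball (0::complex) \<epsilon>)"
    using assms(2) by (intro open_not_negligible) auto
  ultimately obtain c where "c \<in> ball 0 \<epsilon>" "c \<notin> \<Union>((\<lambda>(a, b). closed_segment a b) ` \<S>)"
    using negligible_subset by blast
  then show thesis using that by force
qed

text \<open>
  The map is approximated by its composition with the map of \<open>X\<close> to the nerve of a fine cover. When
  no three members of the cover meet, the nerve is a graph, whose image in the plane is a finite union of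
  segments; a small translation moves the origin off these segments.
\<close>

theorem covering_dim_le_1_perturb_off_origin:
  assumes X: "compact_space X" "Hausdorff_space X" "covering_dim_le X 1"
    and \<Phi>: "continuous_map X euclideanreal \<Phi>\<^sub>1" "continuous_map X euclideanreal \<Phi>\<^sub>2" and "\<epsilon> > 0"
  shows "\<exists>g h. continuous_map X euclideanreal g \<and> continuous_map X euclideanreal h \<and>
    (\<forall>x\<in>topspace X. \<bar>g x - \<Phi>\<^sub>1 x\<bar> < \<epsilon> \<and> \<bar>h x - \<Phi>\<^sub>2 x\<bar> < \<epsilon> \<and> (g x \<noteq> 0 \<or> h x \<noteq> 0))"
proof -
  define N where "N x = {y \<in> topspace X. \<Phi>\<^sub>1 y \<in> ball (\<Phi>\<^sub>1 x) (\<epsilon>/4)} \<inter> {y \<in> topspace X. \<Phi>\<^sub>2 y \<in> ball (\<Phi>\<^sub>2 x) (\<epsilon>/4)}" for x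
  have N: "openin X (N x) \<and> x \<in> N x" if "x \<in> topspace X" for x
  proof
    show "openin X (N x)"
      unfolding N_def
      by (intro openin_Int openin_continuous_map_preimage[OF \<Phi>(1)] openin_continuous_map_preimage[OF \<Phi>(2)]) auto
    show "x \<in> N x" using that \<open>\<epsilon> > 0\<close> by (simp add: N_def)
  qed
  obtain P where P: "finite P" "P \<subseteq> topspace X" "topspace X \<subseteq> \<Union>(N ` P)"
    using compact_space_finite_subcover[OF X(1) N] by blast
  have "\<Union>(N ` P) \<subseteq> topspace X" by (auto simp: N_def)
  then have "finite (N ` P) \<and> open_cover X (N ` P)"
    using P N unfolding open_cover_def by blast
  then have "\<exists>\<V>. finite \<V> \<and> open_cover X \<V> \<and> (\<forall>V\<in>\<V>. \<exists>U\<in>N ` P. V \<subseteq> U) \<and>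
      (\<forall>x\<in>topspace X. int (card {V \<in> \<V>. x \<in> V}) \<le> 1 + 1)"
    by (rule X(3)[unfolded covering_dim_le_def, THEN conjunct2, THEN spec, THEN mp])
  then obtain \<V> where \<V>: "finite \<V>" "open_cover X \<V>" "\<forall>V\<in>\<V>. \<exists>U\<in>N ` P. V \<subseteq> U"
    "\<forall>x\<in>topspace X. int (card {V \<in> \<V>. x \<in> V}) \<le> 1 + 1"
    by (elim exE conjE)
  obtain \<phi> where \<phi>: "partition_of_unity X \<V> \<phi>"
    using ex_partition_of_unity[OF X(1,2) \<V>(1,2)] by blast
  have \<phi>_cont: "continuous_map X euclideanreal (\<phi> V)" if "V \<in> \<V>" for V
    using \<phi> that by (simp add: partition_of_unity_def)
  have \<phi>_nn: "\<phi> V x \<ge> 0" if "V \<in> \<V>" "x \<in> topspace X" for V x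
    using \<phi> that by (simp add: partition_of_unity_def)
  have \<phi>_0: "\<phi> V x = 0" if "V \<in> \<V>" "x \<in> topspace X" "x \<notin> V" for V x
    using \<phi> that by (simp add: partition_of_unity_def)
  have \<phi>_1: "(\<Sum>V\<in>\<V>. \<phi> V x) = 1" if "x \<in> topspace X" for x
    using \<phi> that by (simp add: partition_of_unity_def)
  \<comment> \<open>For empty \<open>V\<close> the point is arbitrary, but then \<open>\<phi> V\<close> vanishes everywhere.\<close>
  define z where "z V = (SOME x. x \<in> V)" for V :: "'a set"
  have close: "\<bar>\<Phi>\<^sub>1 (z V) - \<Phi>\<^sub>1 x\<bar> \<le> \<epsilon>/2" "\<bar>\<Phi>\<^sub>2 (z V) - \<Phi>\<^sub>2 x\<bar> \<le> \<epsilon>/2" if VV: "V \<in> \<V>" and xV: "x \<in> V" for V x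
  proof -
    have "z V \<in> V" unfolding z_def using xV by (rule someI)
    moreover obtain p where "V \<subseteq> N p" using \<V>(3) VV by blast
    ultimately have "z V \<in> N p" "x \<in> N p" using xV by auto
    then have "\<bar>\<Phi>\<^sub>1 p - \<Phi>\<^sub>1 (z V)\<bar> < \<epsilon>/4" "\<bar>\<Phi>\<^sub>1 p - \<Phi>\<^sub>1 x\<bar> < \<epsilon>/4" "\<bar>\<Phi>\<^sub>2 p - \<Phi>\<^sub>2 (z V)\<bar> < \<epsilon>/4" "\<bar>\<Phi>\<^sub>2 p - \<Phi>\<^sub>2 x\<bar> < \<epsilon>/4"
      by (auto simp: N_def dist_real_def)
    then show "\<bar>\<Phi>\<^sub>1 (z V) - \<Phi>\<^sub>1 x\<bar> \<le> \<epsilon>/2" "\<bar>\<Phi>\<^sub>2 (z V) - \<Phi>\<^sub>2 x\<bar> \<le> \<epsilon>/2" by linarith+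
  qed
  define Z where "Z V = Complex (\<Phi>\<^sub>1 (z V)) (\<Phi>\<^sub>2 (z V))" for V
  obtain c where c: "norm c < \<epsilon>/2" "\<And>a b. (a, b) \<in> (\<lambda>(V, W). (Z V, Z W)) ` (\<V> \<times> \<V>) \<Longrightarrow> c \<notin> closed_segment a b"
    using finite_segments_miss_small_point[of "(\<lambda>(V, W). (Z V, Z W)) ` (\<V> \<times> \<V>)" "\<epsilon>/2"] \<V>(1) \<open>\<epsilon> > 0\<close> by auto
  have c_seg: "c \<notin> closed_segment (Z V) (Z W)" if "V \<in> \<V>" "W \<in> \<V>" for V W
    using that by (intro c(2) image_eqI[of _ _ "(V, W)"]) auto
  define avg where "avg a x = (\<Sum>V\<in>\<V>. \<phi> V x * a V)" for a :: "'a set \<Rightarrow> real" and x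
  have avg_cont: "continuous_map X euclideanreal (avg a)" for a
    unfolding avg_def using \<V>(1) \<phi>_cont by (intro continuous_map_sum continuous_map_real_mult_right)
  have avg_close: "\<bar>avg a x - t\<bar> \<le> \<epsilon>/2" if x: "x \<in> topspace X" and a: "\<And>V. V \<in> \<V> \<Longrightarrow> x \<in> V \<Longrightarrow> \<bar>a V - t\<bar> \<le> \<epsilon>/2" for a x t
  proof -
    have "avg a x - t = (\<Sum>V\<in>\<V>. \<phi> V x * (a V - t))"
      using \<phi>_1[OF x] by (simp add: avg_def right_diff_distrib sum_subtractf sum_distrib_right[symmetric])
    also have "\<bar>\<dots>\<bar> \<le> (\<Sum>V\<in>\<V>. \<bar>\<phi> V x * (a V - t)\<bar>)" by (rule sum_abs)
    also have "\<dots> \<le> (\<Sum>V\<in>\<V>. \<phi> V x * (\<epsilon>/2))"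
    proof (rule sum_mono)
      fix V assume V: "V \<in> \<V>"
      show "\<bar>\<phi> V x * (a V - t)\<bar> \<le> \<phi> V x * (\<epsilon>/2)"
      proof (cases "x \<in> V")
        case True
        then have "\<phi> V x * \<bar>a V - t\<bar> \<le> \<phi> V x * (\<epsilon>/2)"
          by (intro mult_left_mono a[OF V] \<phi>_nn[OF V x])
        then show ?thesis unfolding abs_mult using \<phi>_nn[OF V x] by simp
      qed (simp add: \<phi>_0[OF V x])
    qed
    also have "\<dots> = \<epsilon>/2" using \<phi>_1[OF x] by (simp add: sum_distrib_right[symmetric] sum_divide_distrib[symmetric])
    finally show ?thesis .
  qed
  define g where "g x = avg (\<lambda>V. Re (Z V)) x - Re c" for x
  define h where "h x = avg (\<lambda>V. Im (Z V)) x - Im c" for x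
  have "\<bar>g x - \<Phi>\<^sub>1 x\<bar> < \<epsilon> \<and> \<bar>h x - \<Phi>\<^sub>2 x\<bar> < \<epsilon> \<and> (g x \<noteq> 0 \<or> h x \<noteq> 0)" if x: "x \<in> topspace X" for x
  proof -
    have "\<bar>avg (\<lambda>V. Re (Z V)) x - \<Phi>\<^sub>1 x\<bar> \<le> \<epsilon>/2" "\<bar>avg (\<lambda>V. Im (Z V)) x - \<Phi>\<^sub>2 x\<bar> \<le> \<epsilon>/2"
    proof -
      show "\<bar>avg (\<lambda>V. Re (Z V)) x - \<Phi>\<^sub>1 x\<bar> \<le> \<epsilon>/2"
      proof (rule avg_close[OF x])
        show "\<bar>Re (Z V) - \<Phi>\<^sub>1 x\<bar> \<le> \<epsilon>/2" if "V \<in> \<V>" "x \<in> V" for V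
          using close(1)[OF that] by (simp only: Z_def complex.sel)
      qed
      show "\<bar>avg (\<lambda>V. Im (Z V)) x - \<Phi>\<^sub>2 x\<bar> \<le> \<epsilon>/2"
      proof (rule avg_close[OF x])
        show "\<bar>Im (Z V) - \<Phi>\<^sub>2 x\<bar> \<le> \<epsilon>/2" if "V \<in> \<V>" "x \<in> V" for V
          using close(2)[OF that] by (simp only: Z_def complex.sel)
      qed
    qed
    moreover have "\<bar>Re c\<bar> < \<epsilon>/2" "\<bar>Im c\<bar> < \<epsilon>/2"
      using c(1) abs_Re_le_cmod[of c] abs_Im_le_cmod[of c] by linarith+
    moreover have "\<not> (g x = 0 \<and> h x = 0)"
    proof
      assume 0: "g x = 0 \<and> h x = 0"
      define \<W> where "\<W> = {V \<in> \<V>. x \<in> V}"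
      have \<W>: "finite \<W>" "card \<W> \<le> 2" "\<W> \<subseteq> \<V>" using \<V>(1) \<V>(4) x by (auto simp: \<W>_def)
      have restr: "(\<Sum>V\<in>\<V>. \<phi> V x *\<^sub>R Y V) = (\<Sum>V\<in>\<W>. \<phi> V x *\<^sub>R Y V)" for Y :: "'a set \<Rightarrow> 'b::real_vector"
        by (rule sum.mono_neutral_right) (use \<V>(1) \<phi>_0[OF _ x] in \<open>auto simp: \<W>_def\<close>)
      have "(\<Sum>V\<in>\<V>. \<phi> V x *\<^sub>R Z V) = c"
        unfolding complex_eq_iff using 0 by (simp add: g_def h_def avg_def Re_sum Im_sum)
      then have c_eq: "(\<Sum>V\<in>\<W>. \<phi> V x *\<^sub>R Z V) = c" by (simp add: restr)
      have one: "(\<Sum>V\<in>\<W>. \<phi> V x) = 1" using restr[of "\<lambda>_. 1 :: real"] \<phi>_1[OF x] by simp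
      then have "\<W> \<noteq> {}" by auto
      then obtain V where V: "V \<in> \<W>" by blast
      show False
      proof (cases "\<W> = {V}")
        case True
        then have "c = Z V" using c_eq one by simp
        then show False using c_seg[of V V] V \<W>(3) by auto
      next
        case False
        then obtain W where W: "W \<in> \<W>" "W \<noteq> V" using V by blast
        have eqW: "{V, W} = \<W>"
        proof (rule card_seteq)
          show "finite \<W>" by (rule \<W>(1))
          show "{V, W} \<subseteq> \<W>" using V W(1) by simp
          show "card \<W> \<le> card {V, W}" using \<W>(2) W(2) by simp
        qed
        have sum2: "\<phi> V x *\<^sub>R Z V + \<phi> W x *\<^sub>R Z W = c" "\<phi> V x + \<phi> W x = 1"
          using c_eq one W(2)[symmetric] unfolding eqW[symmetric] by simp_all
        have "\<phi> V x \<ge> 0" "\<phi> W x \<ge> 0" using \<phi>_nn x V W(1) \<W>(3) by blast+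
        moreover have "\<phi> V x = 1 - \<phi> W x" using sum2(2) by simp
        ultimately have "c = (1 - \<phi> W x) *\<^sub>R Z V + \<phi> W x *\<^sub>R Z W" "0 \<le> \<phi> W x" "\<phi> W x \<le> 1"
          using sum2(1) by simp_all
        then have "c \<in> closed_segment (Z V) (Z W)" unfolding closed_segment_def by blast
        then show False using c_seg[of V W] V W \<W>(3) by blast
      qed
    qed
    ultimately have "\<bar>g x - \<Phi>\<^sub>1 x\<bar> < \<epsilon>" "\<bar>h x - \<Phi>\<^sub>2 x\<bar> < \<epsilon>" "g x \<noteq> 0 \<or> h x \<noteq> 0"
      unfolding g_def h_def by linarith+
    then show ?thesis by blast
  qed
  moreover have "continuous_map X euclideanreal g" "continuous_map X euclideanreal h"
    unfolding g_def h_def by (intro continuous_map_diff avg_cont; simp)+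
  ultimately show ?thesis by blast
qed

section \<open>Rational approximation on the graphoid\<close>

text \<open>
  The uncountable product of complex planes that receives the values of \<open>circ\<close> at all coordinates, as
  a type of its own with a Hausdorff topology; the Stone-Weierstrass theorem is applied in it.
\<close>

typedef circle_tuple = "UNIV :: (coord \<Rightarrow> complex) set"
  morphisms entry Tuple by simp

lemma entry_Tuple [simp]: "entry (Tuple f) = f"
  by (simp add: Tuple_inverse)

lemma Tuple_eq_iff [simp]: "Tuple f = Tuple g \<longleftrightarrow> f = g"
  by (simp add: Tuple_inject)

instantiation circle_tuple :: t2_space
begin

definition open_circle_tuple :: "circle_tuple set \<Rightarrow> bool" where
  "open_circle_tuple U \<longleftrightarrow> open (Tuple -` U)"

instance
proof
  show "open (UNIV :: circle_tuple set)" by (simp add: open_circle_tuple_def)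
  show "open (S \<inter> T)" if "open S" "open T" for S T :: "circle_tuple set"
    using that by (simp add: open_circle_tuple_def open_Int)
  show "open (\<Union>K)" if "\<forall>S\<in>K. open S" for K :: "circle_tuple set set"
    using that by (simp add: open_circle_tuple_def vimage_Union open_UN)
  fix s t :: circle_tuple
  assume "s \<noteq> t"
  then have "entry s \<noteq> entry t" by (simp add: entry_inject)
  then obtain i where "entry s i \<noteq> entry t i" by blast
  from hausdorff[OF this] obtain U V where UV: "open U" "open V" "entry s i \<in> U" "entry t i \<in> V" "U \<inter> V = {}"
    by blast
  have "open ((\<lambda>s. entry s i) -` W)" if "open W" for W
  proof -
    have "Tuple -` ((\<lambda>s. entry s i) -` W) = (\<lambda>f. f i) -` W" by auto
    moreover have "open ((\<lambda>f :: coord \<Rightarrow> complex. f i) -` W)" using that by (intro open_vimage) auto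
    ultimately show ?thesis by (simp add: open_circle_tuple_def)
  qed
  then show "\<exists>U V. open U \<and> open V \<and> s \<in> U \<and> t \<in> V \<and> U \<inter> V = {}"
    using UV by (intro exI[of _ "(\<lambda>s. entry s i) -` U"] exI[of _ "(\<lambda>s. entry s i) -` V"]) auto
qed

end

lemma Hausdorff_space_circle_tuple: "Hausdorff_space (euclidean :: circle_tuple topology)"
  unfolding Hausdorff_space_def
proof (intro allI impI)
  fix s t :: circle_tuple
  assume "s \<in> topspace euclidean \<and> t \<in> topspace euclidean \<and> s \<noteq> t"
  then have "s \<noteq> t" by blast
  from hausdorff[OF this] obtain U V where "open U" "open V" "s \<in> U" "t \<in> V" "U \<inter> V = {}" by blast
  then show "\<exists>U V. openin euclidean U \<and> openin euclidean V \<and> s \<in> U \<and> t \<in> V \<and> disjnt U V"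
    by (intro exI[of _ U] exI[of _ V]) (simp add: disjnt_def)
qed

lemma continuous_on_entry: "continuous_on S (\<lambda>s. entry s i)"
proof -
  have "open ((\<lambda>s. entry s i) -` W)" if "open W" for W
  proof -
    have "Tuple -` ((\<lambda>s. entry s i) -` W) = (\<lambda>f. f i) -` W" by auto
    moreover have "open ((\<lambda>f :: coord \<Rightarrow> complex. f i) -` W)" using that by (intro open_vimage) auto
    ultimately show ?thesis by (simp add: open_circle_tuple_def)
  qed
  then have "continuous_on UNIV (\<lambda>s. entry s i)" by (simp add: continuous_on_open_vimage)
  then show ?thesis by (rule continuous_on_subset) simp
qed

lemma continuous_map_Tuple: "continuous_map euclidean euclidean Tuple"
  by (simp add: continuous_on_open_vimage open_circle_tuple_def)

text \<open>
  Up to an error \<open>\<epsilon>\<close>, the function \<open>r\<close> on the graphoid is the pullback of \<open>N / D\<close> from the plane, at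
  all points that lie over the domains of the members of the finite set \<open>\<E>\<close>.
\<close>

definition approximated_by :: "ratfun2 set \<Rightarrow> ratfun2 set \<Rightarrow> ((proj_real \<times> proj_real) \<times> (ratfun2 \<Rightarrow> proj_real) \<Rightarrow> real)
    \<Rightarrow> real poly poly \<Rightarrow> real poly poly \<Rightarrow> real \<Rightarrow> bool" where
  "approximated_by \<F> \<E> r N D \<epsilon> \<longleftrightarrow> finite \<E> \<and> \<E> \<subseteq> \<F> \<and>
     (\<forall>x y. (\<forall>f\<in>\<E>. regular_at (Ratfun f) x y) \<longrightarrow> eval2 D x y > 0 \<and>
       (\<forall>p\<in>graphoid \<F>. (\<forall>i\<in>coords \<E>. coord_of i p = coord_val i x y) \<longrightarrow>
          \<bar>r p - eval2 N x y / eval2 D x y\<bar> \<le> \<epsilon>))"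

text \<open>
  For \<open>\<epsilon> = 0\<close> the approximable functions form a ring.
\<close>

lemma approximated_by_common:
  assumes "approximated_by \<F> \<E>\<^sub>1 r\<^sub>1 N\<^sub>1 D\<^sub>1 0" "approximated_by \<F> \<E>\<^sub>2 r\<^sub>2 N\<^sub>2 D\<^sub>2 0"
  shows "approximated_by \<F> (\<E>\<^sub>1 \<union> \<E>\<^sub>2) (\<lambda>p. r\<^sub>1 p + r\<^sub>2 p) (N\<^sub>1 * D\<^sub>2 + N\<^sub>2 * D\<^sub>1) (D\<^sub>1 * D\<^sub>2) 0"
    and "approximated_by \<F> (\<E>\<^sub>1 \<union> \<E>\<^sub>2) (\<lambda>p. r\<^sub>1 p * r\<^sub>2 p) (N\<^sub>1 * N\<^sub>2) (D\<^sub>1 * D\<^sub>2) 0"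
proof -
  have fin: "finite (\<E>\<^sub>1 \<union> \<E>\<^sub>2)" "\<E>\<^sub>1 \<union> \<E>\<^sub>2 \<subseteq> \<F>" using assms by (auto simp: approximated_by_def)
  have *: "eval2 D\<^sub>1 x y > 0 \<and> eval2 D\<^sub>2 x y > 0 \<and> (\<forall>p\<in>graphoid \<F>. (\<forall>i\<in>coords (\<E>\<^sub>1 \<union> \<E>\<^sub>2). coord_of i p = coord_val i x y) \<longrightarrow>
      r\<^sub>1 p = eval2 N\<^sub>1 x y / eval2 D\<^sub>1 x y \<and> r\<^sub>2 p = eval2 N\<^sub>2 x y / eval2 D\<^sub>2 x y)"
    if "\<forall>f\<in>\<E>\<^sub>1 \<union> \<E>\<^sub>2. regular_at (Ratfun f) x y" for x y
  proof -
    have r: "\<forall>f\<in>\<E>\<^sub>1. regular_at (Ratfun f) x y" "\<forall>f\<in>\<E>\<^sub>2. regular_at (Ratfun f) x y" using that by auto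
    have sub: "coords \<E>\<^sub>1 \<subseteq> coords (\<E>\<^sub>1 \<union> \<E>\<^sub>2)" "coords \<E>\<^sub>2 \<subseteq> coords (\<E>\<^sub>1 \<union> \<E>\<^sub>2)" by (auto simp: coords_def)
    from assms(1) r(1) have 1: "eval2 D\<^sub>1 x y > 0" "\<And>p. p \<in> graphoid \<F> \<Longrightarrow> (\<forall>i\<in>coords \<E>\<^sub>1. coord_of i p = coord_val i x y) \<Longrightarrow> r\<^sub>1 p = eval2 N\<^sub>1 x y / eval2 D\<^sub>1 x y"
      by (auto simp: approximated_by_def)
    from assms(2) r(2) have 2: "eval2 D\<^sub>2 x y > 0" "\<And>p. p \<in> graphoid \<F> \<Longrightarrow> (\<forall>i\<in>coords \<E>\<^sub>2. coord_of i p = coord_val i x y) \<Longrightarrow> r\<^sub>2 p = eval2 N\<^sub>2 x y / eval2 D\<^sub>2 x y"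
      by (auto simp: approximated_by_def)
    show ?thesis using 1 2 sub by blast
  qed
  show "approximated_by \<F> (\<E>\<^sub>1 \<union> \<E>\<^sub>2) (\<lambda>p. r\<^sub>1 p + r\<^sub>2 p) (N\<^sub>1 * D\<^sub>2 + N\<^sub>2 * D\<^sub>1) (D\<^sub>1 * D\<^sub>2) 0"
    unfolding approximated_by_def
  proof (intro conjI fin allI impI ballI)
    fix x y assume h: "\<forall>f\<in>\<E>\<^sub>1 \<union> \<E>\<^sub>2. regular_at (Ratfun f) x y"
    note d = *[OF h]
    show "eval2 (D\<^sub>1 * D\<^sub>2) x y > 0" using d by simp
    fix p assume "p \<in> graphoid \<F>" "\<forall>i\<in>coords (\<E>\<^sub>1 \<union> \<E>\<^sub>2). coord_of i p = coord_val i x y"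
    then have "r\<^sub>1 p = eval2 N\<^sub>1 x y / eval2 D\<^sub>1 x y" "r\<^sub>2 p = eval2 N\<^sub>2 x y / eval2 D\<^sub>2 x y" using d by blast+
    then show "\<bar>r\<^sub>1 p + r\<^sub>2 p - eval2 (N\<^sub>1 * D\<^sub>2 + N\<^sub>2 * D\<^sub>1) x y / eval2 (D\<^sub>1 * D\<^sub>2) x y\<bar> \<le> 0"
      using d by (simp add: add_frac_eq)
  qed
  show "approximated_by \<F> (\<E>\<^sub>1 \<union> \<E>\<^sub>2) (\<lambda>p. r\<^sub>1 p * r\<^sub>2 p) (N\<^sub>1 * N\<^sub>2) (D\<^sub>1 * D\<^sub>2) 0"
    unfolding approximated_by_def
  proof (intro conjI fin allI impI ballI)
    fix x y assume h: "\<forall>f\<in>\<E>\<^sub>1 \<union> \<E>\<^sub>2. regular_at (Ratfun f) x y"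
    note d = *[OF h]
    show "eval2 (D\<^sub>1 * D\<^sub>2) x y > 0" using d by simp
    fix p assume "p \<in> graphoid \<F>" "\<forall>i\<in>coords (\<E>\<^sub>1 \<union> \<E>\<^sub>2). coord_of i p = coord_val i x y"
    then have "r\<^sub>1 p = eval2 N\<^sub>1 x y / eval2 D\<^sub>1 x y" "r\<^sub>2 p = eval2 N\<^sub>2 x y / eval2 D\<^sub>2 x y" using d by blast+
    then show "\<bar>r\<^sub>1 p * r\<^sub>2 p - eval2 (N\<^sub>1 * N\<^sub>2) x y / eval2 (D\<^sub>1 * D\<^sub>2) x y\<bar> \<le> 0"
      by simp
  qed
qed

lemma approximated_by_circ:
  assumes "i \<in> coords \<F>"
  shows "\<exists>\<E> N D. approximated_by \<F> \<E> (\<lambda>p. Re (circ (coord_of i p))) N D 0"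
    and "\<exists>\<E> N D. approximated_by \<F> \<E> (\<lambda>p. Im (circ (coord_of i p))) N D 0"
proof -
  define \<E> where "\<E> = {f. i = Ratfun f}"
  have \<E>: "finite \<E>" "\<E> \<subseteq> \<F>" using assms by (cases i; auto simp: \<E>_def coords_def)+
  have i: "i \<in> coords \<E>" by (cases i) (auto simp: \<E>_def coords_def)
  have reg: "regular_at i x y" if "\<forall>f\<in>\<E>. regular_at (Ratfun f) x y" for x y
    using that by (cases i) (auto simp: \<E>_def)
  let ?p = "coord_num i" and ?q = "coord_den i"
  have D: "eval2 (?q ^ 2 + ?p ^ 2) x y > 0" if "\<forall>f\<in>\<E>. regular_at (Ratfun f) x y" for x y
    using coord_norm_pos[OF reg[OF that]] by simp
  have "approximated_by \<F> \<E> (\<lambda>p. Re (circ (coord_of i p))) (?q ^ 2 - ?p ^ 2) (?q ^ 2 + ?p ^ 2) 0"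
    unfolding approximated_by_def
  proof (intro conjI \<E> allI impI ballI)
    show "eval2 (?q ^ 2 + ?p ^ 2) x y > 0" if "\<forall>f\<in>\<E>. regular_at (Ratfun f) x y" for x y
      by (rule D[OF that])
    fix x y p assume "\<forall>f\<in>\<E>. regular_at (Ratfun f) x y" "\<forall>i\<in>coords \<E>. coord_of i p = coord_val i x y"
    then show "\<bar>Re (circ (coord_of i p)) - eval2 (?q ^ 2 - ?p ^ 2) x y / eval2 (?q ^ 2 + ?p ^ 2) x y\<bar> \<le> 0"
      using circ_coord_val_components(1)[OF reg] i by simp
  qed
  moreover have "approximated_by \<F> \<E> (\<lambda>p. Im (circ (coord_of i p))) (2 * ?q * ?p) (?q ^ 2 + ?p ^ 2) 0"
    unfolding approximated_by_def
  proof (intro conjI \<E> allI impI ballI)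
    show "eval2 (?q ^ 2 + ?p ^ 2) x y > 0" if "\<forall>f\<in>\<E>. regular_at (Ratfun f) x y" for x y
      by (rule D[OF that])
    fix x y p assume "\<forall>f\<in>\<E>. regular_at (Ratfun f) x y" "\<forall>i\<in>coords \<E>. coord_of i p = coord_val i x y"
    moreover have "eval2 (2 * ?q * ?p) x y = 2 * eval2 ?q x y * eval2 ?p x y"
      by (simp add: eval2_def)
    ultimately show "\<bar>Im (circ (coord_of i p)) - eval2 (2 * ?q * ?p) x y / eval2 (?q ^ 2 + ?p ^ 2) x y\<bar> \<le> 0"
      using circ_coord_val_components(2)[OF reg] i by simp
  qed
  ultimately show "\<exists>\<E> N D. approximated_by \<F> \<E> (\<lambda>p. Re (circ (coord_of i p))) N D 0"
    "\<exists>\<E> N D. approximated_by \<F> \<E> (\<lambda>p. Im (circ (coord_of i p))) N D 0" by blast+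
qed

text \<open>
  The Stone-Weierstrass theorem for the ring generated by the real and imaginary parts of
  \<open>circ\<close> at the coordinates. These functions separate points and are quotients with positive
  denominators over the real plane.
\<close>

theorem graphoid_rational_approximation:
  assumes r: "continuous_map (graphoid_space \<F>) euclideanreal r" and "\<epsilon> > 0"
  shows "\<exists>\<E> N D. approximated_by \<F> \<E> r N D \<epsilon>"
proof -
  define e0 :: "_ \<Rightarrow> coord \<Rightarrow> complex" where "e0 p = (\<lambda>i. if i \<in> coords \<F> then circ (coord_of i p) else 0)" for p
  define e where "e p = Tuple (e0 p)" for p
  define S where "S = e ` graphoid \<F>"
  have cc: "continuous_map (graphoid_space \<F>) euclidean (\<lambda>p. circ (coord_of i p))" if "i \<in> coords \<F>" for i
    using continuous_map_compose[OF continuous_map_coord_of[OF that] continuous_map_circ] by (simp add: o_def)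
  have "continuous_map (graphoid_space \<F>) euclidean e0"
    unfolding euclidean_product_topology[symmetric] continuous_map_componentwise_UNIV
  proof
    fix i show "continuous_map (graphoid_space \<F>) euclidean (\<lambda>p. e0 p i)"
      using cc[of i] by (cases "i \<in> coords \<F>") (simp_all add: e0_def)
  qed
  from continuous_map_compose[OF this continuous_map_Tuple]
  have e_cont: "continuous_map (graphoid_space \<F>) euclidean e" by (simp add: o_def e_def[abs_def])
  then have e_cont': "continuous_map (graphoid_space \<F>) (top_of_set S) e"
    by (auto simp: continuous_map_in_subtopology S_def)
  have inj: "inj_on e (graphoid \<F>)"
  proof (rule inj_onI)
    fix p q assume pq: "p \<in> graphoid \<F>" "q \<in> graphoid \<F>" and "e p = e q"
    then have eq: "e0 p = e0 q" by (simp add: e_def)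
    have "coord_of i p = coord_of i q" if "i \<in> coords \<F>" for i
      using fun_cong[OF eq, of i] that inj_circ by (auto simp: e0_def dest: injD)
    from this[of Abscissa] this[of Ordinate] this[of "Ratfun _"]
    have "fst p = fst q" "\<And>f. f \<in> \<F> \<Longrightarrow> snd p f = snd q f"
      by (cases p; cases q; auto simp: coords_def prod_eq_iff)+
    moreover have "snd p f = snd q f" if "f \<notin> \<F>" for f
      using pq(1,2) that by (auto simp: graphoid_def graphoid_ext_def PiE_iff extensional_def)
    ultimately show "p = q" by (auto simp: prod_eq_iff)
  qed
  have "compactin euclidean S"
    unfolding S_def using image_compactin[OF _ e_cont, of "graphoid \<F>"] compact_graphoid_space[of \<F>]
    by (simp add: compact_space_def)
  then have compact: "compact S" by simp
  have "closed_map (graphoid_space \<F>) (top_of_set S) e"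
    by (rule continuous_imp_closed_map[OF e_cont' compact_graphoid_space])
       (rule Hausdorff_space_subtopology[OF Hausdorff_space_circle_tuple])
  then have "homeomorphic_map (graphoid_space \<F>) (top_of_set S) e"
    by (intro bijective_closed_imp_homeomorphic_map e_cont') (simp_all add: S_def inj)
  then obtain e' where e': "homeomorphic_maps (graphoid_space \<F>) (top_of_set S) e e'"
    unfolding homeomorphic_map_maps by blast
  have inv: "e' (e p) = p" if "p \<in> graphoid \<F>" for p using e' that by (simp add: homeomorphic_maps_def)
  have "continuous_map (top_of_set S) euclideanreal (r \<circ> e')"
    using e' by (intro continuous_map_compose[OF _ r]) (simp add: homeomorphic_maps_def)
  then have r_cont: "continuous_on S (r \<circ> e')" by simp
  define R where "R = {s. continuous_on S s \<and> (\<exists>\<E> N D. approximated_by \<F> \<E> (\<lambda>p. s (e p)) N D 0)}"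
  have "function_ring_on R S"
  proof
    show "compact S" by (rule compact)
    show "continuous_on S f" if "f \<in> R" for f using that by (simp add: R_def)
    show "(\<lambda>x. f x + g x) \<in> R" if "f \<in> R" "g \<in> R" for f g
      using that approximated_by_common(1) unfolding R_def by (blast intro: continuous_on_add)
    show "(\<lambda>x. f x * g x) \<in> R" if "f \<in> R" "g \<in> R" for f g
      using that approximated_by_common(2) unfolding R_def by (blast intro: continuous_on_mult)
    show "(\<lambda>_. c) \<in> R" for c
    proof -
      have "approximated_by \<F> {} (\<lambda>p. c) [:[:c:]:] 1 0" by (simp add: approximated_by_def)
      then show ?thesis unfolding R_def by (auto simp: continuous_on_const)
    qed
    show "\<exists>f\<in>R. f a \<noteq> f b" if ab: "a \<in> S" "b \<in> S" "a \<noteq> b" for a b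
    proof -
      have "entry a \<noteq> entry b" using ab(3) by (simp add: entry_inject)
      then obtain i where i: "entry a i \<noteq> entry b i" by blast
      then have iF: "i \<in> coords \<F>" using ab(1,2) by (auto simp: S_def e_def e0_def split: if_splits)
      have c: "continuous_on S (\<lambda>s. Re (entry s i))" "continuous_on S (\<lambda>s. Im (entry s i))"
        by (intro continuous_intros continuous_on_entry)+
      have "(\<lambda>s. Re (entry s i)) \<in> R" "(\<lambda>s. Im (entry s i)) \<in> R"
        unfolding R_def using c approximated_by_circ[OF iF] iF by (simp_all add: e_def e0_def)
      moreover have "Re (entry a i) \<noteq> Re (entry b i) \<or> Im (entry a i) \<noteq> Im (entry b i)"
        using i by (auto simp: complex_eq_iff)
      ultimately show ?thesis by (metis (no_types, lifting))
    qed
  qed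
  then obtain s where s: "s \<in> R" "\<forall>a\<in>S. \<bar>(r \<circ> e') a - s a\<bar> < \<epsilon>"
    using function_ring_on.Stone_Weierstrass_basic[OF _ r_cont \<open>\<epsilon> > 0\<close>] by blast
  obtain \<E> N D where ap: "approximated_by \<F> \<E> (\<lambda>p. s (e p)) N D 0" using s(1) by (auto simp: R_def)
  have "\<bar>r p - s (e p)\<bar> < \<epsilon>" if "p \<in> graphoid \<F>" for p
    using s(2) that inv[OF that] by (auto simp: S_def)
  then have "approximated_by \<F> \<E> r N D \<epsilon>"
    using ap unfolding approximated_by_def by fastforce
  then show ?thesis by blast
qed

section \<open>The lower bound\<close>

text \<open>
  These bounds determine the signs of the components of the map to the plane that is used for the
  lower bound.
\<close>

lemma circ_sectors:
  shows "\<bar>y\<bar> \<le> 1 \<Longrightarrow> Re (circ (Some y)) \<ge> 0"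
    and "\<bar>y\<bar> \<ge> 2 \<Longrightarrow> Re (circ (Some y)) \<le> - 3 / 5"
    and "1 \<le> y \<Longrightarrow> y \<le> 2 \<Longrightarrow> Im (circ (Some y)) \<ge> 4 / 5"
    and "- 2 \<le> y \<Longrightarrow> y \<le> -1 \<Longrightarrow> Im (circ (Some y)) \<le> - 4 / 5"
    and "Re (circ (Some y)) \<le> 1" "\<bar>Im (circ (Some y))\<bar> \<le> 1" "\<bar>Re (circ (Some y))\<bar> \<le> 1"
proof -
  have pos: "1 + y\<^sup>2 > 0" by (simp add: add_pos_nonneg)
  show "Re (circ (Some y)) \<ge> 0" if "\<bar>y\<bar> \<le> 1"
    unfolding Re_circ using that pos by (simp add: abs_square_le_1)
  show "Re (circ (Some y)) \<le> - 3 / 5" if "\<bar>y\<bar> \<ge> 2"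
  proof -
    have "y\<^sup>2 \<ge> 4" using power_mono[OF that, of 2] by simp
    then have "1 - y\<^sup>2 \<le> - 3 / 5 * (1 + y\<^sup>2)" by (simp add: field_simps)
    then show ?thesis unfolding Re_circ pos_divide_le_eq[OF pos] .
  qed
  show "Im (circ (Some y)) \<ge> 4 / 5" if "1 \<le> y" "y \<le> 2"
  proof -
    have "(2 * y - 1) * (2 - y) \<ge> 0" using that by simp
    then have "4 / 5 * (1 + y\<^sup>2) \<le> 2 * y" by (simp add: algebra_simps power2_eq_square)
    then show ?thesis unfolding Im_circ pos_le_divide_eq[OF pos] by linarith
  qed
  show "Im (circ (Some y)) \<le> - 4 / 5" if "- 2 \<le> y" "y \<le> - 1"
  proof -
    have "(- 2 * y - 1) * (2 + y) \<ge> 0" using that by (intro mult_nonneg_nonneg) auto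
    then have "2 * y \<le> - 4 / 5 * (1 + y\<^sup>2)" by (simp add: field_simps power2_eq_square)
    then show ?thesis unfolding Im_circ pos_divide_le_eq[OF pos] .
  qed
  show "\<bar>Re (circ (Some y))\<bar> \<le> 1"
    unfolding Re_circ using pos by (simp add: abs_le_iff pos_divide_le_eq pos_le_divide_eq)
  then show "Re (circ (Some y)) \<le> 1" by linarith
  have "2 * \<bar>y\<bar> \<le> 1 + y\<^sup>2" using sum_squares_bound[of 1 "\<bar>y\<bar>"] by simp
  then show "\<bar>Im (circ (Some y))\<bar> \<le> 1"
    unfolding Im_circ using pos by (simp add: abs_mult)
qed

lemma circ_Re_Im_bounded: "\<bar>Re (circ v)\<bar> \<le> 1" "\<bar>Im (circ v)\<bar> \<le> 1"
proof -
  have "\<bar>Re (circ v)\<bar> \<le> 1 \<and> \<bar>Im (circ v)\<bar> \<le> 1"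
    by (cases v) (simp_all add: circ_sectors(6,7))
  then show "\<bar>Re (circ v)\<bar> \<le> 1" "\<bar>Im (circ v)\<bar> \<le> 1" by auto
qed

lemma eventually_Im_circ:
  "eventually (\<lambda>x. Im (circ (Some x)) > 9/10) (at 1)" "eventually (\<lambda>x. Im (circ (Some x)) < -9/10) (at (-1))"
proof -
  have lim: "((\<lambda>x. Im (circ (Some x))) \<longlongrightarrow> 2 * a / (1 + a\<^sup>2)) (at a)" for a :: real
  proof -
    have "1 + a\<^sup>2 \<noteq> 0" by (metis add_pos_nonneg less_irrefl zero_le_power2 zero_less_one)
    then show ?thesis unfolding Im_circ by (intro tendsto_intros)
  qed
  show "eventually (\<lambda>x. Im (circ (Some x)) > 9/10) (at 1)" using order_tendstoD(1)[OF lim, of "9/10" 1] by simp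
  show "eventually (\<lambda>x. Im (circ (Some x)) < -9/10) (at (-1))" using order_tendstoD(2)[OF lim, of "-1" "-9/10"] by simp
qed

lemma compact_positive_lower_bound:
  assumes "compact_space X" "continuous_map X euclideanreal f" "\<And>x. x \<in> topspace X \<Longrightarrow> f x > 0"
  shows "\<exists>\<delta>>0. \<forall>x\<in>topspace X. f x \<ge> \<delta>"
proof (cases "topspace X = {}")
  case False
  have "compactin euclideanreal (f ` topspace X)"
    using image_compactin assms(1,2) unfolding compact_space_def by blast
  then have "compact (f ` topspace X)" by simp
  then obtain s where "s \<in> f ` topspace X" "\<forall>t\<in>f ` topspace X. s \<le> t"
    using compact_attains_inf False by blast
  then show ?thesis using assms(3) by auto
qed (auto intro: exI[of _ 1])

text \<open>
  The map \<open>(\<Phi>\<^sub>1, \<Phi>\<^sub>2)\<close> of the torus to the plane is chosen such that over the strip \<open>-1 \<le> x \<le> 1\<close> the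
  zeros of \<open>\<Phi>\<^sub>2\<close> are at \<open>y = 0\<close> and \<open>y = \<infinity>\<close>, where \<open>\<Phi>\<^sub>1\<close> is \<open>Im (circ x)\<close> plus \<open>2/5\<close> and minus \<open>8/5\<close>,
  respectively. So it crosses the origin over the strip once, and it satisfies the conditions of
  \<open>bounded_rational_miranda\<close> on the lines near \<open>x = -1\<close> and \<open>x = 1\<close> with room for perturbations
  smaller than \<open>1/10\<close>.
\<close>

theorem not_covering_dim_graphoid_le_1: "\<not> covering_dim_le (graphoid_space \<F>) 1"
proof
  assume dim: "covering_dim_le (graphoid_space \<F>) 1"
  let ?X = "graphoid_space \<F>"
  define \<Phi>\<^sub>1 where "\<Phi>\<^sub>1 p = Im (circ (coord_of Abscissa p)) + Re (circ (coord_of Ordinate p)) - 3/5" for p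
  define \<Phi>\<^sub>2 where "\<Phi>\<^sub>2 p = Im (circ (coord_of Ordinate p))" for p
  have cc: "continuous_map ?X euclideanreal (\<lambda>p. Re (circ (coord_of i p)))"
    "continuous_map ?X euclideanreal (\<lambda>p. Im (circ (coord_of i p)))" if "i \<in> coords \<F>" for i
  proof -
    have "continuous_map ?X euclidean (circ \<circ> coord_of i)"
      by (rule continuous_map_compose[OF continuous_map_coord_of[OF that] continuous_map_circ])
    moreover have "continuous_map euclidean euclideanreal Re" "continuous_map euclidean euclideanreal Im"
      by (simp_all add: continuous_on_Re continuous_on_Im)
    ultimately have "continuous_map ?X euclideanreal (Re \<circ> (circ \<circ> coord_of i))"
      "continuous_map ?X euclideanreal (Im \<circ> (circ \<circ> coord_of i))"
      by (blast intro: continuous_map_compose)+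
    then show "continuous_map ?X euclideanreal (\<lambda>p. Re (circ (coord_of i p)))"
      "continuous_map ?X euclideanreal (\<lambda>p. Im (circ (coord_of i p)))" by (simp_all add: o_def)
  qed
  have mem: "Abscissa \<in> coords \<F>" "Ordinate \<in> coords \<F>" by (auto simp: coords_def)
  have c1: "continuous_map ?X euclideanreal \<Phi>\<^sub>1"
    unfolding \<Phi>\<^sub>1_def by (intro continuous_map_diff continuous_map_add cc mem) simp
  have c2: "continuous_map ?X euclideanreal \<Phi>\<^sub>2"
    unfolding \<Phi>\<^sub>2_def by (intro cc mem)
  obtain g h where gh: "continuous_map ?X euclideanreal g" "continuous_map ?X euclideanreal h"
    and gh_close: "\<And>p. p \<in> graphoid \<F> \<Longrightarrow> \<bar>g p - \<Phi>\<^sub>1 p\<bar> < 1/20 \<and> \<bar>h p - \<Phi>\<^sub>2 p\<bar> < 1/20 \<and> (g p \<noteq> 0 \<or> h p \<noteq> 0)"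
    using covering_dim_le_1_perturb_off_origin[OF compact_graphoid_space Hausdorff_graphoid_space dim c1 c2, of "1/20"]
    by auto
  have cont: "continuous_map ?X euclideanreal (\<lambda>p. \<bar>g p\<bar> + \<bar>h p\<bar>)"
    by (intro continuous_map_add continuous_map_real_abs gh)
  have pos: "\<bar>g p\<bar> + \<bar>h p\<bar> > 0" if "p \<in> topspace ?X" for p using gh_close[of p] that by auto
  obtain \<delta> where \<delta>: "\<delta> > 0" "\<And>p. p \<in> graphoid \<F> \<Longrightarrow> \<bar>g p\<bar> + \<bar>h p\<bar> \<ge> \<delta>"
    using compact_positive_lower_bound[OF compact_graphoid_space cont pos] by auto
  \<comment> \<open>After an approximation up to \<open>\<epsilon>\<close> the components still deviate from \<open>\<Phi>\<^sub>1\<close> and \<open>\<Phi>\<^sub>2\<close> by less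
    than \<open>1/10\<close>, and the sum of their absolute values is at least \<open>\<delta>/2\<close>.\<close>
  define \<epsilon> where "\<epsilon> = min (1/20) (\<delta>/4)"
  have \<epsilon>: "\<epsilon> > 0" "\<epsilon> \<le> 1/20" "\<epsilon> \<le> \<delta>/4" using \<delta> by (auto simp: \<epsilon>_def)
  obtain \<E>\<^sub>1 N\<^sub>1 D\<^sub>1 where ap1: "approximated_by \<F> \<E>\<^sub>1 g N\<^sub>1 D\<^sub>1 \<epsilon>"
    using graphoid_rational_approximation[OF gh(1) \<epsilon>(1)] by blast
  obtain \<E>\<^sub>2 N\<^sub>2 D\<^sub>2 where ap2: "approximated_by \<F> \<E>\<^sub>2 h N\<^sub>2 D\<^sub>2 \<epsilon>"
    using graphoid_rational_approximation[OF gh(2) \<epsilon>(1)] by blast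
  define \<E> where "\<E> = \<E>\<^sub>1 \<union> \<E>\<^sub>2"
  have \<E>: "finite \<E>" "\<E> \<subseteq> \<F>" using ap1 ap2 by (auto simp: \<E>_def approximated_by_def)
  define B where "B = (\<Union>i\<in>Ratfun ` \<E>. {x. \<exists>y. \<not> regular_at i x y})"
  have B: "finite B" unfolding B_def using \<E>(1) finite_irregular_lines by (intro finite_UN_I) auto
  define G where "G = N\<^sub>1 * D\<^sub>2"
  define H where "H = N\<^sub>2 * D\<^sub>1"
  define D where "D = D\<^sub>1 * D\<^sub>2"
  have key: "eval2 D x y > 0 \<and> (\<exists>g' h'. eval2 G x y = g' * eval2 D x y \<and> eval2 H x y = h' * eval2 D x y \<and>
      \<bar>g' - (Im (circ (Some x)) + Re (circ (Some y)) - 3/5)\<bar> < 1/10 \<and> \<bar>h' - Im (circ (Some y))\<bar> < 1/10 \<and>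
      \<bar>g'\<bar> + \<bar>h'\<bar> \<ge> \<delta>/2)" if x: "x \<notin> B" for x y
  proof -
    have reg: "regular_at (Ratfun f) x y" if "f \<in> \<E>" for f using x that by (auto simp: B_def)
    obtain p where p: "p \<in> graphoid \<F>" "\<And>i. i \<in> coords \<E> \<Longrightarrow> coord_of i p = coord_val i x y"
      using graphoid_point_over[OF \<E> reg] by blast
    have sub: "coords \<E>\<^sub>1 \<subseteq> coords \<E>" "coords \<E>\<^sub>2 \<subseteq> coords \<E>" by (auto simp: \<E>_def coords_def)
    have e1: "eval2 D\<^sub>1 x y > 0" "\<bar>g p - eval2 N\<^sub>1 x y / eval2 D\<^sub>1 x y\<bar> \<le> \<epsilon>"
    proof -
      have "\<forall>f\<in>\<E>\<^sub>1. regular_at (Ratfun f) x y" using reg by (simp add: \<E>_def)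
      from ap1[unfolded approximated_by_def, THEN conjunct2, THEN conjunct2, THEN spec, THEN spec, THEN mp, OF this]
      have "eval2 D\<^sub>1 x y > 0 \<and> (\<forall>p\<in>graphoid \<F>. (\<forall>i\<in>coords \<E>\<^sub>1. coord_of i p = coord_val i x y) \<longrightarrow>
          \<bar>g p - eval2 N\<^sub>1 x y / eval2 D\<^sub>1 x y\<bar> \<le> \<epsilon>)" .
      moreover have "\<forall>i\<in>coords \<E>\<^sub>1. coord_of i p = coord_val i x y" using p(2) sub by blast
      ultimately show "eval2 D\<^sub>1 x y > 0" "\<bar>g p - eval2 N\<^sub>1 x y / eval2 D\<^sub>1 x y\<bar> \<le> \<epsilon>"
        using p(1) by blast+
    qed
    have e2: "eval2 D\<^sub>2 x y > 0" "\<bar>h p - eval2 N\<^sub>2 x y / eval2 D\<^sub>2 x y\<bar> \<le> \<epsilon>"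
    proof -
      have "\<forall>f\<in>\<E>\<^sub>2. regular_at (Ratfun f) x y" using reg by (simp add: \<E>_def)
      from ap2[unfolded approximated_by_def, THEN conjunct2, THEN conjunct2, THEN spec, THEN spec, THEN mp, OF this]
      have "eval2 D\<^sub>2 x y > 0 \<and> (\<forall>p\<in>graphoid \<F>. (\<forall>i\<in>coords \<E>\<^sub>2. coord_of i p = coord_val i x y) \<longrightarrow>
          \<bar>h p - eval2 N\<^sub>2 x y / eval2 D\<^sub>2 x y\<bar> \<le> \<epsilon>)" .
      moreover have "\<forall>i\<in>coords \<E>\<^sub>2. coord_of i p = coord_val i x y" using p(2) sub by blast
      ultimately show "eval2 D\<^sub>2 x y > 0" "\<bar>h p - eval2 N\<^sub>2 x y / eval2 D\<^sub>2 x y\<bar> \<le> \<epsilon>"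
        using p(1) by blast+
    qed
    let ?g = "eval2 N\<^sub>1 x y / eval2 D\<^sub>1 x y" and ?h = "eval2 N\<^sub>2 x y / eval2 D\<^sub>2 x y"
    have "coord_of Abscissa p = Some x" "coord_of Ordinate p = Some y"
      using p(2)[of Abscissa] p(2)[of Ordinate] by (auto simp: coords_def)
    then have \<Phi>: "\<Phi>\<^sub>1 p = Im (circ (Some x)) + Re (circ (Some y)) - 3/5" "\<Phi>\<^sub>2 p = Im (circ (Some y))"
      by (simp_all add: \<Phi>\<^sub>1_def \<Phi>\<^sub>2_def)
    have "\<bar>g p - \<Phi>\<^sub>1 p\<bar> < 1/20" "\<bar>h p - \<Phi>\<^sub>2 p\<bar> < 1/20" "\<bar>g p\<bar> + \<bar>h p\<bar> \<ge> \<delta>"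
      using gh_close[OF p(1)] \<delta>(2)[OF p(1)] by auto
    then have "\<bar>?g - \<Phi>\<^sub>1 p\<bar> < 1/10" "\<bar>?h - \<Phi>\<^sub>2 p\<bar> < 1/10" "\<bar>?g\<bar> + \<bar>?h\<bar> \<ge> \<delta>/2"
      using e1(2) e2(2) \<epsilon> by linarith+
    moreover have "eval2 G x y = ?g * eval2 D x y" "eval2 H x y = ?h * eval2 D x y" "eval2 D x y > 0"
      using e1(1) e2(1) by (simp_all add: G_def H_def D_def)
    ultimately show ?thesis unfolding \<Phi> by blast
  qed
  show False
  proof (rule bounded_rational_miranda[where \<delta> = "\<delta>/2" and B = B and D = D and M = 3 and G = G and H = H and a = "-1" and b = 1])
    show "0 < \<delta>/2" using \<delta> by simp
    show "finite B" by (rule B)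
    fix x y assume x: "x \<notin> B"
    obtain g' h' where k: "eval2 D x y > 0" "eval2 G x y = g' * eval2 D x y" "eval2 H x y = h' * eval2 D x y"
      "\<bar>g' - (Im (circ (Some x)) + Re (circ (Some y)) - 3/5)\<bar> < 1/10" "\<bar>g'\<bar> + \<bar>h'\<bar> \<ge> \<delta>/2"
      using key[OF x, of y] by blast
    show "eval2 D x y > 0" by (rule k(1))
    have "\<bar>g'\<bar> \<le> 3" using k(4) circ_Re_Im_bounded[of "Some x"] circ_Re_Im_bounded[of "Some y"] by linarith
    then show "\<bar>eval2 G x y\<bar> \<le> 3 * eval2 D x y" using k(1,2) by (simp add: abs_mult)
    show "\<bar>eval2 G x y\<bar> \<ge> \<delta>/2 * eval2 D x y" if "eval2 H x y = 0"
    proof -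
      have "h' = 0" using that k(1,3) by simp
      then have "\<delta>/2 \<le> \<bar>g'\<bar>" using k(5) by simp
      then have "\<delta>/2 * eval2 D x y \<le> \<bar>g'\<bar> * eval2 D x y" using k(1) by (intro mult_right_mono) auto
      then show ?thesis using k(1,2) by (simp add: abs_mult)
    qed
  next
    show "eventually (\<lambda>x. \<forall>y. eval2 G x y < 0) (at (-1))"
      using eventually_at_notin_finite[OF B] eventually_Im_circ(2)
    proof eventually_elim
      case (elim x)
      show ?case
      proof
        fix y
        obtain g' where k: "eval2 D x y > 0" "eval2 G x y = g' * eval2 D x y"
          "\<bar>g' - (Im (circ (Some x)) + Re (circ (Some y)) - 3/5)\<bar> < 1/10"
          using key[OF elim(1), of y] by blast
        have "g' < 0" using k(3) elim(2) circ_sectors(5)[of y] by linarith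
        then show "eval2 G x y < 0" using k by (simp add: mult_neg_pos)
      qed
    qed
    show "eventually (\<lambda>x. \<forall>y. (\<bar>y\<bar> \<le> 1 \<longrightarrow> eval2 G x y > 0) \<and> (\<bar>y\<bar> \<ge> 2 \<longrightarrow> eval2 G x y < 0)
               \<and> (1 \<le> y \<and> y \<le> 2 \<longrightarrow> eval2 H x y > 0) \<and> (- 2 \<le> y \<and> y \<le> -1 \<longrightarrow> eval2 H x y < 0)) (at 1)"
      using eventually_at_notin_finite[OF B] eventually_Im_circ(1)
    proof eventually_elim
      case (elim x)
      show ?case
      proof (intro allI conjI impI)
        fix y
        obtain g' h' where k: "eval2 D x y > 0" "eval2 G x y = g' * eval2 D x y" "eval2 H x y = h' * eval2 D x y"
          "\<bar>g' - (Im (circ (Some x)) + Re (circ (Some y)) - 3/5)\<bar> < 1/10" "\<bar>h' - Im (circ (Some y))\<bar> < 1/10"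
          using key[OF elim(1), of y] by blast
        have x1: "Im (circ (Some x)) \<le> 1" using circ_Re_Im_bounded(2)[of "Some x"] by linarith
        show "eval2 G x y > 0" if "\<bar>y\<bar> \<le> 1"
        proof -
          have "g' > 0" using k(4) elim(2) circ_sectors(1)[OF that] by linarith
          then show ?thesis using k by simp
        qed
        show "eval2 G x y < 0" if "2 \<le> \<bar>y\<bar>"
        proof -
          have "g' < 0" using k(4) x1 circ_sectors(2)[OF that] by linarith
          then show ?thesis using k by (simp add: mult_neg_pos)
        qed
        show "eval2 H x y > 0" if "1 \<le> y \<and> y \<le> 2"
        proof -
          have "h' > 0" using k(5) circ_sectors(3)[of y] that by linarith
          then show ?thesis using k by simp
        qed
        show "eval2 H x y < 0" if "- 2 \<le> y \<and> y \<le> -1"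
        proof -
          have "h' < 0" using k(5) circ_sectors(4)[of y] that by linarith
          then show ?thesis using k by (simp add: mult_neg_pos)
        qed
      qed
    qed
  qed
qed

lemma covering_dim_le_mono:
  assumes "covering_dim_le X m" "m \<le> n"
  shows "covering_dim_le X n"
  unfolding covering_dim_le_def
proof (intro conjI allI impI)
  show "-1 \<le> n" using assms by (simp add: covering_dim_le_def)
  fix \<U> assume "finite \<U> \<and> open_cover X \<U>"
  with assms(1) obtain \<V> where "finite \<V> \<and> open_cover X \<V> \<and> (\<forall>V\<in>\<V>. \<exists>U\<in>\<U>. V \<subseteq> U)"
    and card: "\<forall>x\<in>topspace X. int (card {V\<in>\<V>. x \<in> V}) \<le> m + 1"
    unfolding covering_dim_le_def by blast
  moreover have "\<forall>x\<in>topspace X. int (card {V\<in>\<V>. x \<in> V}) \<le> n + 1"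
    using card assms(2) by fastforce
  ultimately show "\<exists>\<V>. finite \<V> \<and> open_cover X \<V> \<and> (\<forall>V\<in>\<V>. \<exists>U\<in>\<U>. V \<subseteq> U) \<and>
      (\<forall>x\<in>topspace X. int (card {V\<in>\<V>. x \<in> V}) \<le> n + 1)"
    by blast
qed

theorem theorem1p2:
  fixes \<F> :: "ratfun2 set"
  shows "covering_dim (graphoid_space \<F>) = 2"
  unfolding covering_dim_def
proof (rule antisym)
  have "ereal (of_int 2) \<in> {ereal (of_int n) |n. covering_dim_le (graphoid_space \<F>) n}"
    using covering_dim_graphoid_le_2 by blast
  from Inf_lower[OF this] show "Inf {ereal (of_int n) |n. covering_dim_le (graphoid_space \<F>) n} \<le> 2"
    by simp
  show "2 \<le> Inf {ereal (of_int n) |n. covering_dim_le (graphoid_space \<F>) n}"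
  proof (rule Inf_greatest)
    fix e assume "e \<in> {ereal (of_int n) |n. covering_dim_le (graphoid_space \<F>) n}"
    then obtain n where n: "e = ereal (of_int n)" "covering_dim_le (graphoid_space \<F>) n" by blast
    have "\<not> n \<le> 1" using n(2) covering_dim_le_mono not_covering_dim_graphoid_le_1 by blast
    then have "2 \<le> real_of_int n" by linarith
    then show "2 \<le> e" by (simp add: n(1))
  qed
qed

end
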